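(* Let $M$ be an $L$-structure, $T={\rm Th}(M)$, $G=G(M)$ an infinite group $0$-definable in $M$, and let $M\preceq^* N$. Assume every minimal left ideal of the semigroup $(S_{ext,G}(N),* )$ is a group. Then every Ellis group of $S_{ext,G}(M)$ is isomorphic to some (topologically) closed subgroup of an Ellis group of $S_{ext,G}(N)$.
   Context: All models are elementary substructures of a monster model $\mathfrak{M}$ of $T$; for $N\equiv M$, $G(N)$ is the group defined in $N$ by the same formula. A subset of $M^n$ is externally definable if it equals $X\cap M^n$ for some $X$ definable in $\mathfrak{M}$ with parameters from $\mathfrak{M}$; ${\rm Def}_{ext}(M)$ is the family of all externally definable subsets of powers of $M$ and ${\rm Def}_{ext,G}(M)$ the family of externally definable subsets of $G(M)$. $S_{ext,G}(M)$ is the Stone space of ultrafilters of the Boolean algebra ${\rm Def}_{ext,G}(M)$ (a $G(M)$-flow by left translation). For $p\in S_{ext,G}(M)$ and $A\in{\rm Def}_{ext,G}(M)$, $d_p(A)=\{g\in G(M):g^{-1}A\in p\}$, which again lies in ${\rm Def}_{ext,G}(M)$; the semigroup operation on $S_{ext,G}(M)$ is $A\in p*q\iff d_q(A)\in p$ (compact Hausdorff, continuous in the first coordinate, isomorphic to the Ellis semigroup of the flow). The Ellis groups are the groups $u*I$, $I$ a minimal left ideal of $(S_{ext,G}(M),* )$, $u\in I$ an idempotent. Let $L_{ext,M}=L\cup\{P_U:U\in{\rm Def}_{ext}(M)\}$ with new relation symbols, and $M_{ext}$ the expansion of $M$ interpreting $P_U$ as $U$. $M\preceq^* N$ means $M\preceq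 N$ and each symbol $P_U$ of $L_{ext,M}$ is identified with a symbol $P_{U'}$ of $L_{ext,N}$ ($U'\in{\rm Def}_{ext}(N)$) so that $M_{ext}\preceq N_{ext}|_{L_{ext,M}}$. The same notions are defined for $N$ and $G(N)$. *)

theory Defs
  imports "HOL-Algebra.Coset" "HOL-Analysis.Abstract_Topology"
begin

unbundle cardinal_syntax

section \<open>First-order logic\<close>

record ('f, 'r) lang =
  funs :: "'f set"
  fun_ar :: "'f \<Rightarrow> nat"
  rels :: "'r set"
  rel_ar :: "'r \<Rightarrow> nat"

record ('f, 'r, 'a) struct =
  univ :: "'a set"
  fun_of :: "'f \<Rightarrow> 'a list \<Rightarrow> 'a"
  rel_of :: "'r \<Rightarrow> 'a list \<Rightarrow> bool"

datatype 'f tm = Var nat | Fun 'f "'f tm list"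

datatype ('f, 'r) fm =
    Eq "'f tm" "'f tm"
  | Rel 'r "'f tm list"
  | Neg "('f, 'r) fm"
  | And "('f, 'r) fm" "('f, 'r) fm"
  | Ex nat "('f, 'r) fm"

fun wf_tm :: "('f, 'r) lang \<Rightarrow> 'f tm \<Rightarrow> bool" where
  "wf_tm L (Var i) \<longleftrightarrow> True"
| "wf_tm L (Fun f ts) \<longleftrightarrow> f \<in> funs L \<and> length ts = fun_ar L f \<and> (\<forall>t\<in>set ts. wf_tm L t)"

fun wf_fm :: "('f, 'r) lang \<Rightarrow> ('f, 'r) fm \<Rightarrow> bool" where
  "wf_fm L (Eq s t) \<longleftrightarrow> wf_tm L s \<and> wf_tm L t"
| "wf_fm L (Rel r ts) \<longleftrightarrow> r \<in> rels L \<and> length ts = rel_ar L r \<and> (\<forall>t\<in>set ts. wf_tm L t)"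
| "wf_fm L (Neg \<phi>) \<longleftrightarrow> wf_fm L \<phi>"
| "wf_fm L (And \<phi> \<psi>) \<longleftrightarrow> wf_fm L \<phi> \<and> wf_fm L \<psi>"
| "wf_fm L (Ex v \<phi>) \<longleftrightarrow> wf_fm L \<phi>"

fun fv_tm :: "'f tm \<Rightarrow> nat set" where
  "fv_tm (Var i) = {i}"
| "fv_tm (Fun f ts) = (\<Union>t\<in>set ts. fv_tm t)"

fun fv_fm :: "('f, 'r) fm \<Rightarrow> nat set" where
  "fv_fm (Eq s t) = fv_tm s \<union> fv_tm t"
| "fv_fm (Rel r ts) = (\<Union>t\<in>set ts. fv_tm t)"
| "fv_fm (Neg \<phi>) = fv_fm \<phi>"
| "fv_fm (And \<phi> \<psi>) = fv_fm \<phi> \<union> fv_fm \<psi>"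
| "fv_fm (Ex v \<phi>) = fv_fm \<phi> - {v}"

fun eval_tm :: "('f, 'r, 'a) struct \<Rightarrow> (nat \<Rightarrow> 'a) \<Rightarrow> 'f tm \<Rightarrow> 'a" where
  "eval_tm A e (Var i) = e i"
| "eval_tm A e (Fun f ts) = fun_of A f (map (eval_tm A e) ts)"

fun sat :: "('f, 'r, 'a) struct \<Rightarrow> ('f, 'r) fm \<Rightarrow> (nat \<Rightarrow> 'a) \<Rightarrow> bool" where
  "sat A (Eq s t) e \<longleftrightarrow> eval_tm A e s = eval_tm A e t"
| "sat A (Rel r ts) e \<longleftrightarrow> rel_of A r (map (eval_tm A e) ts)"
| "sat A (Neg \<phi>) e \<longleftrightarrow> \<not> sat A \<phi> e"
| "sat A (And \<phi> \<psi>) e \<longleftrightarrow> sat A \<phi> e \<and> sat A \<psi> e"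
| "sat A (Ex v \<phi>) e \<longleftrightarrow> (\<exists>a\<in>univ A. sat A \<phi> (e(v := a)))"

definition is_struct :: "('f, 'r) lang \<Rightarrow> ('f, 'r, 'a) struct \<Rightarrow> bool" where
  "is_struct L A \<longleftrightarrow> univ A \<noteq> {} \<and>
     (\<forall>f\<in>funs L. \<forall>xs. set xs \<subseteq> univ A \<and> length xs = fun_ar L f \<longrightarrow> fun_of A f xs \<in> univ A)"

definition substruct :: "('f, 'r) lang \<Rightarrow> ('f, 'r, 'a) struct \<Rightarrow> ('f, 'r, 'a) struct \<Rightarrow> bool" where
  "substruct L A B \<longleftrightarrow> is_struct L A \<and> is_struct L B \<and> univ A \<subseteq> univ B \<and>
     (\<forall>f\<in>funs L. \<forall>xs. set xs \<subseteq> univ A \<and> length xs = fun_ar L f \<longrightarrow> fun_of A f xs = fun_of B f xs) \<and>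
     (\<forall>r\<in>rels L. \<forall>xs. set xs \<subseteq> univ A \<and> length xs = rel_ar L r \<longrightarrow> rel_of A r xs = rel_of B r xs)"

definition elem_substruct :: "('f, 'r) lang \<Rightarrow> ('f, 'r, 'a) struct \<Rightarrow> ('f, 'r, 'a) struct \<Rightarrow> bool" where
  "elem_substruct L A B \<longleftrightarrow> substruct L A B \<and>
     (\<forall>\<phi> e. wf_fm L \<phi> \<and> range e \<subseteq> univ A \<longrightarrow> (sat A \<phi> e \<longleftrightarrow> sat B \<phi> e))"

definition power_of :: "('f, 'r, 'a) struct \<Rightarrow> nat \<Rightarrow> 'a list set" where
  "power_of A k = {xs. set xs \<subseteq> univ A \<and> length xs = k}"

text \<open>
  A formula with parameters is a pair of a formula and a parameter list. In k object variables,
  the variables below k are the object variables and the following ones stand for the parameters.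
  The values of \<open>nth\<close> beyond the end of the list are irrelevant because of the bound on the
  free variables.
\<close>

definition param_fms :: "('f, 'r) lang \<Rightarrow> nat \<Rightarrow> 'a set \<Rightarrow> (('f, 'r) fm \<times> 'a list) set" where
  "param_fms L k C =
     {(\<phi>, cs). wf_fm L \<phi> \<and> set cs \<subseteq> C \<and> fv_fm \<phi> \<subseteq> {..<k + length cs}}"

definition solutions :: "('f, 'r, 'a) struct \<Rightarrow> nat \<Rightarrow> ('f, 'r) fm \<times> 'a list \<Rightarrow> 'a list set" where
  "solutions A k = (\<lambda>(\<phi>, cs). {xs \<in> power_of A k. sat A \<phi> (nth (xs @ cs))})"


section \<open>Monster models\<close>

definition saturated :: "('f, 'r) lang \<Rightarrow> 'k rel \<Rightarrow> ('f, 'r, 'a) struct \<Rightarrow> bool" where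
  "saturated L \<kappa> A \<longleftrightarrow>
     (\<forall>k C \<Sigma>. C \<subseteq> univ A \<and> |C| <o \<kappa> \<and> \<Sigma> \<subseteq> param_fms L k C \<and>
        (\<forall>\<Delta>\<subseteq>\<Sigma>. finite \<Delta> \<longrightarrow> (\<exists>xs\<in>power_of A k. \<forall>\<sigma>\<in>\<Delta>. xs \<in> solutions A k \<sigma>))
      \<longrightarrow> (\<exists>xs\<in>power_of A k. \<forall>\<sigma>\<in>\<Sigma>. xs \<in> solutions A k \<sigma>))"

definition partial_elementary ::
    "('f, 'r) lang \<Rightarrow> ('f, 'r, 'a) struct \<Rightarrow> 'a set \<Rightarrow> ('a \<Rightarrow> 'a) \<Rightarrow> bool" where
  "partial_elementary L A C h \<longleftrightarrow> C \<subseteq> univ A \<and> h ` C \<subseteq> univ A \<and>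
     (\<forall>\<phi> cs. wf_fm L \<phi> \<and> set cs \<subseteq> C \<and> fv_fm \<phi> \<subseteq> {..<length cs} \<longrightarrow>
        (sat A \<phi> (nth cs) \<longleftrightarrow> sat A \<phi> (nth (map h cs))))"

definition automorphism :: "('f, 'r) lang \<Rightarrow> ('f, 'r, 'a) struct \<Rightarrow> ('a \<Rightarrow> 'a) \<Rightarrow> bool" where
  "automorphism L A h \<longleftrightarrow> bij_betw h (univ A) (univ A) \<and>
     (\<forall>f\<in>funs L. \<forall>xs. set xs \<subseteq> univ A \<and> length xs = fun_ar L f \<longrightarrow>
        h (fun_of A f xs) = fun_of A f (map h xs)) \<and>
     (\<forall>r\<in>rels L. \<forall>xs. set xs \<subseteq> univ A \<and> length xs = rel_ar L r \<longrightarrow>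
        rel_of A r xs = rel_of A r (map h xs))"

definition strongly_homogeneous :: "('f, 'r) lang \<Rightarrow> 'k rel \<Rightarrow> ('f, 'r, 'a) struct \<Rightarrow> bool" where
  "strongly_homogeneous L \<kappa> A \<longleftrightarrow>
     (\<forall>C h. |C| <o \<kappa> \<and> partial_elementary L A C h \<longrightarrow>
        (\<exists>h'. automorphism L A h' \<and> (\<forall>c\<in>C. h' c = h c)))"

definition monster :: "('f, 'r) lang \<Rightarrow> 'k rel \<Rightarrow> ('f, 'r, 'a) struct \<Rightarrow> bool" where
  "monster L \<kappa> \<MM> \<longleftrightarrow> is_struct L \<MM> \<and> Cinfinite \<kappa> \<and> |funs L| <o \<kappa> \<and> |rels L| <o \<kappa> \<and>
     saturated L \<kappa> \<MM> \<and> strongly_homogeneous L \<kappa> \<MM>"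

definition small_model ::
    "('f, 'r) lang \<Rightarrow> 'k rel \<Rightarrow> ('f, 'r, 'a) struct \<Rightarrow> ('f, 'r, 'a) struct \<Rightarrow> bool" where
  "small_model L \<kappa> \<MM> M \<longleftrightarrow> elem_substruct L M \<MM> \<and> |univ M| <o \<kappa>"


section \<open>Externally definable sets and the expansion by them\<close>

text \<open>
  Externally definable sets are tagged with their arity, since the empty set is a subset of
  every power and would otherwise not determine a relation symbol.
\<close>

definition Def_ext ::
    "('f, 'r) lang \<Rightarrow> ('f, 'r, 'a) struct \<Rightarrow> ('f, 'r, 'a) struct \<Rightarrow> (nat \<times> 'a list set) set" where
  "Def_ext L \<MM> M =
     {(k, solutions \<MM> k \<sigma> \<inter> power_of M k) | k \<sigma>. \<sigma> \<in> param_fms L k (univ \<MM>)}"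

definition ext_lang ::
    "('f, 'r) lang \<Rightarrow> ('f, 'r, 'a) struct \<Rightarrow> ('f, 'r, 'a) struct
     \<Rightarrow> ('f, 'r + nat \<times> 'a list set) lang" where
  "ext_lang L \<MM> M =
     \<lparr>funs = funs L, fun_ar = fun_ar L,
      rels = Inl ` rels L \<union> Inr ` Def_ext L \<MM> M, rel_ar = case_sum (rel_ar L) fst\<rparr>"

definition ext_struct ::
    "('f, 'r, 'a) struct \<Rightarrow> ('f, 'r + nat \<times> 'a list set, 'a) struct" where
  "ext_struct M =
     \<lparr>univ = univ M, fun_of = fun_of M,
      rel_of = case_sum (rel_of M) (\<lambda>(k, U) xs. xs \<in> U)\<rparr>"

text \<open>
  An identification of the new symbols of M with new symbols of N is a map \<open>\<iota>\<close>; the reduct of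
  the expansion of N interprets \<open>P\<^sub>U\<close> by the interpretation of the symbol identified with it.
\<close>

definition reduct_along ::
    "('p \<Rightarrow> 'q) \<Rightarrow> ('f, 'r + 'q, 'a) struct \<Rightarrow> ('f, 'r + 'p, 'a) struct" where
  "reduct_along \<iota> B = \<lparr>univ = univ B, fun_of = fun_of B, rel_of = rel_of B \<circ> map_sum id \<iota>\<rparr>"

definition star_elem_substruct ::
    "('f, 'r) lang \<Rightarrow> ('f, 'r, 'a) struct \<Rightarrow> ('f, 'r, 'a) struct \<Rightarrow> ('f, 'r, 'a) struct \<Rightarrow> bool" where
  "star_elem_substruct L \<MM> M N \<longleftrightarrow> elem_substruct L M N \<and>
     (\<exists>\<iota>. (\<forall>P\<in>Def_ext L \<MM> M. \<iota> P \<in> Def_ext L \<MM> N \<and> fst (\<iota> P) = fst P) \<and>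
          elem_substruct (ext_lang L \<MM> M) (ext_struct M) (reduct_along \<iota> (ext_struct N)))"


section \<open>Groups definable without parameters\<close>

text \<open>
  The domain is a subset of the power of exponent \<open>dim\<close>; the graph of the multiplication is
  defined by a formula in three consecutive blocks of \<open>dim\<close> variables.
\<close>

record ('f, 'r) group_fms =
  dim :: nat
  dom_fm :: "('f, 'r) fm"
  mult_fm :: "('f, 'r) fm"

definition dom_of :: "('f, 'r) group_fms \<Rightarrow> ('f, 'r, 'a) struct \<Rightarrow> 'a list set" where
  "dom_of \<Gamma> A = {xs \<in> power_of A (dim \<Gamma>). sat A (dom_fm \<Gamma>) (nth xs)}"

definition group_of :: "('f, 'r) group_fms \<Rightarrow> ('f, 'r, 'a) struct \<Rightarrow> 'a list monoid" where
  "group_of \<Gamma> A =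
     \<lparr>carrier = dom_of \<Gamma> A,
      mult = (\<lambda>x y. THE z. z \<in> dom_of \<Gamma> A \<and> sat A (mult_fm \<Gamma>) (nth (x @ y @ z))),
      one = (THE e. e \<in> dom_of \<Gamma> A \<and>
        (\<forall>x\<in>dom_of \<Gamma> A. sat A (mult_fm \<Gamma>) (nth (e @ x @ x)) \<and>
                         sat A (mult_fm \<Gamma>) (nth (x @ e @ x))))\<rparr>"

definition definable_group ::
    "('f, 'r) lang \<Rightarrow> ('f, 'r) group_fms \<Rightarrow> ('f, 'r, 'a) struct \<Rightarrow> bool" where
  "definable_group L \<Gamma> A \<longleftrightarrow>
     wf_fm L (dom_fm \<Gamma>) \<and> fv_fm (dom_fm \<Gamma>) \<subseteq> {..<dim \<Gamma>} \<and>
     wf_fm L (mult_fm \<Gamma>) \<and> fv_fm (mult_fm \<Gamma>) \<subseteq> {..<3 * dim \<Gamma>} \<and>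
     (\<forall>x\<in>dom_of \<Gamma> A. \<forall>y\<in>dom_of \<Gamma> A.
        \<exists>!z. z \<in> dom_of \<Gamma> A \<and> sat A (mult_fm \<Gamma>) (nth (x @ y @ z))) \<and>
     group (group_of \<Gamma> A)"


section \<open>Stone spaces and Ellis groups\<close>

text \<open>Ultrafilters of a Boolean algebra \<open>\<B>\<close> of subsets of \<open>X\<close>.\<close>

definition ultrafilters :: "'x set \<Rightarrow> 'x set set \<Rightarrow> 'x set set set" where
  "ultrafilters X \<B> =
     {p. p \<subseteq> \<B> \<and> X \<in> p \<and> {} \<notin> p \<and>
         (\<forall>A\<in>p. \<forall>B\<in>p. A \<inter> B \<in> p) \<and>
         (\<forall>A\<in>p. \<forall>B\<in>\<B>. A \<subseteq> B \<longrightarrow> B \<in> p) \<and>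
         (\<forall>A\<in>\<B>. A \<in> p \<or> X - A \<in> p)}"

definition stone_topology :: "'x set \<Rightarrow> 'x set set \<Rightarrow> 'x set set topology" where
  "stone_topology X \<B> = topology_generated_by {{p \<in> ultrafilters X \<B>. A \<in> p} | A. A \<in> \<B>}"

definition dmap :: "('x, 'b) monoid_scheme \<Rightarrow> 'x set set \<Rightarrow> 'x set \<Rightarrow> 'x set" where
  "dmap G p A = {g \<in> carrier G. (inv\<^bsub>G\<^esub> g) <#\<^bsub>G\<^esub> A \<in> p}"

definition stone_mult ::
    "('x, 'b) monoid_scheme \<Rightarrow> 'x set set \<Rightarrow> 'x set set \<Rightarrow> 'x set set \<Rightarrow> 'x set set" where
  "stone_mult G \<B> p q = {A \<in> \<B>. dmap G q A \<in> p}"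

definition left_ideal :: "'s set \<Rightarrow> ('s \<Rightarrow> 's \<Rightarrow> 's) \<Rightarrow> 's set \<Rightarrow> bool" where
  "left_ideal S m I \<longleftrightarrow> I \<noteq> {} \<and> I \<subseteq> S \<and> (\<forall>s\<in>S. \<forall>x\<in>I. m s x \<in> I)"

definition minimal_left_ideal :: "'s set \<Rightarrow> ('s \<Rightarrow> 's \<Rightarrow> 's) \<Rightarrow> 's set \<Rightarrow> bool" where
  "minimal_left_ideal S m I \<longleftrightarrow>
     left_ideal S m I \<and> (\<forall>J. left_ideal S m J \<and> J \<subseteq> I \<longrightarrow> J = I)"

definition Ellis_groups :: "'s set \<Rightarrow> ('s \<Rightarrow> 's \<Rightarrow> 's) \<Rightarrow> 's monoid set" where
  "Ellis_groups S m =
     {\<lparr>carrier = m u ` I, mult = m, one = u\<rparr> | u I. minimal_left_ideal S m I \<and> u \<in> I \<and> m u u = u}"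

definition Def_extG ::
    "('f, 'r) lang \<Rightarrow> ('f, 'r, 'a) struct \<Rightarrow> ('f, 'r) group_fms \<Rightarrow> ('f, 'r, 'a) struct
     \<Rightarrow> 'a list set set" where
  "Def_extG L \<MM> \<Gamma> M = {U. (dim \<Gamma>, U) \<in> Def_ext L \<MM> M \<and> U \<subseteq> carrier (group_of \<Gamma> M)}"

definition S_extG ::
    "('f, 'r) lang \<Rightarrow> ('f, 'r, 'a) struct \<Rightarrow> ('f, 'r) group_fms \<Rightarrow> ('f, 'r, 'a) struct
     \<Rightarrow> 'a list set set set" where
  "S_extG L \<MM> \<Gamma> M = ultrafilters (carrier (group_of \<Gamma> M)) (Def_extG L \<MM> \<Gamma> M)"

definition S_extG_topology ::
    "('f, 'r) lang \<Rightarrow> ('f, 'r, 'a) struct \<Rightarrow> ('f, 'r) group_fms \<Rightarrow> ('f, 'r, 'a) struct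
     \<Rightarrow> 'a list set set topology" where
  "S_extG_topology L \<MM> \<Gamma> M = stone_topology (carrier (group_of \<Gamma> M)) (Def_extG L \<MM> \<Gamma> M)"

definition S_extG_mult ::
    "('f, 'r) lang \<Rightarrow> ('f, 'r, 'a) struct \<Rightarrow> ('f, 'r) group_fms \<Rightarrow> ('f, 'r, 'a) struct
     \<Rightarrow> 'a list set set \<Rightarrow> 'a list set set \<Rightarrow> 'a list set set" where
  "S_extG_mult L \<MM> \<Gamma> M = stone_mult (group_of \<Gamma> M) (Def_extG L \<MM> \<Gamma> M)"

end

(*
  An ultrafilter p on G(M) induces the ultrafilter of all externally definable B with B \<inter> G(M)
  in p; this embeds the semigroup of M into the semigroup of N, without any assumption on the
  pair. Conversely an ultrafilter x on G(N) restricts along the identification of symbols, and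
  restriction commutes with left multiplication by elements in the image of the embedding.

  Let u be an idempotent in a minimal left ideal I over M. By elementarity of the expansions
  there is q over N whose d-map is, on the identified sets, given by the d-map of u. Then
  restriction sends s * q to res s * u, so a minimal left ideal J contained in the left ideal
  generated by q restricts into I. Since J is a group with unit e, right multiplication by e is a
  homomorphism from the whole semigroup onto J. Composed with the embedding it is injective on
  the Ellis group u * I, because p can be recovered from p * res e with res e in I, and its image
  on u * I equals its image on the whole (compact) semigroup over M, hence is closed.
*)

theory Submission
  imports Defs
begin

section \<open>Semigroups of ultrafilters\<close>

text \<open>Restriction from N to M is in general no homomorphism; it respects a product when the
  left factor comes from M. So it is not enough that \<open>q\<close> restricts to \<open>u\<close>:
  to control the left ideal generated by \<open>q\<close>, its d-map has to be known also at
  elements of G(N) outside G(M). The conditions on \<open>q\<close> therefore involve every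
  \<open>h\<close> in the extension of \<open>dmap G u A\<close>, and their finite consistency is a
  first-order statement that quantifies over such \<open>h\<close> and mentions externally definable
  sets of M. This is where elementarity in the expanded language enters.

  Every idempotent of a minimal left ideal is a right identity there. That J is a group makes e a
  left identity of J as well, so e * (s * e) = s * e, and this turns right multiplication by e into
  a homomorphism.

  Closedness is not inherited from u * I, since left multiplication by u need not be continuous. It
  is recovered because the idempotent u must go to the identity of a group, so u * p * u and p have
  the same image.\<close>

lemma ultrafilterD:
  assumes "p \<in> ultrafilters X \<B>"
  shows "A \<in> p \<Longrightarrow> A \<in> \<B>" "X \<in> p" "{} \<notin> p"
    "A \<in> p \<Longrightarrow> B \<in> p \<Longrightarrow> A \<inter> B \<in> p"
    "A \<in> p \<Longrightarrow> B \<in> \<B> \<Longrightarrow> A \<subseteq> B \<Longrightarrow> B \<in> p"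
    "A \<in> \<B> \<Longrightarrow> A \<in> p \<or> X - A \<in> p"
  using assms unfolding ultrafilters_def by auto

lemma ultrafilter_compl_iff:
  assumes "p \<in> ultrafilters X \<B>" "A \<in> \<B>" "X - A \<in> \<B>"
  shows "X - A \<in> p \<longleftrightarrow> A \<notin> p"
proof -
  have "A \<inter> (X - A) = {}" by auto
  then show ?thesis using ultrafilterD[OF assms(1)] assms(2,3) by metis
qed

lemma ultrafilter_int_iff:
  assumes "p \<in> ultrafilters X \<B>" "A \<in> \<B>" "B \<in> \<B>"
  shows "A \<inter> B \<in> p \<longleftrightarrow> A \<in> p \<and> B \<in> p"
  using ultrafilterD(4,5)[OF assms(1)] assms(2,3) by (metis inf_le1 inf_le2)

locale set_algebra =
  fixes X :: "'x set" and \<B> :: "'x set set"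
  assumes sub: "A \<in> \<B> \<Longrightarrow> A \<subseteq> X"
    and top: "X \<in> \<B>"
    and compl: "A \<in> \<B> \<Longrightarrow> X - A \<in> \<B>"
    and int: "A \<in> \<B> \<Longrightarrow> B \<in> \<B> \<Longrightarrow> A \<inter> B \<in> \<B>"
begin

lemma ultrafilter_finite_int:
  assumes "p \<in> ultrafilters X \<B>"
  shows "finite \<Delta> \<Longrightarrow> \<Delta> \<subseteq> p \<Longrightarrow> X \<inter> \<Inter>\<Delta> \<in> p"
proof (induction rule: finite_induct)
  case (insert A \<Delta>)
  then have "A \<inter> (X \<inter> \<Inter>\<Delta>) \<in> p" using ultrafilterD(4)[OF assms] by auto
  then show ?case by (simp add: Int_left_commute)
qed (simp add: ultrafilterD(2)[OF assms])

lemma ultrafilter_eqI: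
  assumes "p \<in> ultrafilters X \<B>" "q \<in> ultrafilters X \<B>" "p \<subseteq> q"
  shows "p = q"
proof
  show "q \<subseteq> p"
  proof
    fix A assume A: "A \<in> q"
    then have "A \<in> \<B>" using ultrafilterD(1)[OF assms(2)] by auto
    then show "A \<in> p"
      using A assms(3) compl ultrafilter_compl_iff[OF assms(1)] ultrafilter_compl_iff[OF assms(2)]
      by blast
  qed
qed (fact assms(3))

text \<open>Zorn's lemma on the families with the finite intersection property. The factor
  \<open>X\<close> takes care of the empty family, whose intersection is the whole type.\<close>

lemma ultrafilter_exists:
  assumes F: "F \<subseteq> \<B>" and fip: "\<And>\<Delta>. finite \<Delta> \<Longrightarrow> \<Delta> \<subseteq> F \<Longrightarrow> X \<inter> \<Inter>\<Delta> \<noteq> {}"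
  obtains p where "p \<in> ultrafilters X \<B>" "F \<subseteq> p"
proof -
  define \<H> where "\<H> = {H. F \<subseteq> H \<and> H \<subseteq> \<B> \<and> (\<forall>\<Delta>. finite \<Delta> \<longrightarrow> \<Delta> \<subseteq> H \<longrightarrow> X \<inter> \<Inter>\<Delta> \<noteq> {})}"
  have "\<exists>H\<in>\<H>. \<forall>H'\<in>\<H>. H \<subseteq> H' \<longrightarrow> H' = H"
  proof (rule subset_Zorn_nonempty)
    show "\<H> \<noteq> {}" unfolding \<H>_def using F fip by blast
  next
    fix \<C> assume ne: "\<C> \<noteq> {}" and ch: "subset.chain \<H> \<C>"
    then have CH: "\<C> \<subseteq> \<H>" by (auto simp: subset.chain_def)
    have "X \<inter> \<Inter>\<Delta> \<noteq> {}" if fin: "finite \<Delta>" and sub: "\<Delta> \<subseteq> \<Union>\<C>" for \<Delta>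
    proof -
      obtain H where "H \<in> \<C>" "\<Delta> \<subseteq> H"
        using finite_subset_Union_chain[OF fin sub ne ch] by blast
      then show ?thesis using CH fin unfolding \<H>_def by blast
    qed
    moreover have "F \<subseteq> \<Union>\<C>" using ne CH unfolding \<H>_def by blast
    moreover have "\<Union>\<C> \<subseteq> \<B>" using CH unfolding \<H>_def by blast
    ultimately show "\<Union>\<C> \<in> \<H>" unfolding \<H>_def by blast
  qed
  then obtain p where p: "p \<in> \<H>" and max: "\<And>H. H \<in> \<H> \<Longrightarrow> p \<subseteq> H \<Longrightarrow> H = p" by blast
  have Fp: "F \<subseteq> p" and pB: "p \<subseteq> \<B>"
    and pf: "\<And>\<Delta>. finite \<Delta> \<Longrightarrow> \<Delta> \<subseteq> p \<Longrightarrow> X \<inter> \<Inter>\<Delta> \<noteq> {}"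
    using p unfolding \<H>_def by auto
  \<comment> \<open>Maximality: a set outside \<open>p\<close> cannot be added without destroying
    the finite intersection property.\<close>
  have witness: "\<exists>\<Delta>. finite \<Delta> \<and> \<Delta> \<subseteq> p \<and> X \<inter> \<Inter>\<Delta> \<inter> A = {}" if A: "A \<in> \<B>" "A \<notin> p" for A
  proof (rule ccontr)
    assume no: "\<not> ?thesis"
    have "X \<inter> \<Inter>\<Delta> \<noteq> {}" if "finite \<Delta>" "\<Delta> \<subseteq> insert A p" for \<Delta>
    proof -
      have "finite (\<Delta> - {A})" using that(1) by simp
      moreover have "\<Delta> - {A} \<subseteq> p" using that(2) by blast
      ultimately obtain x where "x \<in> X \<inter> \<Inter>(\<Delta> - {A}) \<inter> A" using no by (metis ex_in_conv)
      then have "x \<in> X \<inter> \<Inter>\<Delta>" by blast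
      then show ?thesis by blast
    qed
    then have "insert A p \<in> \<H>" unfolding \<H>_def using A Fp pB by blast
    then show False using max A by blast
  qed
  \<comment> \<open>All filter axioms follow from this one closure property: \<open>p\<close>
    contains what lies above a finite intersection of its members.\<close>
  have mem: "A \<in> p" if mem: "A \<in> \<B>" "finite \<Delta>" "\<Delta> \<subseteq> p" "X \<inter> \<Inter>\<Delta> \<subseteq> A" for A \<Delta>
  proof (rule ccontr)
    assume "A \<notin> p"
    then obtain \<Delta>' where D: "finite \<Delta>'" "\<Delta>' \<subseteq> p" "X \<inter> \<Inter>\<Delta>' \<inter> A = {}"
      using witness[OF mem(1)] by auto
    have "X \<inter> \<Inter>(\<Delta> \<union> \<Delta>') \<noteq> {}" using mem(2,3) D(1,2) by (intro pf) simp_all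
    then obtain x where "x \<in> X \<inter> \<Inter>\<Delta>" "x \<in> X \<inter> \<Inter>\<Delta>'" by auto
    then show False using mem(4) D(3) by blast
  qed
  have "X \<in> p" by (rule mem[of _ "{}"]) (auto simp: top)
  moreover have "{} \<notin> p" using pf[of "{{}}"] by auto
  moreover have "A \<inter> B \<in> p" if "A \<in> p" "B \<in> p" for A B
    using that pB by (intro mem[of _ "{A, B}"]) (auto intro: int)
  moreover have "B \<in> p" if "A \<in> p" "B \<in> \<B>" "A \<subseteq> B" for A B
    using that by (intro mem[of _ "{A}"]) auto
  moreover have "A \<in> p \<or> X - A \<in> p" if A: "A \<in> \<B>" for A
  proof (rule disjCI)
    assume "X - A \<notin> p"
    then obtain \<Delta> where D: "finite \<Delta>" "\<Delta> \<subseteq> p" "X \<inter> \<Inter>\<Delta> \<inter> (X - A) = {}"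
      using witness[OF compl[OF A]] by auto
    then have "X \<inter> \<Inter>\<Delta> \<subseteq> A" by blast
    then show "A \<in> p" by (rule mem[OF A D(1,2)])
  qed
  ultimately have "p \<in> ultrafilters X \<B>" unfolding ultrafilters_def using pB by blast
  then show thesis using Fp that by blast
qed

text \<open>The complement is a union of basic open sets. The image in the final embedding is
  brought into this form, which replaces an argument with compact spaces and continuous
  maps.\<close>

lemma stone_closedin:
  assumes "\<C> \<subseteq> \<B>"
  shows "closedin (stone_topology X \<B>) {p \<in> ultrafilters X \<B>. \<forall>A\<in>\<C>. A \<notin> p}"
proof -
  let ?U = "\<lambda>A. {p \<in> ultrafilters X \<B>. A \<in> p}"
  have "?U X = ultrafilters X \<B>" using ultrafilterD(2) by blast
  then have "ultrafilters X \<B> \<in> {?U A | A. A \<in> \<B>}" using top by blast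
  then have space: "topspace (stone_topology X \<B>) = ultrafilters X \<B>"
    unfolding stone_topology_def topology_generated_by_topspace by blast
  have "openin (stone_topology X \<B>) (\<Union>A\<in>\<C>. ?U A)"
  proof (rule openin_Union, clarify)
    fix A assume "A \<in> \<C>"
    then have "?U A \<in> {?U A | A. A \<in> \<B>}" using assms by blast
    then show "openin (stone_topology X \<B>) (?U A)"
      unfolding stone_topology_def by (rule topology_generated_by_Basis)
  qed
  moreover have "topspace (stone_topology X \<B>) - {p \<in> ultrafilters X \<B>. \<forall>A\<in>\<C>. A \<notin> p}
      = (\<Union>A\<in>\<C>. ?U A)"
    unfolding space by blast
  ultimately show ?thesis unfolding closedin_def space by simp
qed

end

section \<open>Translations, d-maps and the product of ultrafilters\<close>

definition shift :: "('x, 'b) monoid_scheme \<Rightarrow> 'x \<Rightarrow> 'x set \<Rightarrow> 'x set" where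
  "shift G g A = {x \<in> carrier G. g \<otimes>\<^bsub>G\<^esub> x \<in> A}"

text \<open>Removes the inverse from the d-map. The group is given by a formula for its
  multiplication, so \<open>shift\<close> is the form that formulas can express directly.\<close>

lemma (in group) inv_coset_eq_shift:
  assumes "g \<in> carrier G" "A \<subseteq> carrier G"
  shows "inv g <# A = shift G g A"
proof -
  have "x \<in> inv g <# A" if "x \<in> carrier G" "g \<otimes> x \<in> A" for x
    unfolding l_coset_def using that assms by (auto intro!: bexI[of _ "g \<otimes> x"] simp: m_assoc[symmetric])
  moreover have "x \<in> carrier G \<and> g \<otimes> x \<in> A" if x: "x \<in> inv g <# A" for x
  proof -
    obtain a where "a \<in> A" "x = inv g \<otimes> a" using x unfolding l_coset_def by blast
    then show ?thesis using assms by (auto simp: m_assoc[symmetric])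
  qed
  ultimately show ?thesis unfolding shift_def by auto
qed

text \<open>Closure under d-maps is the definability requirement that makes a product of two
  ultrafilters an ultrafilter of the same algebra; for an arbitrary translation-invariant algebra of
  sets it may fail.\<close>

locale group_set_algebra = group G + set_algebra "carrier G" \<B>
  for G :: "('x, 'b) monoid_scheme" (structure) and \<B> +
  assumes shift_closed: "g \<in> carrier G \<Longrightarrow> A \<in> \<B> \<Longrightarrow> shift G g A \<in> \<B>"
    and dmap_closed: "p \<in> ultrafilters (carrier G) \<B> \<Longrightarrow> A \<in> \<B> \<Longrightarrow> dmap G p A \<in> \<B>"
begin

abbreviation S where "S \<equiv> ultrafilters (carrier G) \<B>"
abbreviation smult (infixl "\<star>" 70) where "p \<star> q \<equiv> stone_mult G \<B> p q"

lemma mem_dmap_iff: "A \<in> \<B> \<Longrightarrow> g \<in> dmap G p A \<longleftrightarrow> g \<in> carrier G \<and> shift G g A \<in> p"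
  unfolding dmap_def using inv_coset_eq_shift sub by auto

lemma mem_smult_iff: "A \<in> p \<star> q \<longleftrightarrow> A \<in> \<B> \<and> dmap G q A \<in> p"
  unfolding stone_mult_def by simp

lemma shift_compl: "g \<in> carrier G \<Longrightarrow> shift G g (carrier G - A) = carrier G - shift G g A"
  unfolding shift_def by auto

lemma shift_int: "shift G g (A \<inter> B) = shift G g A \<inter> shift G g B"
  unfolding shift_def by auto

lemma shift_carrier: "g \<in> carrier G \<Longrightarrow> shift G g (carrier G) = carrier G"
  unfolding shift_def by auto

lemma shift_shift:
  "g \<in> carrier G \<Longrightarrow> h \<in> carrier G \<Longrightarrow> shift G h (shift G g A) = shift G (g \<otimes> h) A"
  unfolding shift_def by (auto simp: m_assoc)

lemma dmap_compl:
  assumes "p \<in> S" "A \<in> \<B>"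
  shows "dmap G p (carrier G - A) = carrier G - dmap G p A"
  using assms ultrafilter_compl_iff[OF assms(1) shift_closed] compl
  by (auto simp: mem_dmap_iff shift_compl shift_closed)

lemma dmap_int:
  assumes "p \<in> S" "A \<in> \<B>" "B \<in> \<B>"
  shows "dmap G p (A \<inter> B) = dmap G p A \<inter> dmap G p B"
  using assms ultrafilter_int_iff[OF assms(1) shift_closed shift_closed]
  by (auto simp: mem_dmap_iff shift_int int)

lemma dmap_carrier:
  assumes "p \<in> S"
  shows "dmap G p (carrier G) = carrier G"
  using ultrafilterD(2)[OF assms] by (auto simp: mem_dmap_iff top shift_carrier)

lemma dmap_empty:
  assumes "p \<in> S"
  shows "dmap G p {} = {}"
  using ultrafilterD(3)[OF assms] compl[OF top] by (auto simp: mem_dmap_iff shift_def)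

lemma dmap_mono:
  assumes "p \<in> S" "A \<in> \<B>" "B \<in> \<B>" "A \<subseteq> B"
  shows "dmap G p A \<subseteq> dmap G p B"
  using dmap_int[OF assms(1-3)] assms(4) by (simp add: Int_absorb2 le_iff_inf)

lemma dmap_shift:
  assumes "g \<in> carrier G" "A \<in> \<B>"
  shows "dmap G p (shift G g A) = shift G g (dmap G p A)"
proof -
  have "h \<in> dmap G p (shift G g A) \<longleftrightarrow> h \<in> shift G g (dmap G p A)" for h
    using assms mem_dmap_iff[OF shift_closed[OF assms]] mem_dmap_iff[OF assms(2)]
    by (auto simp: shift_shift shift_def[of _ _ "dmap G p A"])
  then show ?thesis by auto
qed

lemma smult_closed:
  assumes "p \<in> S" "q \<in> S"
  shows "p \<star> q \<in> S"
proof -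
  note P = ultrafilterD[OF assms(1)]
  have "A \<in> p \<star> q \<or> carrier G - A \<in> p \<star> q" if "A \<in> \<B>" for A
    using that P(6) assms by (auto simp: mem_smult_iff dmap_compl compl dmap_closed)
  moreover have "B \<in> p \<star> q" if "A \<in> p \<star> q" "B \<in> \<B>" "A \<subseteq> B" for A B
    using that P(5) assms dmap_closed dmap_mono by (auto simp: mem_smult_iff)
  moreover have "A \<inter> B \<in> p \<star> q" if "A \<in> p \<star> q" "B \<in> p \<star> q" for A B
    using that P(4) assms by (auto simp: mem_smult_iff dmap_int int)
  moreover have "carrier G \<in> p \<star> q" "{} \<notin> p \<star> q"
    using P(2,3) assms by (auto simp: mem_smult_iff top dmap_carrier dmap_empty)
  moreover have "p \<star> q \<subseteq> \<B>" by (auto simp: mem_smult_iff)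
  ultimately show ?thesis unfolding ultrafilters_def by blast
qed

text \<open>Each d-map is an endomorphism of the Boolean algebra that commutes with shifts, and the
  product of ultrafilters corresponds to the composition of their d-maps. Associativity is read off
  from this.\<close>

lemma dmap_smult:
  assumes "p \<in> S" "q \<in> S" "A \<in> \<B>"
  shows "dmap G (p \<star> q) A = dmap G p (dmap G q A)"
  using assms
  by (auto simp: mem_dmap_iff dmap_closed mem_smult_iff shift_closed dmap_shift)

lemma smult_assoc:
  assumes "p \<in> S" "q \<in> S" "s \<in> S"
  shows "p \<star> q \<star> s = p \<star> (q \<star> s)"
  using assms by (auto simp: mem_smult_iff dmap_smult dmap_closed)

text \<open>Compactness, in the form: \<open>y\<close> lies in the closure of \<open>X \<star> x\<close> iff it lies in the
  image of the ultrafilters concentrated on \<open>X\<close>.\<close>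

lemma dmap_trace_ultrafilter:
  assumes alg: "set_algebra X \<A>" and tr: "\<And>B. B \<in> \<B> \<Longrightarrow> B \<inter> X \<in> \<A>"
    and x: "x \<in> S" and y: "y \<in> S" and ne: "\<And>A. A \<in> y \<Longrightarrow> dmap G x A \<inter> X \<noteq> {}"
  obtains p where "p \<in> ultrafilters X \<A>" "\<And>A. A \<in> y \<Longrightarrow> dmap G x A \<inter> X \<in> p"
proof -
  interpret X: set_algebra X \<A> by fact
  note Y = ultrafilterD[OF y]
  let ?F = "(\<lambda>A. dmap G x A \<inter> X) ` y"
  \<comment> \<open>\<open>?F\<close> is directed downwards because \<open>dmap\<close> preserves
    intersections, so consistency of finitely many members reduces to the nonemptiness of a single
    one.\<close>
  have fin: "\<exists>A\<in>y. dmap G x A \<inter> X \<subseteq> \<Inter>\<Delta>" if "finite \<Delta>" "\<Delta> \<subseteq> ?F" for \<Delta>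
    using that
  proof (induction rule: finite_induct)
    case (insert D \<Delta>)
    then obtain A B where AB: "A \<in> y" "B \<in> y" "dmap G x A \<inter> X \<subseteq> \<Inter>\<Delta>" "D = dmap G x B \<inter> X" by auto
    have "dmap G x (A \<inter> B) \<inter> X \<subseteq> \<Inter>(insert D \<Delta>)"
      using AB(3) unfolding AB(4) dmap_int[OF x Y(1)[OF AB(1)] Y(1)[OF AB(2)]] by blast
    then show ?case using Y(4)[OF AB(1,2)] by blast
  qed (use Y(2) in auto)
  obtain p where "p \<in> ultrafilters X \<A>" "?F \<subseteq> p"
  proof (rule X.ultrafilter_exists)
    show "?F \<subseteq> \<A>" using tr[OF dmap_closed[OF x Y(1)]] by blast
    show "X \<inter> \<Inter>\<Delta> \<noteq> {}" if D: "finite \<Delta>" "\<Delta> \<subseteq> ?F" for \<Delta>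
    proof -
      obtain A where A: "A \<in> y" "dmap G x A \<inter> X \<subseteq> \<Inter>\<Delta>" using fin[OF D] by blast
      show ?thesis using ne[OF A(1)] A(2) by blast
    qed
  qed blast
  then show thesis using that by blast
qed

text \<open>The equation \<open>y = s \<star> x\<close> asks \<open>s\<close> to contain
  \<open>dmap G x A\<close> for every \<open>A \<in> y\<close>. This is the case of ultrafilters on
  the whole group, where the trace changes nothing.\<close>

lemma left_multiple_exists:
  assumes "x \<in> S" "y \<in> S" and ne: "\<And>A. A \<in> y \<Longrightarrow> dmap G x A \<noteq> {}"
  obtains s where "s \<in> S" "y = s \<star> x"
proof -
  have *: "B \<inter> carrier G = B" if "B \<in> \<B>" for B using sub[OF that] by auto
  have **: "dmap G x A \<inter> carrier G = dmap G x A" if "A \<in> y" for A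
    unfolding dmap_def by auto
  obtain s where s: "s \<in> S" "\<And>A. A \<in> y \<Longrightarrow> dmap G x A \<inter> carrier G \<in> s"
  proof (rule dmap_trace_ultrafilter[OF set_algebra_axioms _ assms(1,2)])
    show "B \<inter> carrier G \<in> \<B>" if "B \<in> \<B>" for B using that by (simp add: *)
    show "dmap G x A \<inter> carrier G \<noteq> {}" if "A \<in> y" for A using ne[OF that] **[OF that] by metis
  qed blast
  have "y \<subseteq> s \<star> x"
  proof
    fix A assume A: "A \<in> y"
    then have "dmap G x A \<in> s" using s(2) ** by metis
    then show "A \<in> s \<star> x" using ultrafilterD(1)[OF assms(2) A] by (simp add: mem_smult_iff)
  qed
  then have "y = s \<star> x" by (rule ultrafilter_eqI[OF assms(2) smult_closed[OF s(1) assms(1)]])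
  then show thesis by (rule that[OF s(1)])
qed

text \<open>Closed left ideals correspond to shift-invariant filters, so a minimal one is found
  as a maximal invariant filter; no topology is needed.\<close>

definition inv_filter :: "'x set set \<Rightarrow> bool" where
  "inv_filter F \<longleftrightarrow> F \<subseteq> \<B> \<and> carrier G \<in> F \<and> {} \<notin> F \<and>
     (\<forall>A\<in>F. \<forall>B\<in>F. A \<inter> B \<in> F) \<and> (\<forall>A\<in>F. \<forall>g\<in>carrier G. shift G g A \<in> F)"

lemma inv_filterD:
  assumes "inv_filter F"
  shows "F \<subseteq> \<B>" "carrier G \<in> F" "{} \<notin> F" "A \<in> F \<Longrightarrow> B \<in> F \<Longrightarrow> A \<inter> B \<in> F"
    "A \<in> F \<Longrightarrow> g \<in> carrier G \<Longrightarrow> shift G g A \<in> F"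
  using assms unfolding inv_filter_def by auto

lemma inv_filterI:
  assumes "F \<subseteq> \<B>" "carrier G \<in> F" "{} \<notin> F" "\<And>A B. A \<in> F \<Longrightarrow> B \<in> F \<Longrightarrow> A \<inter> B \<in> F"
    "\<And>A g. A \<in> F \<Longrightarrow> g \<in> carrier G \<Longrightarrow> shift G g A \<in> F"
  shows "inv_filter F"
  using assms unfolding inv_filter_def by auto

text \<open>The filter that describes the left ideal generated by \<open>x\<close>: the sets all of
  whose shifts lie in \<open>x\<close>, equivalently those that belong to every
  \<open>s \<star> x\<close>.\<close>

definition ann :: "'x set set \<Rightarrow> 'x set set" where
  "ann x = {A \<in> \<B>. dmap G x A = carrier G}"

lemma inv_filter_ann:
  assumes "x \<in> S"
  shows "inv_filter (ann x)"
proof -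
  have "carrier G \<noteq> {}" using one_closed by blast
  then show ?thesis unfolding inv_filter_def ann_def using assms
    by (auto simp: top dmap_carrier dmap_empty dmap_int int shift_closed dmap_shift shift_carrier)
qed

text \<open>With \<open>A\<close> the filter contains all shifts of \<open>A\<close>, and these lie
  in \<open>x\<close>. So \<open>ann x\<close> is the largest invariant filter inside
  \<open>x\<close>.\<close>

lemma inv_filter_subset_ann:
  assumes "inv_filter F" "F \<subseteq> x" "x \<in> S"
  shows "F \<subseteq> ann x"
  using assms unfolding inv_filter_def ann_def by (auto simp: mem_dmap_iff subset_iff)

text \<open>If \<open>dmap G x A\<close> were empty for some \<open>A \<in> y\<close>, the
  complement of \<open>A\<close> would belong to \<open>ann x\<close>. So the obstruction in
  \<open>left_multiple_exists\<close> is exactly a set of \<open>ann x\<close> missing from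
  \<open>y\<close>.\<close>

lemma left_multiple_iff_ann:
  assumes "x \<in> S" "y \<in> S"
  shows "(\<exists>s\<in>S. y = s \<star> x) \<longleftrightarrow> ann x \<subseteq> y"
proof
  assume "\<exists>s\<in>S. y = s \<star> x"
  then show "ann x \<subseteq> y" using ultrafilterD(2) by (auto simp: ann_def mem_smult_iff)
next
  assume a: "ann x \<subseteq> y"
  have "dmap G x A \<noteq> {}" if A: "A \<in> y" for A
  proof
    assume "dmap G x A = {}"
    moreover have AB: "A \<in> \<B>" using A ultrafilterD(1)[OF assms(2)] by auto
    ultimately have "carrier G - A \<in> ann x"
      using dmap_compl[OF assms(1)] compl by (auto simp: ann_def)
    then show False using a A AB ultrafilter_compl_iff[OF assms(2) AB compl[OF AB]] by auto
  qed
  then show "\<exists>s\<in>S. y = s \<star> x" by (rule left_multiple_exists[OF assms]) blast+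
qed

text \<open>The passage from left ideals to filters reverses inclusion, so a maximal invariant
  filter above \<open>ann q\<close> yields a minimal left ideal inside the one generated by
  \<open>q\<close>.\<close>

lemma minimal_left_ideal_exists:
  assumes q: "q \<in> S"
  obtains J where "minimal_left_ideal S (\<star>) J" "\<And>y. y \<in> J \<Longrightarrow> \<exists>s\<in>S. y = s \<star> q"
proof -
  define \<H> where "\<H> = {F. inv_filter F \<and> ann q \<subseteq> F}"
  have "\<exists>F\<in>\<H>. \<forall>F'\<in>\<H>. F \<subseteq> F' \<longrightarrow> F' = F"
  proof (rule subset_Zorn_nonempty)
    show "\<H> \<noteq> {}" unfolding \<H>_def using inv_filter_ann[OF q] by blast
  next
    fix \<C> assume ne: "\<C> \<noteq> {}" and ch: "subset.chain \<H> \<C>"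
    then have CH: "\<C> \<subseteq> \<H>" by (auto simp: subset.chain_def)
    have C: "inv_filter F" "ann q \<subseteq> F" if "F \<in> \<C>" for F
      using that CH by (auto simp: \<H>_def)
    have "inv_filter (\<Union>\<C>)"
    proof (rule inv_filterI)
      show "\<Union>\<C> \<subseteq> \<B>" using inv_filterD(1)[OF C(1)] by blast
      show "carrier G \<in> \<Union>\<C>" using ne inv_filterD(2)[OF C(1)] by blast
      show "{} \<notin> \<Union>\<C>" using inv_filterD(3)[OF C(1)] by blast
      show "shift G g A \<in> \<Union>\<C>" if "A \<in> \<Union>\<C>" "g \<in> carrier G" for A g
        using that inv_filterD(5)[OF C(1)] by blast
      fix A B assume "A \<in> \<Union>\<C>" "B \<in> \<Union>\<C>"
      then obtain F F' where F: "F \<in> \<C>" "A \<in> F" "F' \<in> \<C>" "B \<in> F'" by auto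
      then have "F \<subseteq> F' \<or> F' \<subseteq> F" using ch by (auto simp: subset.chain_def)
      then show "A \<inter> B \<in> \<Union>\<C>"
        using F inv_filterD(4)[OF C(1)[OF F(1)]] inv_filterD(4)[OF C(1)[OF F(3)]] by blast
    qed
    moreover have "ann q \<subseteq> \<Union>\<C>" using ne C(2) by blast
    ultimately show "\<Union>\<C> \<in> \<H>" by (simp add: \<H>_def)
  qed
  then obtain F where "F \<in> \<H>" and max\<H>: "\<forall>F'\<in>\<H>. F \<subseteq> F' \<longrightarrow> F' = F" by (rule bexE)
  then have F: "inv_filter F" "ann q \<subseteq> F" by (auto simp: \<H>_def)
  have max: "F' = F" if "inv_filter F'" "F \<subseteq> F'" for F'
    using max\<H> that F(2) by (auto simp: \<H>_def)
  define J where "J = {x \<in> S. F \<subseteq> x}"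
  \<comment> \<open>Maximality forces equality. Hence all elements of \<open>J\<close> have the same
    left multiples, which gives both that \<open>J\<close> is a left ideal and that it is
    minimal.\<close>
  have annJ: "ann x = F" if "x \<in> J" for x
  proof (rule max)
    have x: "x \<in> S" "F \<subseteq> x" using that by (auto simp: J_def)
    show "inv_filter (ann x)" "F \<subseteq> ann x"
      using inv_filter_ann inv_filter_subset_ann[OF F(1)] x by auto
  qed
  have fin: "carrier G \<inter> \<Inter>\<Delta> \<in> F" if "finite \<Delta>" "\<Delta> \<subseteq> F" for \<Delta>
    using that
  proof (induction rule: finite_induct)
    case (insert A \<Delta>)
    then have "A \<inter> (carrier G \<inter> \<Inter>\<Delta>) \<in> F" using inv_filterD(4)[OF F(1)] by auto
    then show ?case by (simp add: Int_left_commute)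
  qed (simp add: inv_filterD(2)[OF F(1)])
  obtain x where "x \<in> S" "F \<subseteq> x"
  proof (rule ultrafilter_exists)
    show "F \<subseteq> \<B>" by (rule inv_filterD(1)[OF F(1)])
    show "carrier G \<inter> \<Inter>\<Delta> \<noteq> {}" if "finite \<Delta>" "\<Delta> \<subseteq> F" for \<Delta>
      using fin[OF that] inv_filterD(3)[OF F(1)] by metis
  qed blast
  then have "J \<noteq> {}" by (auto simp: J_def)
  moreover have "s \<star> x \<in> J" if "s \<in> S" "x \<in> J" for s x
    using that annJ[OF that(2)] smult_closed ultrafilterD(2)[OF that(1)]
    by (auto simp: J_def mem_smult_iff ann_def)
  ultimately have "left_ideal S (\<star>) J" unfolding left_ideal_def by (auto simp: J_def)
  moreover have "J' = J" if J': "left_ideal S (\<star>) J'" "J' \<subseteq> J" for J'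
  proof
    obtain x where x: "x \<in> J'" using J'(1) unfolding left_ideal_def by blast
    then have xS: "x \<in> S" "ann x = F" using J' annJ J_def by auto
    show "J \<subseteq> J'"
    proof
      fix y assume y: "y \<in> J"
      then obtain s where "s \<in> S" "y = s \<star> x"
        using left_multiple_iff_ann[OF xS(1)] xS unfolding J_def by blast
      then show "y \<in> J'" using J'(1) x unfolding left_ideal_def by blast
    qed
  qed (fact that(2))
  ultimately have "minimal_left_ideal S (\<star>) J" unfolding minimal_left_ideal_def by blast
  moreover have "\<exists>s\<in>S. y = s \<star> q" if "y \<in> J" for y
    using that left_multiple_iff_ann[OF q] F(2) unfolding J_def by blast
  ultimately show thesis using that by blast
qed

end

section \<open>Minimal left ideals and Ellis groups of an abstract semigroup\<close>

context
  fixes S :: "'s set" and m :: "'s \<Rightarrow> 's \<Rightarrow> 's" (infixl "\<cdot>" 70)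
  assumes closed: "\<And>x y. x \<in> S \<Longrightarrow> y \<in> S \<Longrightarrow> x \<cdot> y \<in> S"
    and assoc: "\<And>x y z. x \<in> S \<Longrightarrow> y \<in> S \<Longrightarrow> z \<in> S \<Longrightarrow> x \<cdot> y \<cdot> z = x \<cdot> (y \<cdot> z)"
begin

text \<open>The left multiples of \<open>a\<close> form a left ideal inside \<open>I\<close>, so by
  minimality they exhaust \<open>I\<close>.\<close>

lemma minimal_left_ideal_generated:
  assumes I: "minimal_left_ideal S m I" and "a \<in> I" "b \<in> I"
  obtains s where "s \<in> S" "s \<cdot> a = b"
proof -
  have IS: "I \<subseteq> S" and cl: "\<And>s x. s \<in> S \<Longrightarrow> x \<in> I \<Longrightarrow> s \<cdot> x \<in> I"
    using I unfolding minimal_left_ideal_def left_ideal_def by auto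
  have aS: "a \<in> S" using IS assms by auto
  have "left_ideal S m ((\<lambda>s. s \<cdot> a) ` S)"
    unfolding left_ideal_def
  proof (intro conjI ballI)
    show "(\<lambda>s. s \<cdot> a) ` S \<noteq> {}" using aS by auto
    show "(\<lambda>s. s \<cdot> a) ` S \<subseteq> S" using aS closed by auto
    show "s \<cdot> x \<in> (\<lambda>s. s \<cdot> a) ` S" if s: "s \<in> S" and x: "x \<in> (\<lambda>s. s \<cdot> a) ` S" for s x
    proof -
      obtain t where t: "t \<in> S" "x = t \<cdot> a" using x by auto
      then have "s \<cdot> x = (s \<cdot> t) \<cdot> a" using assoc s aS by simp
      then show ?thesis using closed s t by blast
    qed
  qed
  moreover have "(\<lambda>s. s \<cdot> a) ` S \<subseteq> I" using cl assms by auto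
  ultimately have "(\<lambda>s. s \<cdot> a) ` S = I" using I unfolding minimal_left_ideal_def by blast
  then show thesis using assms that by blast
qed

lemma minimal_left_ideal_right_unit:
  assumes "minimal_left_ideal S m I" "u \<in> I" "u \<cdot> u = u" "p \<in> I"
  shows "p \<cdot> u = p"
proof -
  obtain s where s: "s \<in> S" "s \<cdot> u = p" using minimal_left_ideal_generated assms by metis
  have "u \<in> S" using assms(1,2) unfolding minimal_left_ideal_def left_ideal_def by auto
  then show ?thesis using assoc[of s u u] s assms(3) by simp
qed

lemma Ellis_group_left_inverse:
  assumes I: "minimal_left_ideal S m I" and u: "u \<in> I" "u \<cdot> u = u" and a: "a \<in> I" "u \<cdot> a = a"
  obtains b where "b \<in> I" "u \<cdot> b = b" "b \<cdot> a = u"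
proof -
  have IS: "I \<subseteq> S" and cl: "\<And>s x. s \<in> S \<Longrightarrow> x \<in> I \<Longrightarrow> s \<cdot> x \<in> I"
    using I unfolding minimal_left_ideal_def left_ideal_def by auto
  have S: "u \<in> S" "a \<in> S" using IS u a by auto
  obtain s where s: "s \<in> S" "s \<cdot> a = u" using minimal_left_ideal_generated[OF I a(1) u(1)] by blast
  \<comment> \<open>The left quotient \<open>s\<close> is an arbitrary element of \<open>S\<close>;
    framing it by \<open>u\<close> on both sides moves it into the Ellis group without changing the
    product with \<open>a\<close>.\<close>
  have "(u \<cdot> (s \<cdot> u)) \<cdot> a = u"
    using s S u a assoc closed by simp
  moreover have "u \<cdot> (u \<cdot> (s \<cdot> u)) = u \<cdot> (s \<cdot> u)"
    using s S u assoc closed by metis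
  moreover have "u \<cdot> (s \<cdot> u) \<in> I" using cl s S u by blast
  ultimately show thesis using that by blast
qed

text \<open>The usual group argument: a left inverse \<open>c\<close> of the left inverse
  \<open>b\<close> of \<open>a\<close> must be \<open>a\<close> itself.\<close>

lemma Ellis_group_inverse:
  assumes I: "minimal_left_ideal S m I" and u: "u \<in> I" "u \<cdot> u = u" and a: "a \<in> I" "u \<cdot> a = a"
  obtains b where "b \<in> I" "u \<cdot> b = b" "b \<cdot> a = u" "a \<cdot> b = u"
proof -
  obtain b where b: "b \<in> I" "u \<cdot> b = b" "b \<cdot> a = u"
    using Ellis_group_left_inverse[OF assms] by blast
  obtain c where c: "c \<in> I" "u \<cdot> c = c" "c \<cdot> b = u"
    using Ellis_group_left_inverse[OF I u b(1,2)] by blast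
  have S: "a \<in> S" "b \<in> S" "c \<in> S"
    using I a b c unfolding minimal_left_ideal_def left_ideal_def by auto
  have "a = c \<cdot> (b \<cdot> a)" using assoc[of c b a] S c a by simp
  also have "\<dots> = c" using b minimal_left_ideal_right_unit[OF I u c(1)] by simp
  finally show thesis using that b c by blast
qed

end

section \<open>The embedding theorem for a pair of groups with set algebras\<close>

text \<open>Everything that is extracted from model theory. \<open>st\<close> sends an externally
  definable set over M to the set identified with it over N. The condition \<open>st_fip\<close>
  transfers a sentence of the form "for all \<open>gs\<close> there is \<open>x\<close>", and serves
  to extend the d-map of an ultrafilter to the larger group.\<close>

locale group_set_algebra_extension =
  M: group_set_algebra G \<A> + N: group_set_algebra H \<B>
  for G H :: "('x, 'b) monoid_scheme" and \<A> \<B> +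
  fixes st :: "'x set \<Rightarrow> 'x set"
  assumes carrier_sub: "carrier G \<subseteq> carrier H"
    and mult_eq: "x \<in> carrier G \<Longrightarrow> y \<in> carrier G \<Longrightarrow> x \<otimes>\<^bsub>H\<^esub> y = x \<otimes>\<^bsub>G\<^esub> y"
    and trace: "B \<in> \<B> \<Longrightarrow> B \<inter> carrier G \<in> \<A>"
    and st_closed: "A \<in> \<A> \<Longrightarrow> st A \<in> \<B>"
    and st_compl: "A \<in> \<A> \<Longrightarrow> st (carrier G - A) = carrier H - st A"
    and st_int: "A \<in> \<A> \<Longrightarrow> B \<in> \<A> \<Longrightarrow> st (A \<inter> B) = st A \<inter> st B"
    and st_shift: "g \<in> carrier G \<Longrightarrow> A \<in> \<A> \<Longrightarrow> st (shift G g A) = shift H g (st A)"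
    and st_fip: "(\<And>i. i < n \<Longrightarrow> As i \<in> \<A> \<and> Ds i \<in> \<A>) \<Longrightarrow>
      (\<And>gs. (\<forall>i<n. gs i \<in> Ds i) \<Longrightarrow> \<exists>x\<in>carrier G. \<forall>i<n. gs i \<otimes>\<^bsub>G\<^esub> x \<in> As i) \<Longrightarrow>
      (\<forall>i<(n::nat). hs i \<in> st (Ds i)) \<Longrightarrow> \<exists>x\<in>carrier H. \<forall>i<n. hs i \<otimes>\<^bsub>H\<^esub> x \<in> st (As i)"
begin

abbreviation multM (infixl "\<star>M" 70) where "p \<star>M q \<equiv> stone_mult G \<A> p q"
abbreviation multN (infixl "\<star>N" 70) where "p \<star>N q \<equiv> stone_mult H \<B> p q"

lemma st_empty: "st {} = {}"
  using st_int[OF M.top M.compl[OF M.top]] st_compl[OF M.top] by auto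

lemma st_carrier: "st (carrier G) = carrier H"
  using st_compl[of "{}"] st_empty M.compl[OF M.top] by auto

lemma st_mono: "A \<in> \<A> \<Longrightarrow> B \<in> \<A> \<Longrightarrow> A \<subseteq> B \<Longrightarrow> st A \<subseteq> st B"
  using st_int[of A B] by (simp add: Int_absorb2 le_iff_inf)

text \<open>The push-forward along the inclusion. Each of its members meets
  \<open>carrier G\<close>, that is, it is finitely satisfiable in the smaller group; hence the
  name.\<close>

definition coheir :: "'x set set \<Rightarrow> 'x set set" where
  "coheir p = {B \<in> \<B>. B \<inter> carrier G \<in> p}"

definition res :: "'x set set \<Rightarrow> 'x set set" where
  "res x = {A \<in> \<A>. st A \<in> x}"

lemma coheir_closed:
  assumes "p \<in> M.S"
  shows "coheir p \<in> N.S"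
proof -
  note P = ultrafilterD[OF assms]
  have "(carrier H - B) \<inter> carrier G = carrier G - (B \<inter> carrier G)" for B
    using carrier_sub by auto
  then have "B \<in> coheir p \<or> carrier H - B \<in> coheir p" if "B \<in> \<B>" for B
    using that P(6)[of "B \<inter> carrier G"] trace N.compl by (auto simp: coheir_def)
  moreover have "B \<inter> C \<in> coheir p" if "B \<in> coheir p" "C \<in> coheir p" for B C
  proof -
    have "(B \<inter> carrier G) \<inter> (C \<inter> carrier G) = B \<inter> C \<inter> carrier G" by auto
    then show ?thesis using that P(4) N.int unfolding coheir_def by (metis (no_types, lifting) mem_Collect_eq)
  qed
  moreover have "C \<in> coheir p" if "B \<in> coheir p" "C \<in> \<B>" "B \<subseteq> C" for B C
    using that P(5)[of "B \<inter> carrier G" "C \<inter> carrier G"] trace by (auto simp: coheir_def)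
  moreover have "carrier H \<in> coheir p" "{} \<notin> coheir p" "coheir p \<subseteq> \<B>"
    using P(2,3) N.top carrier_sub by (auto simp: coheir_def Int_absorb1)
  ultimately show ?thesis unfolding ultrafilters_def by blast
qed

lemma res_closed:
  assumes "x \<in> N.S"
  shows "res x \<in> M.S"
proof -
  note X = ultrafilterD[OF assms]
  have "A \<in> res x \<or> carrier G - A \<in> res x" if "A \<in> \<A>" for A
    using that X(6) by (auto simp: res_def st_closed st_compl M.compl)
  moreover have "B \<in> res x" if "A \<in> res x" "B \<in> \<A>" "A \<subseteq> B" for A B
    using that X(5) st_mono st_closed by (auto simp: res_def)
  moreover have "A \<inter> B \<in> res x" if "A \<in> res x" "B \<in> res x" for A B
    using that X(4) by (auto simp: res_def st_int M.int)
  moreover have "carrier G \<in> res x" "{} \<notin> res x" "res x \<subseteq> \<A>"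
    using X(2,3) by (auto simp: res_def st_carrier st_empty M.top)
  ultimately show ?thesis unfolding ultrafilters_def by blast
qed

lemma shift_trace: "g \<in> carrier G \<Longrightarrow> shift H g B \<inter> carrier G = shift G g (B \<inter> carrier G)"
  unfolding shift_def using carrier_sub mult_eq by auto

lemma dmap_coheir:
  assumes "B \<in> \<B>"
  shows "dmap H (coheir q) B \<inter> carrier G = dmap G q (B \<inter> carrier G)"
  using assms carrier_sub
  by (auto simp: N.mem_dmap_iff M.mem_dmap_iff trace coheir_def shift_trace N.shift_closed)

text \<open>Membership in \<open>coheir p\<close> depends only on traces on
  \<open>carrier G\<close>, and there the d-maps of \<open>coheir q\<close> and of \<open>q\<close>
  agree.\<close>

lemma coheir_mult:
  assumes "p \<in> M.S" "q \<in> M.S"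
  shows "coheir (p \<star>M q) = coheir p \<star>N coheir q"
  using assms
  by (auto simp: N.mem_smult_iff M.mem_smult_iff dmap_coheir coheir_def[of p]
      coheir_def[of "p \<star>M q"] trace N.dmap_closed coheir_closed)

text \<open>\<open>coheir p\<close> sees \<open>dmap H x (st A)\<close> only at points of
  \<open>carrier G\<close>, where \<open>st_shift\<close> applies. A general left factor would also
  see the other points of \<open>carrier H\<close>, at which nothing relates the two d-maps.\<close>

lemma res_coheir_mult:
  assumes "p \<in> M.S" "x \<in> N.S"
  shows "res (coheir p \<star>N x) = p \<star>M res x"
proof -
  have "dmap H x (st A) \<inter> carrier G = dmap G (res x) A" if "A \<in> \<A>" for A
    using that carrier_sub
    by (auto simp: N.mem_dmap_iff M.mem_dmap_iff st_closed res_def M.shift_closed st_shift)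
  then show ?thesis using assms
    by (auto simp: N.mem_smult_iff M.mem_smult_iff coheir_def res_def[of "_ \<star>N _"] st_closed N.dmap_closed)
qed

text \<open>In model-theoretic terms, \<open>u\<close> is a definable type over the expansion and
  \<open>q\<close> extends it by the same defining scheme.\<close>

lemma definable_extension_exists:
  assumes u: "u \<in> M.S"
  obtains q where "q \<in> N.S" "\<And>A. A \<in> \<A> \<Longrightarrow> dmap H q (st A) = st (dmap G u A)"
proof -
  let ?F = "{shift H h (st A) | h A. A \<in> \<A> \<and> h \<in> st (dmap G u A)}"
  have stH: "st D \<subseteq> carrier H" if "D \<in> \<A>" for D using N.sub[OF st_closed[OF that]] .
  have dA: "dmap G u A \<in> \<A>" if "A \<in> \<A>" for A using M.dmap_closed[OF u that] .
  obtain q where q: "q \<in> N.S" "?F \<subseteq> q"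
  proof (rule N.ultrafilter_exists)
    show "?F \<subseteq> \<B>" using stH dA N.shift_closed st_closed by blast
    fix \<Delta> assume fin: "finite \<Delta>" and sub: "\<Delta> \<subseteq> ?F"
    obtain xs where xs: "set xs = \<Delta>" using finite_list[OF fin] by blast
    have "\<forall>B\<in>\<Delta>. \<exists>h A. B = shift H h (st A) \<and> A \<in> \<A> \<and> h \<in> st (dmap G u A)" using sub by blast
    then obtain hh AA where hA: "\<And>B. B \<in> \<Delta> \<Longrightarrow> B = shift H (hh B) (st (AA B)) \<and> AA B \<in> \<A> \<and> hh B \<in> st (dmap G u (AA B))"
      by metis
    have "\<exists>x\<in>carrier H. \<forall>i<length xs. hh (xs ! i) \<otimes>\<^bsub>H\<^esub> x \<in> st (AA (xs ! i))"
    proof (rule st_fip)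
      show "AA (xs ! i) \<in> \<A> \<and> dmap G u (AA (xs ! i)) \<in> \<A>" if "i < length xs" for i
        using that hA xs dA nth_mem by blast
      show "\<forall>i<length xs. hh (xs ! i) \<in> st (dmap G u (AA (xs ! i)))"
        using hA xs nth_mem by blast
      \<comment> \<open>Over \<open>G\<close> the required sentence holds because the finitely many
        shifts involved all belong to the ultrafilter \<open>u\<close>.\<close>
      fix g assume g: "\<forall>i<length xs. g i \<in> dmap G u (AA (xs ! i))"
      let ?E = "(\<lambda>i. shift G (g i) (AA (xs ! i))) ` {..<length xs}"
      have "?E \<subseteq> u" using g hA xs nth_mem by (auto simp: M.mem_dmap_iff)
      then have "carrier G \<inter> \<Inter>?E \<in> u" using M.ultrafilter_finite_int[OF u] by blast
      then have "carrier G \<inter> \<Inter>?E \<noteq> {}" using ultrafilterD(3)[OF u] by metis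
      then show "\<exists>x\<in>carrier G. \<forall>i<length xs. g i \<otimes>\<^bsub>G\<^esub> x \<in> AA (xs ! i)"
        unfolding shift_def by auto
    qed
    then obtain x where x: "x \<in> carrier H" "\<forall>i<length xs. hh (xs ! i) \<otimes>\<^bsub>H\<^esub> x \<in> st (AA (xs ! i))" by blast
    have "x \<in> B" if B: "B \<in> \<Delta>" for B
    proof -
      obtain i where "i < length xs" "xs ! i = B" using B xs by (auto simp: in_set_conv_nth)
      then have "x \<in> shift H (hh B) (st (AA B))" using x unfolding shift_def by auto
      then show ?thesis using hA[OF B] by simp
    qed
    then show "carrier H \<inter> \<Inter>\<Delta> \<noteq> {}" using x(1) by blast
  qed
  have "st (dmap G u A) = dmap H q (st A)" if A: "A \<in> \<A>" for A
  proof -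
    \<comment> \<open>The generating family gives one inclusion only. Applied to the complement of
      \<open>A\<close> it gives the other, since both d-maps and \<open>st\<close> respect
      complements.\<close>
    have 1: "st (dmap G u A) \<subseteq> dmap H q (st A)" if A: "A \<in> \<A>" for A
    proof
      fix h assume h: "h \<in> st (dmap G u A)"
      then show "h \<in> dmap H q (st A)"
        using q(2) A stH[OF dA[OF A]] by (auto simp: N.mem_dmap_iff st_closed)
    qed
    have "carrier H - st (dmap G u A) \<subseteq> carrier H - dmap H q (st A)"
      using 1[OF M.compl[OF A]] A u q(1)
      by (simp add: M.dmap_compl st_compl N.dmap_compl st_closed dA)
    moreover have "dmap H q (st A) \<subseteq> carrier H" unfolding dmap_def by auto
    ultimately show ?thesis using 1[OF A] by blast
  qed
  then show thesis using q(1) that by metis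
qed

theorem Ellis_group_embeds:
  assumes grp: "\<And>I. minimal_left_ideal N.S (\<star>N) I \<Longrightarrow> \<exists>e. group \<lparr>carrier = I, mult = (\<star>N), one = e\<rparr>"
    and E: "E \<in> Ellis_groups M.S (\<star>M)"
  shows "\<exists>F \<in> Ellis_groups N.S (\<star>N). \<exists>K. subgroup K F \<and>
           closedin (stone_topology (carrier H) \<B>) K \<and> E \<cong> F\<lparr>carrier := K\<rparr>"
proof -
  obtain u I where Eeq: "E = \<lparr>carrier = (\<star>M) u ` I, mult = (\<star>M), one = u\<rparr>"
    and I: "minimal_left_ideal M.S (\<star>M) I" and uI: "u \<in> I" and uu: "u \<star>M u = u"
    using E unfolding Ellis_groups_def by blast
  have IS: "I \<subseteq> M.S" and Icl: "\<And>s x. s \<in> M.S \<Longrightarrow> x \<in> I \<Longrightarrow> s \<star>M x \<in> I"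
    using I unfolding minimal_left_ideal_def left_ideal_def by auto
  have uS: "u \<in> M.S" using uI IS by auto
  obtain q where q: "q \<in> N.S" and dq: "\<And>A. A \<in> \<A> \<Longrightarrow> dmap H q (st A) = st (dmap G u A)"
    using definable_extension_exists[OF uS] by blast
  obtain J where J: "minimal_left_ideal N.S (\<star>N) J" and Jq: "\<And>y. y \<in> J \<Longrightarrow> \<exists>s\<in>N.S. y = s \<star>N q"
    using N.minimal_left_ideal_exists[OF q] by blast
  have JS: "J \<subseteq> N.S" and Jcl: "\<And>s x. s \<in> N.S \<Longrightarrow> x \<in> J \<Longrightarrow> s \<star>N x \<in> J"
    using J unfolding minimal_left_ideal_def left_ideal_def by auto
  obtain e where gJ: "group \<lparr>carrier = J, mult = (\<star>N), one = e\<rparr>" using grp[OF J] by blast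
  define F where "F = \<lparr>carrier = J, mult = (\<star>N), one = e\<rparr>"
  interpret F: group F using gJ F_def by simp
  have Fs: "carrier F = J" "\<And>x y. x \<otimes>\<^bsub>F\<^esub> y = x \<star>N y" "\<one>\<^bsub>F\<^esub> = e" by (auto simp: F_def)
  have eJ: "e \<in> J" using F.one_closed Fs by simp
  then have eS: "e \<in> N.S" using JS by auto
  have el: "\<And>x. x \<in> J \<Longrightarrow> e \<star>N x = x" using F.l_one Fs by simp
  \<comment> \<open>As \<open>e\<close> is a left identity, the Ellis group of \<open>J\<close> at
    \<open>e\<close> is all of \<open>J\<close>.\<close>
  then have "(\<star>N) e ` J = J" by auto
  then have FE: "F \<in> Ellis_groups N.S (\<star>N)"
    unfolding Ellis_groups_def F_def using J eJ el by blast

  define \<phi> where "\<phi> p = coheir p \<star>N e" for p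
  have \<phi>J: "\<phi> p \<in> J" if "p \<in> M.S" for p
    unfolding \<phi>_def using Jcl[OF coheir_closed[OF that] eJ] .
  \<comment> \<open>The inner \<open>e\<close> is absorbed because \<open>\<phi> s\<close> lies in
    \<open>J\<close>, on which \<open>e\<close> acts as identity from the left.\<close>
  have \<phi>mult: "\<phi> (p \<star>M s) = \<phi> p \<star>N \<phi> s" if "p \<in> M.S" "s \<in> M.S" for p s
  proof -
    have "\<phi> p \<star>N \<phi> s = coheir p \<star>N (e \<star>N \<phi> s)"
      unfolding \<phi>_def[of p] using N.smult_assoc coheir_closed that eS \<phi>J JS by blast
    also have "\<dots> = coheir p \<star>N (coheir s \<star>N e)" using el \<phi>J that by (simp add: \<phi>_def)
    also have "\<dots> = \<phi> (p \<star>M s)"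
      using that N.smult_assoc[OF coheir_closed coheir_closed eS] by (simp add: \<phi>_def coheir_mult)
    finally show ?thesis by simp
  qed
  have \<phi>u: "\<phi> u = e"
  proof -
    have "\<phi> u \<otimes>\<^bsub>F\<^esub> \<phi> u = \<phi> u" using \<phi>mult[OF uS uS] uu Fs by simp
    then show ?thesis using F.r_cancel_one'[of "\<phi> u" "\<phi> u"] \<phi>J[OF uS] Fs by simp
  qed

  \<comment> \<open>\<open>res e\<close> will be shown to lie in \<open>I\<close>, but it may lie
    outside the Ellis group. Its component \<open>a\<close> has an inverse \<open>b\<close> there,
    and right multiplication by \<open>res e\<close> or by \<open>a\<close> is the same on
    \<open>I\<close> because \<open>u\<close> is a right identity.\<close>
  define a where "a = u \<star>M res e"
  have resI: "res e \<in> I"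
  proof -
    obtain s where s: "s \<in> N.S" "e = s \<star>N q" using Jq[OF eJ] by blast
    \<comment> \<open>For this left factor, which need not come from M, the defining scheme of
      \<open>q\<close> replaces \<open>res_coheir_mult\<close>: \<open>dmap H q (st A)\<close> is
      again a set in the range of \<open>st\<close>.\<close>
    have "res e = res s \<star>M u"
      unfolding s(2) using dq uS
      by (auto simp: M.mem_smult_iff N.mem_smult_iff res_def st_closed M.dmap_closed)
    then show ?thesis using Icl[OF res_closed[OF s(1)] uI] by simp
  qed
  have aI: "a \<in> I" unfolding a_def using Icl uS resI by blast
  have ua: "u \<star>M a = a" unfolding a_def using M.smult_assoc uS resI IS uu by (metis subsetD)
  note cl = M.smult_closed and as = M.smult_assoc
  obtain b where b: "b \<in> I" "a \<star>M b = u"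
    using Ellis_group_inverse[of M.S "(\<star>M)" I u a] cl as I uI uu aI ua by metis
  have runit: "p \<star>M u = p" if "p \<in> I" for p
    by (rule minimal_left_ideal_right_unit[OF cl as I uI uu that])
  \<comment> \<open>Restriction turns \<open>\<phi> p\<close> into \<open>p \<star>M res e\<close>,
    and right multiplication by \<open>b\<close> then recovers \<open>p\<close>.\<close>
  have inj: "p = p'" if p: "p \<in> I" "p' \<in> I" and eq: "\<phi> p = \<phi> p'" for p p'
  proof -
    have *: "x \<star>M res e \<star>M b = x" if x: "x \<in> I" for x
    proof -
      have S: "x \<in> M.S" "b \<in> M.S" "res e \<in> M.S" "a \<in> M.S" using x b resI aI IS by auto
      have "x \<star>M res e = x \<star>M a" using as[OF S(1) uS S(3)] runit[OF x] a_def by simp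
      then show ?thesis using as[OF S(1,4,2)] b runit[OF x] by simp
    qed
    have "p \<star>M res e = p' \<star>M res e"
      using eq p IS res_coheir_mult[OF _ eS] unfolding \<phi>_def by (metis subsetD)
    then show ?thesis using * p by metis
  qed
  define K where "K = \<phi> ` M.S"
  have uIS: "(\<star>M) u ` I \<subseteq> I" using Icl uS by auto
  have KuI: "\<phi> ` (\<star>M) u ` I = K"
  proof
    show "\<phi> ` (\<star>M) u ` I \<subseteq> K" unfolding K_def using uIS IS by blast
    show "K \<subseteq> \<phi> ` (\<star>M) u ` I"
    proof
      fix y assume "y \<in> K"
      then obtain p where p: "p \<in> M.S" "y = \<phi> p" unfolding K_def by auto
      \<comment> \<open>The element framed by \<open>u\<close> lies in the Ellis group, and
        \<open>\<phi>\<close> maps both factors \<open>u\<close> to the identity.\<close>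
      have "\<phi> (u \<star>M (p \<star>M u)) = e \<otimes>\<^bsub>F\<^esub> (\<phi> p \<otimes>\<^bsub>F\<^esub> e)"
        using \<phi>mult cl uS p \<phi>u Fs by simp
      also have "\<dots> = \<phi> p" using F.l_one F.r_one Fs \<phi>J p by metis
      finally show "y \<in> \<phi> ` (\<star>M) u ` I" using p Icl uI by blast
    qed
  qed
  have sub: "subgroup K F"
  proof (rule F.subgroupI)
    show "K \<subseteq> carrier F" unfolding K_def using \<phi>J Fs by auto
    show "K \<noteq> {}" unfolding K_def using uS by auto
    show "x \<otimes>\<^bsub>F\<^esub> y \<in> K" if xy: "x \<in> K" "y \<in> K" for x y
    proof -
      obtain p s where "p \<in> M.S" "s \<in> M.S" "x = \<phi> p" "y = \<phi> s" using xy K_def by auto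
      then show ?thesis using \<phi>mult[of p s] cl[of p s] Fs(2) unfolding K_def by auto
    qed
    show "inv\<^bsub>F\<^esub> x \<in> K" if xK: "x \<in> K" for x
    proof -
      \<comment> \<open>A preimage inside the Ellis group is chosen, since only there an inverse is
        available.\<close>
      obtain p where p: "p \<in> I" "u \<star>M p = p" "x = \<phi> p"
      proof -
        obtain p0 where p0: "p0 \<in> I" "x = \<phi> (u \<star>M p0)" using xK KuI by auto
        have "u \<star>M (u \<star>M p0) = u \<star>M p0" using as[of u u p0] uS p0 IS uu by auto
        then show thesis using p0 that uIS by blast
      qed
      obtain c where c: "c \<in> I" "c \<star>M p = u"
        using Ellis_group_inverse[of M.S "(\<star>M)" I u p] cl as I uI uu p by metis
      have "\<phi> c \<otimes>\<^bsub>F\<^esub> x = \<one>\<^bsub>F\<^esub>" using \<phi>mult[of c p] c p IS Fs \<phi>u by auto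
      then have "inv\<^bsub>F\<^esub> x = \<phi> c" using F.inv_equality \<phi>J c p IS Fs(1) by (metis subsetD)
      then show ?thesis using c IS K_def by auto
    qed
  qed
  \<comment> \<open>An ultrafilter \<open>y\<close> is a value of \<open>\<phi>\<close> iff the
    traces \<open>dmap H e B \<inter> carrier G\<close> with \<open>B \<in> y\<close> lie in a
    common ultrafilter over M. By compactness it is enough that none of them is empty, and this is a
    closed condition on \<open>y\<close>.\<close>
  have Kchar: "K = {y \<in> N.S. \<forall>B \<in> {B \<in> \<B>. dmap H e B \<inter> carrier G = {}}. B \<notin> y}"
  proof (intro equalityI subsetI)
    fix y assume "y \<in> K"
    then obtain p where p: "p \<in> M.S" "y = \<phi> p" unfolding K_def by auto
    have "dmap H e B \<inter> carrier G \<in> p" if "B \<in> y" for B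
      using that p unfolding \<phi>_def by (auto simp: N.mem_smult_iff coheir_def)
    then show "y \<in> {y \<in> N.S. \<forall>B \<in> {B \<in> \<B>. dmap H e B \<inter> carrier G = {}}. B \<notin> y}"
      using p \<phi>J JS ultrafilterD(3)[OF p(1)] by fastforce
  next
    fix y assume y: "y \<in> {y \<in> N.S. \<forall>B \<in> {B \<in> \<B>. dmap H e B \<inter> carrier G = {}}. B \<notin> y}"
    then have yS: "y \<in> N.S" by simp
    have yB: "\<And>A. A \<in> y \<Longrightarrow> A \<in> \<B>" using ultrafilterD(1)[OF yS] .
    obtain p where p: "p \<in> M.S" "\<And>A. A \<in> y \<Longrightarrow> dmap H e A \<inter> carrier G \<in> p"
    proof -
      note * = that
      show thesis
      proof (rule N.dmap_trace_ultrafilter[OF M.set_algebra_axioms trace eS yS])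
        show "dmap H e A \<inter> carrier G \<noteq> {}" if "A \<in> y" for A using that y yB by blast
        show thesis if "p \<in> M.S" "\<And>A. A \<in> y \<Longrightarrow> dmap H e A \<inter> carrier G \<in> p" for p
          by (rule *[OF that])
      qed
    qed
    then have "y \<subseteq> \<phi> p" unfolding \<phi>_def
      using yB by (auto simp: N.mem_smult_iff coheir_def N.dmap_closed[OF eS])
    then have "y = \<phi> p" using N.ultrafilter_eqI[OF yS] \<phi>J[OF p(1)] JS by blast
    then show "y \<in> K" using p K_def by blast
  qed
  have "closedin (stone_topology (carrier H) \<B>) K"
    unfolding Kchar by (rule N.stone_closedin) auto
  moreover have "E \<cong> F\<lparr>carrier := K\<rparr>"
  proof -
    have "\<phi> \<in> iso E (F\<lparr>carrier := K\<rparr>)"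
    proof (rule isoI)
      show "\<phi> \<in> hom E (F\<lparr>carrier := K\<rparr>)"
        unfolding hom_def using KuI \<phi>mult uIS IS Fs by (auto simp: Eeq)
      have "inj_on \<phi> ((\<star>M) u ` I)" using inj uIS by (intro inj_onI) blast
      then show "bij_betw \<phi> (carrier E) (carrier (F\<lparr>carrier := K\<rparr>))"
        unfolding bij_betw_def using KuI by (simp add: Eeq)
    qed
    then show ?thesis unfolding is_iso_def by blast
  qed
  ultimately show ?thesis using FE sub by blast
qed

end

section \<open>Formulas and elementary extensions\<close>

lemma eval_tm_cong: "(\<forall>i\<in>fv_tm t. e i = e' i) \<Longrightarrow> eval_tm A e t = eval_tm A e' t"
  by (induction t) (auto cong: map_cong)

lemma sat_cong: "(\<forall>i\<in>fv_fm \<phi>. e i = e' i) \<Longrightarrow> sat A \<phi> e \<longleftrightarrow> sat A \<phi> e'"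
proof (induction \<phi> arbitrary: e e')
  case (Eq s t e e')
  then show ?case using eval_tm_cong[of s e e' A] eval_tm_cong[of t e e' A] by auto
next
  case (Rel r ts e e')
  have "eval_tm A e t = eval_tm A e' t" if "t \<in> set ts" for t
    by (rule eval_tm_cong) (use Rel that in auto)
  then have "map (eval_tm A e) ts = map (eval_tm A e') ts" by simp
  then show ?case unfolding sat.simps by (rule arg_cong)
next
  case (And \<phi> \<psi> e e')
  have "sat A \<phi> e \<longleftrightarrow> sat A \<phi> e'" by (rule And.IH(1)) (use And.prems in auto)
  moreover have "sat A \<psi> e \<longleftrightarrow> sat A \<psi> e'" by (rule And.IH(2)) (use And.prems in auto)
  ultimately show ?case by simp
next
  case (Neg \<phi> e e')
  have "sat A \<phi> e \<longleftrightarrow> sat A \<phi> e'" by (rule Neg.IH) (use Neg.prems in auto)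
  then show ?case by simp
next
  case (Ex v \<phi> e e')
  have "sat A \<phi> (e(v := a)) \<longleftrightarrow> sat A \<phi> (e'(v := a))" for a
    by (rule Ex.IH) (use Ex.prems in auto)
  then show ?case by simp
qed

lemma finite_fv_tm: "finite (fv_tm t)"
  by (induction t) auto

lemma finite_fv_fm: "finite (fv_fm \<phi>)"
  by (induction \<phi>) (auto simp: finite_fv_tm)

fun ren_tm :: "(nat \<Rightarrow> nat) \<Rightarrow> 'f tm \<Rightarrow> 'f tm" where
  "ren_tm f (Var i) = Var (f i)"
| "ren_tm f (Fun g ts) = Fun g (map (ren_tm f) ts)"

definition fresh_for :: "nat set \<Rightarrow> nat" where
  "fresh_for V = (SOME w. w \<notin> V)"

lemma fresh_for: "finite V \<Longrightarrow> fresh_for V \<notin> V"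
  unfolding fresh_for_def by (rule someI_ex) (rule ex_new_if_finite[OF infinite_UNIV_nat])

text \<open>A fresh bound variable is chosen at every quantifier, so \<open>f\<close> need not be
  injective. This matters when one block of variables is inserted at two places, as in the unit law
  \<open>mult_rel\<close> for \<open>e\<close>, \<open>x\<close>, \<open>x\<close>.\<close>

fun ren_fm :: "(nat \<Rightarrow> nat) \<Rightarrow> ('f, 'r) fm \<Rightarrow> ('f, 'r) fm" where
  "ren_fm f (Eq s t) = Eq (ren_tm f s) (ren_tm f t)"
| "ren_fm f (Rel r ts) = Rel r (map (ren_tm f) ts)"
| "ren_fm f (Neg \<phi>) = Neg (ren_fm f \<phi>)"
| "ren_fm f (And \<phi> \<psi>) = And (ren_fm f \<phi>) (ren_fm f \<psi>)"
| "ren_fm f (Ex v \<phi>) =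
     Ex (fresh_for (f ` fv_fm \<phi>)) (ren_fm (f(v := fresh_for (f ` fv_fm \<phi>))) \<phi>)"

lemma eval_ren_tm: "eval_tm A e (ren_tm f t) = eval_tm A (e \<circ> f) t"
proof (induction t)
  case (Fun g ts)
  have "map (eval_tm A e \<circ> ren_tm f) ts = map (eval_tm A (e \<circ> f)) ts"
    by (rule map_cong[OF refl]) (simp only: comp_apply[of _ "ren_tm f"] Fun.IH)
  then show ?case by (simp only: ren_tm.simps eval_tm.simps map_map)
qed simp

lemma sat_ren_fm: "sat A (ren_fm f \<phi>) e \<longleftrightarrow> sat A \<phi> (e \<circ> f)"
proof (induction \<phi> arbitrary: f e)
  case (Rel r ts f e)
  have "map (eval_tm A e \<circ> ren_tm f) ts = map (eval_tm A (e \<circ> f)) ts"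
    by (rule map_cong[OF refl]) (simp only: comp_apply[of _ "ren_tm f"] eval_ren_tm)
  then show ?case by (simp only: ren_fm.simps sat.simps map_map)
next
  case (Ex v \<phi> f e)
  let ?w = "fresh_for (f ` fv_fm \<phi>)"
  have w: "?w \<notin> f ` fv_fm \<phi>" by (simp add: fresh_for finite_fv_fm)
  have "sat A \<phi> (e(?w := a) \<circ> f(v := ?w)) \<longleftrightarrow> sat A \<phi> ((e \<circ> f)(v := a))" for a
    by (rule sat_cong) (use w in force)
  then show ?case by (simp only: ren_fm.simps sat.simps Ex.IH)
qed (simp_all add: eval_ren_tm)

lemma wf_ren_tm: "wf_tm L (ren_tm f t) \<longleftrightarrow> wf_tm L t"
  by (induction t) auto

lemma wf_ren_fm: "wf_fm L (ren_fm f \<phi>) \<longleftrightarrow> wf_fm L \<phi>"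
  by (induction \<phi> arbitrary: f) (auto simp: wf_ren_tm)

lemma fv_ren_tm: "fv_tm (ren_tm f t) = f ` fv_tm t"
  by (induction t) auto

lemma fv_ren_fm: "fv_fm (ren_fm f \<phi>) = f ` fv_fm \<phi>"
proof (induction \<phi> arbitrary: f)
  case (Ex v \<phi> f)
  let ?w = "fresh_for (f ` fv_fm \<phi>)"
  have w: "?w \<notin> f ` fv_fm \<phi>" by (simp add: fresh_for finite_fv_fm)
  then show ?case using Ex.IH by (auto simp: image_iff)
qed (auto simp: fv_ren_tm)

lemma sat_map_fm:
  assumes "univ A' = univ A" "fun_of A' = fun_of A" "\<And>r. rel_of A' (h r) = rel_of A r"
  shows "sat A' (map_fm id h \<phi>) e \<longleftrightarrow> sat A \<phi> e"
proof -
  have ev: "eval_tm A' e t = eval_tm A e t" for e t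
  proof (induction t)
    case (Fun g ts)
    then have "map (eval_tm A' e) ts = map (eval_tm A e) ts" by simp
    then show ?case by (simp only: eval_tm.simps assms(2))
  qed simp
  then have ev': "eval_tm A' e = eval_tm A e" for e by (rule ext)
  show ?thesis by (induction \<phi> arbitrary: e) (simp_all add: ev' assms tm.map_id0 tm.map_id)
qed

lemma wf_map_fm:
  assumes "funs L' = funs L" "fun_ar L' = fun_ar L" "\<And>r. r \<in> rels L \<Longrightarrow> h r \<in> rels L' \<and> rel_ar L' (h r) = rel_ar L r"
    and "wf_fm L \<phi>"
  shows "wf_fm L' (map_fm id h \<phi>)"
proof -
  have wt: "wf_tm L' t = wf_tm L t" for t by (induction t) (simp_all add: assms(1,2))
  show ?thesis using assms(4) by (induction \<phi>) (simp_all add: tm.map_id tm.map_ident wt assms(3))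
qed

definition upd_block :: "nat \<Rightarrow> 'a list \<Rightarrow> (nat \<Rightarrow> 'a) \<Rightarrow> nat \<Rightarrow> 'a" where
  "upd_block m xs e n = (if m \<le> n \<and> n < m + length xs then xs ! (n - m) else e n)"

lemma sat_foldr_Ex:
  "sat A (foldr fm.Ex [m..<m + k] \<phi>) e \<longleftrightarrow> (\<exists>xs\<in>power_of A k. sat A \<phi> (upd_block m xs e))"
proof (induction k arbitrary: m e)
  case (0 m e)
  have "upd_block m [] e = e" by (rule ext) (auto simp: upd_block_def)
  then show ?case by (simp add: power_of_def)
next
  case (Suc k m e)
  have sp: "upd_block (Suc m) xs (e(m := a)) = upd_block m (a # xs) e" for a xs
    by (rule ext) (auto simp: upd_block_def nth_Cons')
  have upt: "[m..<m + Suc k] = m # [Suc m..<Suc m + k]" by (simp add: upt_rec)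
  have "sat A (foldr fm.Ex [m..<m + Suc k] \<phi>) e \<longleftrightarrow>
      (\<exists>a\<in>univ A. \<exists>xs\<in>power_of A k. sat A \<phi> (upd_block m (a # xs) e))"
    by (simp only: upt foldr.simps comp_apply sat.simps Suc.IH sp)
  also have "\<dots> \<longleftrightarrow> (\<exists>xs\<in>power_of A (Suc k). sat A \<phi> (upd_block m xs e))"
  proof
    assume "\<exists>a\<in>univ A. \<exists>xs\<in>power_of A k. sat A \<phi> (upd_block m (a # xs) e)"
    then obtain a xs where a: "a \<in> univ A" "xs \<in> power_of A k" "sat A \<phi> (upd_block m (a # xs) e)" by blast
    then have "a # xs \<in> power_of A (Suc k)" by (simp add: power_of_def)
    then show "\<exists>xs\<in>power_of A (Suc k). sat A \<phi> (upd_block m xs e)" using a(3) by blast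
  next
    assume "\<exists>xs\<in>power_of A (Suc k). sat A \<phi> (upd_block m xs e)"
    then obtain ys where ys: "ys \<in> power_of A (Suc k)" "sat A \<phi> (upd_block m ys e)" by blast
    then obtain a xs where "ys = a # xs" by (cases ys) (auto simp: power_of_def)
    then show "\<exists>a\<in>univ A. \<exists>xs\<in>power_of A k. sat A \<phi> (upd_block m (a # xs) e)"
      using ys by (auto simp: power_of_def)
  qed
  finally show ?case .
qed

lemma wf_foldr_Ex: "wf_fm L (foldr fm.Ex vs \<phi>) \<longleftrightarrow> wf_fm L \<phi>"
  by (induction vs) auto

lemma fv_foldr_Ex: "fv_fm (foldr fm.Ex vs \<phi>) = fv_fm \<phi> - set vs"
  by (induction vs) auto

lemma elem_substruct_univ: "elem_substruct L A B \<Longrightarrow> univ A \<subseteq> univ B"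
  unfolding elem_substruct_def substruct_def by auto

lemma elem_substruct_nonempty: "elem_substruct L A B \<Longrightarrow> univ A \<noteq> {}"
  unfolding elem_substruct_def substruct_def is_struct_def by auto

text \<open>Elementarity compares assignments with values in \<open>A\<close> only. For values in
  \<open>B\<close>, the free variables outside \<open>V\<close> are universally quantified one after
  the other, by induction on their number; those in \<open>V\<close> act as parameters from
  \<open>A\<close>.\<close>

lemma elem_substruct_valid:
  assumes AB: "elem_substruct L A B" and "wf_fm L \<phi>" and e0: "range e0 \<subseteq> univ A"
    and "\<And>e. range e \<subseteq> univ A \<Longrightarrow> \<forall>n\<in>V. e n = e0 n \<Longrightarrow> sat A \<phi> e"
    and "range e \<subseteq> univ B" "\<forall>n\<in>V. e n = e0 n"
  shows "sat B \<phi> e"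
  using assms(2,4-)
proof (induction "card (fv_fm \<phi> - V)" arbitrary: \<phi> e rule: less_induct)
  case less
  show ?case
  proof (cases "fv_fm \<phi> \<subseteq> V")
    case True
    have "sat B \<phi> e \<longleftrightarrow> sat B \<phi> e0" by (rule sat_cong) (use True less.prems in auto)
    also have "\<dots> \<longleftrightarrow> sat A \<phi> e0" using AB e0 less.prems(1) unfolding elem_substruct_def by blast
    also have "\<dots>" using less.prems(2)[OF e0] by simp
    finally show ?thesis by simp
  next
    case False
    then obtain v where v: "v \<in> fv_fm \<phi>" "v \<notin> V" by blast
    let ?\<psi> = "Neg (fm.Ex v (Neg \<phi>))"
    have "sat B ?\<psi> e"
    proof (rule less.hyps)
      show "card (fv_fm ?\<psi> - V) < card (fv_fm \<phi> - V)"
        using v finite_fv_fm[of \<phi>] by (intro psubset_card_mono) auto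
      show "wf_fm L ?\<psi>" using less.prems(1) by simp
      show "range e \<subseteq> univ B" "\<forall>n\<in>V. e n = e0 n" by (fact less.prems)+
      fix e' assume e': "range e' \<subseteq> univ A" "\<forall>n\<in>V. e' n = e0 n"
      have "sat A \<phi> (e'(v := a))" if "a \<in> univ A" for a
        by (rule less.prems(2)) (use e' that v in auto)
      then show "sat A ?\<psi> e'" by simp
    qed
    moreover have "e v \<in> univ B" using less.prems(3) by auto
    ultimately have "sat B \<phi> (e(v := e v))" unfolding sat.simps by blast
    then show ?thesis by simp
  qed
qed

section \<open>Predicates on blocks of variables\<close>

text \<open>The variables are grouped into consecutive blocks of length \<open>d\<close>, so that one block
  carries one element of a definable subset of the power of exponent \<open>d\<close>.\<close>

definition blocks :: "nat \<Rightarrow> (nat \<Rightarrow> 'a) \<Rightarrow> nat \<Rightarrow> 'a list" where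
  "blocks d e i = map e [i * d..<i * d + d]"

definition env_in :: "('f, 'r, 'a) struct \<Rightarrow> nat \<Rightarrow> (nat \<Rightarrow> 'a list) \<Rightarrow> bool" where
  "env_in A d E \<longleftrightarrow> (\<forall>i. E i \<in> power_of A d)"

lemma env_in_blocks: "range e \<subseteq> univ A \<Longrightarrow> env_in A d (blocks d e)"
  unfolding env_in_def blocks_def power_of_def by auto

lemma nth_blocks: "j < d \<Longrightarrow> blocks d e i ! j = e (i * d + j)"
  unfolding blocks_def by simp

text \<open>An inverse of \<open>blocks d\<close> on environments in the power. For
  \<open>d = 0\<close> every block is empty and determines no variable, so an arbitrary value
  \<open>c\<close> is assigned.\<close>

definition unblocks :: "'a \<Rightarrow> nat \<Rightarrow> (nat \<Rightarrow> 'a list) \<Rightarrow> nat \<Rightarrow> 'a" where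
  "unblocks c d E n = (if d = 0 then c else E (n div d) ! (n mod d))"

lemma unblocks_range: "env_in A d E \<Longrightarrow> c \<in> univ A \<Longrightarrow> range (unblocks c d E) \<subseteq> univ A"
proof (rule image_subsetI)
  fix n assume E: "env_in A d E" "c \<in> univ A"
  show "unblocks c d E n \<in> univ A"
  proof (cases "d = 0")
    case False
    have "E (n div d) \<in> power_of A d" using E(1) by (simp add: env_in_def)
    then have "set (E (n div d)) \<subseteq> univ A" "n mod d < length (E (n div d))"
      using False by (simp_all add: power_of_def)
    then show ?thesis using False nth_mem by (auto simp: unblocks_def)
  qed (simp add: unblocks_def E(2))
qed

lemma blocks_unblocks: "env_in A d E \<Longrightarrow> blocks d (unblocks c d E) = E"
  by (intro ext nth_equalityI) (auto simp: blocks_def unblocks_def env_in_def power_of_def)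

text \<open>One formula has to work in both structures, with \<open>\<Phi>\<close> its reading in
  \<open>A\<close> and \<open>\<Psi>\<close> its reading in \<open>B\<close>. The closure rules
  below then allow transfer of statements about tuples without writing formulas out.\<close>

definition expressible ::
    "('f, 'r) lang \<Rightarrow> ('f, 'r, 'a) struct \<Rightarrow> ('f, 'r, 'a) struct \<Rightarrow> nat
     \<Rightarrow> ((nat \<Rightarrow> 'a list) \<Rightarrow> bool) \<Rightarrow> ((nat \<Rightarrow> 'a list) \<Rightarrow> bool) \<Rightarrow> bool" where
  "expressible L A B d \<Phi> \<Psi> \<longleftrightarrow> (\<exists>\<phi>. wf_fm L \<phi> \<and>
     (\<forall>e. range e \<subseteq> univ A \<longrightarrow> (sat A \<phi> e \<longleftrightarrow> \<Phi> (blocks d e))) \<and>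
     (\<forall>e. range e \<subseteq> univ B \<longrightarrow> (sat B \<phi> e \<longleftrightarrow> \<Psi> (blocks d e))))"

lemma expressible_cong:
  assumes "expressible L A B d \<Phi> \<Psi>"
    and "\<And>E. env_in A d E \<Longrightarrow> \<Phi> E \<longleftrightarrow> \<Phi>' E" "\<And>E. env_in B d E \<Longrightarrow> \<Psi> E \<longleftrightarrow> \<Psi>' E"
  shows "expressible L A B d \<Phi>' \<Psi>'"
  using assms env_in_blocks unfolding expressible_def by metis

lemma expressible_neg:
  assumes "expressible L A B d \<Phi> \<Psi>"
  shows "expressible L A B d (\<lambda>E. \<not> \<Phi> E) (\<lambda>E. \<not> \<Psi> E)"
  using assms unfolding expressible_def by (metis sat.simps(3) wf_fm.simps(3))

lemma expressible_conj:
  assumes "expressible L A B d \<Phi> \<Psi>" "expressible L A B d \<Phi>' \<Psi>'"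
  shows "expressible L A B d (\<lambda>E. \<Phi> E \<and> \<Phi>' E) (\<lambda>E. \<Psi> E \<and> \<Psi>' E)"
  using assms unfolding expressible_def by (metis sat.simps(4) wf_fm.simps(4))

lemma expressible_imp:
  assumes "expressible L A B d \<Phi> \<Psi>" "expressible L A B d \<Phi>' \<Psi>'"
  shows "expressible L A B d (\<lambda>E. \<Phi> E \<longrightarrow> \<Phi>' E) (\<lambda>E. \<Psi> E \<longrightarrow> \<Psi>' E)"
  by (rule expressible_cong[OF expressible_neg[OF expressible_conj[OF assms(1) expressible_neg[OF assms(2)]]]]) auto

lemma expressible_Ball:
  assumes "finite S" "\<And>s. s \<in> S \<Longrightarrow> expressible L A B d (\<Phi> s) (\<Psi> s)"
  shows "expressible L A B d (\<lambda>E. \<forall>s\<in>S. \<Phi> s E) (\<lambda>E. \<forall>s\<in>S. \<Psi> s E)"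
  using assms
proof (induction rule: finite_induct)
  case empty
  show ?case unfolding expressible_def by (rule exI[of _ "Eq (Var 0) (Var 0)"]) simp
next
  case (insert s S)
  then have "expressible L A B d (\<lambda>E. \<Phi> s E \<and> (\<forall>s\<in>S. \<Phi> s E)) (\<lambda>E. \<Psi> s E \<and> (\<forall>s\<in>S. \<Psi> s E))"
    by (intro expressible_conj) auto
  then show ?case by (rule expressible_cong) auto
qed

lemma blocks_upd_block:
  assumes "length xs = d"
  shows "blocks d (upd_block (i * d) xs e) = (blocks d e)(i := xs)"
proof (rule ext)
  fix i'
  have "upd_block (i * d) xs e (i' * d + j) = (if i' = i then xs ! j else e (i' * d + j))" if "j < d" for j
  proof (cases "i' = i")
    case False
    \<comment> \<open>A common position of two blocks would have both block numbers as its quotient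
      by \<open>d\<close>.\<close>
    have "\<not> (i * d \<le> i' * d + j \<and> i' * d + j < i * d + d)"
    proof
      assume *: "i * d \<le> i' * d + j \<and> i' * d + j < i * d + d"
      have "(i' * d + j) div d = i'" using that by simp
      moreover have "(i * d + (i' * d + j - i * d)) div d = i" using * by (subst div_mult_self3) auto
      ultimately show False using * False by simp
    qed
    then show ?thesis using False assms by (auto simp: upd_block_def)
  qed (use that assms in \<open>auto simp: upd_block_def\<close>)
  then show "blocks d (upd_block (i * d) xs e) i' = ((blocks d e)(i := xs)) i'"
    using assms by (intro nth_equalityI) (auto simp: blocks_def)
qed

lemma upd_block_range: "xs \<in> power_of A d \<Longrightarrow> range e \<subseteq> univ A \<Longrightarrow> range (upd_block m xs e) \<subseteq> univ A"
  unfolding upd_block_def power_of_def by (auto simp: image_subset_iff subset_iff)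

lemma expressible_Bex:
  fixes A B :: "('f, 'r, 'a) struct"
  assumes "expressible L A B d \<Phi> \<Psi>"
  shows "expressible L A B d (\<lambda>E. \<exists>x\<in>power_of A d. \<Phi> (E(i := x))) (\<lambda>E. \<exists>x\<in>power_of B d. \<Psi> (E(i := x)))"
proof -
  obtain \<phi> where wf: "wf_fm L \<phi>"
    and A: "\<And>e. range e \<subseteq> univ A \<Longrightarrow> sat A \<phi> e \<longleftrightarrow> \<Phi> (blocks d e)"
    and B: "\<And>e. range e \<subseteq> univ B \<Longrightarrow> sat B \<phi> e \<longleftrightarrow> \<Psi> (blocks d e)"
    using assms unfolding expressible_def by blast
  have bl: "blocks d (upd_block (i * d) xs e) = (blocks d e)(i := xs)" if "xs \<in> power_of C d" for C :: "('f, 'r, 'a) struct" and xs and e :: "nat \<Rightarrow> 'a"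
    using that by (intro blocks_upd_block) (simp add: power_of_def)
  show ?thesis unfolding expressible_def
  proof (intro exI[of _ "foldr fm.Ex [i * d..<i * d + d] \<phi>"] conjI allI impI)
    show "wf_fm L (foldr fm.Ex [i * d..<i * d + d] \<phi>)" using wf by (simp add: wf_foldr_Ex)
  next
    fix e :: "nat \<Rightarrow> 'a" assume "range e \<subseteq> univ A"
    then show "sat A (foldr fm.Ex [i * d..<i * d + d] \<phi>) e \<longleftrightarrow> (\<exists>x\<in>power_of A d. \<Phi> ((blocks d e)(i := x)))"
      unfolding sat_foldr_Ex by (intro bex_cong refl) (simp add: A upd_block_range bl)
  next
    fix e :: "nat \<Rightarrow> 'a" assume "range e \<subseteq> univ B"
    then show "sat B (foldr fm.Ex [i * d..<i * d + d] \<phi>) e \<longleftrightarrow> (\<exists>x\<in>power_of B d. \<Psi> ((blocks d e)(i := x)))"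
      unfolding sat_foldr_Ex by (intro bex_cong refl) (simp add: B upd_block_range bl)
  qed
qed

lemma nth_concat_blocks:
  assumes "\<forall>xs\<in>set xss. length xs = d" "n < length xss * d"
  shows "concat xss ! n = xss ! (n div d) ! (n mod d)"
  using assms
proof (induction xss arbitrary: n)
  case (Cons xs xss n)
  show ?case
  proof (cases "n < d")
    case True
    then show ?thesis using Cons.prems by (simp add: nth_append)
  next
    case False
    then have d: "d > 0" "d \<le> n" using Cons.prems(2) by (auto intro: gr0I)
    have "concat xss ! (n - d) = xss ! ((n - d) div d) ! ((n - d) mod d)"
      using Cons.prems d by (intro Cons.IH) auto
    then show ?thesis using Cons.prems d False by (simp add: nth_append le_div_geq le_mod_geq)
  qed
qed simp

lemma expressible_sat:
  fixes A B :: "('f, 'r, 'a) struct"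
  assumes "wf_fm L \<phi>" "fv_fm \<phi> \<subseteq> {..<length is * d}"
  shows "expressible L A B d (\<lambda>E. sat A \<phi> (nth (concat (map E is)))) (\<lambda>E. sat B \<phi> (nth (concat (map E is))))"
proof -
  \<comment> \<open>Position \<open>n\<close> of the concatenated tuple has offset
    \<open>n mod d\<close> in its component \<open>n div d\<close>; it is redirected to the same
    offset in the block listed there in \<open>is\<close>.\<close>
  let ?f = "\<lambda>n. is ! (n div d) * d + n mod d"
  have "sat C (ren_fm ?f \<phi>) e \<longleftrightarrow> sat C \<phi> (nth (concat (map (blocks d e) is)))"
    for C :: "('f, 'r, 'a) struct" and e :: "nat \<Rightarrow> 'a"
    unfolding sat_ren_fm
  proof (rule sat_cong, rule ballI)
    fix n assume "n \<in> fv_fm \<phi>"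
    then have n: "n < length is * d" using assms(2) by auto
    then have d: "d > 0" by (auto intro: gr0I)
    have k: "n div d < length is" using n by (simp add: less_mult_imp_div_less)
    have "concat (map (blocks d e) is) ! n = map (blocks d e) is ! (n div d) ! (n mod d)"
      using n by (intro nth_concat_blocks) (auto simp: blocks_def)
    also have "\<dots> = e (?f n)" using k d by (simp add: nth_blocks)
    finally show "(e \<circ> ?f) n = concat (map (blocks d e) is) ! n" by simp
  qed
  then show ?thesis unfolding expressible_def using assms(1)
    by (intro exI[of _ "ren_fm ?f \<phi>"]) (simp add: wf_ren_fm)
qed

lemma expressible_eq: "expressible L A B d (\<lambda>E. E i = E j) (\<lambda>E. E i = E j)"
proof -
  have "expressible L A B d (\<lambda>E. E i ! k = E j ! k) (\<lambda>E. E i ! k = E j ! k)" if "k < d" for k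
    unfolding expressible_def
    by (rule exI[of _ "Eq (Var (i * d + k)) (Var (j * d + k))"]) (simp add: nth_blocks that)
  then have "expressible L A B d (\<lambda>E. \<forall>k\<in>{..<d}. E i ! k = E j ! k) (\<lambda>E. \<forall>k\<in>{..<d}. E i ! k = E j ! k)"
    by (intro expressible_Ball) auto
  then show ?thesis
    by (rule expressible_cong) (auto simp: env_in_def power_of_def list_eq_iff_nth_eq)
qed

lemma expressible_agree:
  assumes "elem_substruct L A B" "expressible L A B d \<Phi> \<Psi>" "env_in A d E"
  shows "\<Phi> E \<longleftrightarrow> \<Psi> E"
proof -
  obtain \<phi> where \<phi>: "wf_fm L \<phi>"
    "\<And>e. range e \<subseteq> univ A \<Longrightarrow> sat A \<phi> e \<longleftrightarrow> \<Phi> (blocks d e)"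
    "\<And>e. range e \<subseteq> univ B \<Longrightarrow> sat B \<phi> e \<longleftrightarrow> \<Psi> (blocks d e)"
    using assms(2) unfolding expressible_def by blast
  obtain c where c: "c \<in> univ A" using elem_substruct_nonempty[OF assms(1)] by blast
  let ?e = "unblocks c d E"
  have e: "range ?e \<subseteq> univ A" by (rule unblocks_range[OF assms(3) c])
  then have "sat A \<phi> ?e \<longleftrightarrow> sat B \<phi> ?e" using assms(1) \<phi>(1) unfolding elem_substruct_def by blast
  moreover have "range ?e \<subseteq> univ B" using e elem_substruct_univ[OF assms(1)] by blast
  ultimately show ?thesis using \<phi>(2,3)[of ?e] e by (simp add: blocks_unblocks[OF assms(3)])
qed

text \<open>\<open>W\<close> names the blocks held fixed as parameters from the smaller structure;
  the remaining ones are universally quantified.\<close>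

lemma expressible_valid:
  assumes "elem_substruct L A B" "expressible L A B d \<Phi> \<Psi>" "env_in A d E0"
    and valid: "\<And>E. env_in A d E \<Longrightarrow> \<forall>i\<in>W. E i = E0 i \<Longrightarrow> \<Phi> E"
    and "env_in B d E" "\<forall>i\<in>W. E i = E0 i"
  shows "\<Psi> E"
proof -
  obtain \<phi> where \<phi>: "wf_fm L \<phi>"
    "\<And>e. range e \<subseteq> univ A \<Longrightarrow> sat A \<phi> e \<longleftrightarrow> \<Phi> (blocks d e)"
    "\<And>e. range e \<subseteq> univ B \<Longrightarrow> sat B \<phi> e \<longleftrightarrow> \<Psi> (blocks d e)"
    using assms(2) unfolding expressible_def by blast
  obtain c where c: "c \<in> univ A" "c \<in> univ B"
    using elem_substruct_nonempty[OF assms(1)] elem_substruct_univ[OF assms(1)] by blast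
  have e: "range (unblocks c d E) \<subseteq> univ B" by (rule unblocks_range[OF assms(5) c(2)])
  have "sat B \<phi> (unblocks c d E)"
  proof (rule elem_substruct_valid[OF assms(1) \<phi>(1) unblocks_range[OF assms(3) c(1)] _ e])
    show "\<forall>n\<in>{n. n div d \<in> W}. unblocks c d E n = unblocks c d E0 n"
      using assms(6) by (simp add: unblocks_def)
    fix e assume e: "range e \<subseteq> univ A" "\<forall>n\<in>{n. n div d \<in> W}. e n = unblocks c d E0 n"
    have "blocks d e i = blocks d (unblocks c d E0) i" if "i \<in> W" for i
    proof (rule nth_equalityI)
      fix j assume "j < length (blocks d e i)"
      then have j: "j < d" by (simp add: blocks_def)
      then have "(i * d + j) div d = i" by simp
      then have "e (i * d + j) = unblocks c d E0 (i * d + j)" using e(2) that by simp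
      then show "blocks d e i ! j = blocks d (unblocks c d E0) i ! j" by (simp add: nth_blocks j)
    qed (simp add: blocks_def)
    then have "\<Phi> (blocks d e)"
      using valid[OF env_in_blocks[OF e(1)]] by (simp add: blocks_unblocks[OF assms(3)])
    then show "sat A \<phi> e" using \<phi>(2)[OF e(1)] by simp
  qed
  then show ?thesis using \<phi>(3)[OF e] by (simp add: blocks_unblocks[OF assms(5)])
qed

section \<open>Transfer of definable groups\<close>

lemma expressible_Ball_power:
  assumes "expressible L A B d \<Phi> \<Psi>"
  shows "expressible L A B d (\<lambda>E. \<forall>x\<in>power_of A d. \<Phi> (E(i := x))) (\<lambda>E. \<forall>x\<in>power_of B d. \<Psi> (E(i := x)))"
  by (rule expressible_cong[OF expressible_neg[OF expressible_Bex[OF expressible_neg[OF assms], of i]]]) auto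

lemma expressible_valid_closed:
  assumes "elem_substruct L A B" "expressible L A B d \<Phi> \<Psi>"
    and "\<And>E. env_in A d E \<Longrightarrow> \<Phi> E" and "env_in B d E"
  shows "\<Psi> E"
proof -
  obtain c where "c \<in> univ A" using elem_substruct_nonempty[OF assms(1)] by blast
  then have "env_in A d (\<lambda>_. replicate d c)" by (auto simp: env_in_def power_of_def)
  then show ?thesis
    using expressible_valid[OF assms(1,2) _ _ assms(4), of _ "{}"] assms(3) by blast
qed

definition mult_rel :: "('f, 'r) group_fms \<Rightarrow> ('f, 'r, 'a) struct \<Rightarrow> 'a list \<Rightarrow> 'a list \<Rightarrow> 'a list \<Rightarrow> bool" where
  "mult_rel \<Gamma> A x y z \<longleftrightarrow> sat A (mult_fm \<Gamma>) (nth (x @ y @ z))"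

definition group_fms_wf :: "('f, 'r) lang \<Rightarrow> ('f, 'r) group_fms \<Rightarrow> bool" where
  "group_fms_wf L \<Gamma> \<longleftrightarrow> wf_fm L (dom_fm \<Gamma>) \<and> fv_fm (dom_fm \<Gamma>) \<subseteq> {..<dim \<Gamma>} \<and>
     wf_fm L (mult_fm \<Gamma>) \<and> fv_fm (mult_fm \<Gamma>) \<subseteq> {..<3 * dim \<Gamma>}"

text \<open>The group axioms in terms of the graph of multiplication, so that each clause is a
  first-order sentence; \<open>group_of\<close> uses definite descriptions, which cannot be
  transferred directly. A left unit and left inverses suffice.\<close>

definition group_graph :: "'x set \<Rightarrow> ('x \<Rightarrow> 'x \<Rightarrow> 'x \<Rightarrow> bool) \<Rightarrow> bool" where
  "group_graph D \<mu> \<longleftrightarrow>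
     (\<forall>x\<in>D. \<forall>y\<in>D. \<exists>z\<in>D. \<mu> x y z) \<and>
     (\<forall>x\<in>D. \<forall>y\<in>D. \<forall>z\<in>D. \<forall>z'\<in>D. \<mu> x y z \<and> \<mu> x y z' \<longrightarrow> z = z') \<and>
     (\<forall>x\<in>D. \<forall>y\<in>D. \<forall>z\<in>D. \<forall>a\<in>D. \<forall>b\<in>D. \<forall>c\<in>D. \<mu> x y a \<and> \<mu> y z b \<and> \<mu> a z c \<longrightarrow> \<mu> x b c) \<and>
     (\<exists>e\<in>D. (\<forall>x\<in>D. \<mu> e x x) \<and> (\<forall>x\<in>D. \<exists>y\<in>D. \<mu> y x e))"

lemma dom_of_subset: "dom_of \<Gamma> A \<subseteq> power_of A (dim \<Gamma>)"
  unfolding dom_of_def by auto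

lemma carrier_group_of: "carrier (group_of \<Gamma> A) = dom_of \<Gamma> A"
  unfolding group_of_def by simp

lemma definable_group_wf: "definable_group L \<Gamma> A \<Longrightarrow> group_fms_wf L \<Gamma>"
  unfolding definable_group_def group_fms_wf_def by blast

lemma definable_group_group: "definable_group L \<Gamma> A \<Longrightarrow> group (group_of \<Gamma> A)"
  unfolding definable_group_def by blast

lemma mult_rel_iff:
  assumes "definable_group L \<Gamma> A" "x \<in> dom_of \<Gamma> A" "y \<in> dom_of \<Gamma> A" "z \<in> dom_of \<Gamma> A"
  shows "mult_rel \<Gamma> A x y z \<longleftrightarrow> z = x \<otimes>\<^bsub>group_of \<Gamma> A\<^esub> y"
proof -
  have ex1: "\<exists>!z. z \<in> dom_of \<Gamma> A \<and> mult_rel \<Gamma> A x y z"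
    using assms unfolding definable_group_def mult_rel_def by blast
  have eq: "x \<otimes>\<^bsub>group_of \<Gamma> A\<^esub> y = (THE z. z \<in> dom_of \<Gamma> A \<and> mult_rel \<Gamma> A x y z)"
    unfolding group_of_def mult_rel_def by simp
  show ?thesis unfolding eq using theI'[OF ex1] the1_equality[OF ex1] assms(4) by metis
qed

lemma definable_group_graph:
  assumes "definable_group L \<Gamma> A"
  shows "group_graph (dom_of \<Gamma> A) (mult_rel \<Gamma> A)"
proof -
  interpret group "group_of \<Gamma> A" by (rule definable_group_group[OF assms])
  note iff = mult_rel_iff[OF assms]
  have closed: "x \<otimes>\<^bsub>group_of \<Gamma> A\<^esub> y \<in> dom_of \<Gamma> A" if "x \<in> dom_of \<Gamma> A" "y \<in> dom_of \<Gamma> A" for x y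
    using m_closed that by (simp add: carrier_group_of)
  have one: "\<one>\<^bsub>group_of \<Gamma> A\<^esub> \<in> dom_of \<Gamma> A" using one_closed by (simp add: carrier_group_of)
  have l1: "\<one>\<^bsub>group_of \<Gamma> A\<^esub> \<otimes>\<^bsub>group_of \<Gamma> A\<^esub> x = x" if "x \<in> dom_of \<Gamma> A" for x
    using l_one that by (simp add: carrier_group_of)
  show ?thesis unfolding group_graph_def
  proof (intro conjI ballI impI)
    show "\<exists>z\<in>dom_of \<Gamma> A. mult_rel \<Gamma> A x y z" if "x \<in> dom_of \<Gamma> A" "y \<in> dom_of \<Gamma> A" for x y
      using iff[OF that closed[OF that]] closed[OF that] by blast
    show "z = z'" if "x \<in> dom_of \<Gamma> A" "y \<in> dom_of \<Gamma> A" "z \<in> dom_of \<Gamma> A" "z' \<in> dom_of \<Gamma> A"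
      "mult_rel \<Gamma> A x y z \<and> mult_rel \<Gamma> A x y z'" for x y z z'
      using iff[OF that(1,2,3)] iff[OF that(1,2,4)] that(5) by simp
    show "mult_rel \<Gamma> A x b c"
      if "x \<in> dom_of \<Gamma> A" "y \<in> dom_of \<Gamma> A" "z \<in> dom_of \<Gamma> A" "a \<in> dom_of \<Gamma> A" "b \<in> dom_of \<Gamma> A"
        "c \<in> dom_of \<Gamma> A" "mult_rel \<Gamma> A x y a \<and> mult_rel \<Gamma> A y z b \<and> mult_rel \<Gamma> A a z c" for x y z a b c
      using that m_assoc[of x y z] by (simp add: iff carrier_group_of closed)
    have "\<exists>y\<in>dom_of \<Gamma> A. mult_rel \<Gamma> A y x \<one>\<^bsub>group_of \<Gamma> A\<^esub>" if x: "x \<in> dom_of \<Gamma> A" for x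
    proof -
      obtain y where y: "y \<in> dom_of \<Gamma> A" "y \<otimes>\<^bsub>group_of \<Gamma> A\<^esub> x = \<one>\<^bsub>group_of \<Gamma> A\<^esub>"
        using l_inv_ex[of x] x by (auto simp: carrier_group_of)
      then have "mult_rel \<Gamma> A y x \<one>\<^bsub>group_of \<Gamma> A\<^esub>" using iff[OF y(1) x one] by simp
      then show ?thesis using y(1) by blast
    qed
    moreover have "mult_rel \<Gamma> A \<one>\<^bsub>group_of \<Gamma> A\<^esub> x x" if "x \<in> dom_of \<Gamma> A" for x
      using iff[OF one that that] l1[OF that] by simp
    ultimately show "\<exists>e\<in>dom_of \<Gamma> A. (\<forall>x\<in>dom_of \<Gamma> A. mult_rel \<Gamma> A e x x) \<and>
        (\<forall>x\<in>dom_of \<Gamma> A. \<exists>y\<in>dom_of \<Gamma> A. mult_rel \<Gamma> A y x e)"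
      using one by blast
  qed
qed

lemma definable_groupI:
  assumes wf: "group_fms_wf L \<Gamma>" and gr: "group_graph (dom_of \<Gamma> A) (mult_rel \<Gamma> A)"
  shows "definable_group L \<Gamma> A"
proof -
  let ?D = "dom_of \<Gamma> A" and ?\<mu> = "mult_rel \<Gamma> A"
  have ex: "\<And>x y. x \<in> ?D \<Longrightarrow> y \<in> ?D \<Longrightarrow> \<exists>z\<in>?D. ?\<mu> x y z"
    and un: "\<And>x y z z'. x \<in> ?D \<Longrightarrow> y \<in> ?D \<Longrightarrow> z \<in> ?D \<Longrightarrow> z' \<in> ?D \<Longrightarrow> ?\<mu> x y z \<Longrightarrow> ?\<mu> x y z' \<Longrightarrow> z = z'"
    and assoc: "\<And>x y z a b c. x \<in> ?D \<Longrightarrow> y \<in> ?D \<Longrightarrow> z \<in> ?D \<Longrightarrow> a \<in> ?D \<Longrightarrow> b \<in> ?D \<Longrightarrow> c \<in> ?D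
      \<Longrightarrow> ?\<mu> x y a \<Longrightarrow> ?\<mu> y z b \<Longrightarrow> ?\<mu> a z c \<Longrightarrow> ?\<mu> x b c"
    using gr unfolding group_graph_def by blast+
  have "\<exists>e\<in>?D. (\<forall>x\<in>?D. ?\<mu> e x x) \<and> (\<forall>x\<in>?D. \<exists>y\<in>?D. ?\<mu> y x e)"
    using gr unfolding group_graph_def by (elim conjE)
  then obtain e where e: "e \<in> ?D" "\<And>x. x \<in> ?D \<Longrightarrow> ?\<mu> e x x" "\<And>x. x \<in> ?D \<Longrightarrow> \<exists>y\<in>?D. ?\<mu> y x e"
    by auto
  have ex1: "\<exists>!z. z \<in> ?D \<and> ?\<mu> x y z" if xy: "x \<in> ?D" "y \<in> ?D" for x y
  proof -
    obtain z where z: "z \<in> ?D" "?\<mu> x y z" using ex[OF xy] by blast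
    show ?thesis
    proof (rule ex1I[of _ z])
      show "z' = z" if "z' \<in> ?D \<and> ?\<mu> x y z'" for z'
        using un[OF xy _ z(1) _ z(2)] that by blast
    qed (use z in blast)
  qed
  define m where "m x y = (THE z. z \<in> ?D \<and> ?\<mu> x y z)" for x y
  have m: "m x y \<in> ?D" "?\<mu> x y (m x y)" if "x \<in> ?D" "y \<in> ?D" for x y
    using theI'[OF ex1[OF that]] unfolding m_def by auto
  have m_eq: "m x y = z" if "x \<in> ?D" "y \<in> ?D" "z \<in> ?D" "?\<mu> x y z" for x y z
    by (rule un[OF that(1,2) m(1)[OF that(1,2)] that(3) m(2)[OF that(1,2)] that(4)])
  define G where "G = \<lparr>carrier = ?D, mult = m, one = e\<rparr>"
  interpret group G
  proof (rule groupI)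
    show "x \<otimes>\<^bsub>G\<^esub> y \<otimes>\<^bsub>G\<^esub> z = x \<otimes>\<^bsub>G\<^esub> (y \<otimes>\<^bsub>G\<^esub> z)" if "x \<in> carrier G" "y \<in> carrier G" "z \<in> carrier G" for x y z
    proof -
      have D: "x \<in> ?D" "y \<in> ?D" "z \<in> ?D" using that by (auto simp: G_def)
      note xy = m[OF D(1,2)] and yz = m[OF D(2,3)]
      note xyz = m[OF xy(1) D(3)]
      have "m x (m y z) = m (m x y) z"
        by (rule m_eq[OF D(1) yz(1) xyz(1) assoc[OF D xy(1) yz(1) xyz(1) xy(2) yz(2) xyz(2)]])
      then show ?thesis by (simp add: G_def)
    qed
    show "\<exists>y\<in>carrier G. y \<otimes>\<^bsub>G\<^esub> x = \<one>\<^bsub>G\<^esub>" if "x \<in> carrier G" for x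
    proof -
      have D: "x \<in> ?D" using that by (simp add: G_def)
      then obtain y where "y \<in> ?D" "?\<mu> y x e" using e(3) by blast
      then show ?thesis using m_eq[OF _ D e(1)] by (auto simp: G_def)
    qed
  qed (use e m m_eq in \<open>auto simp: G_def\<close>)
  \<comment> \<open>The unit of \<open>group_of\<close> is described as two-sided, so the right unit
    law must be known before the description can be evaluated. It is available once \<open>G\<close>
    is a group.\<close>
  have unit: "?\<mu> x e x" if "x \<in> ?D" for x
    using r_one[of x] m[OF that e(1)] that by (simp add: G_def)
  have "(THE e. e \<in> ?D \<and> (\<forall>x\<in>?D. ?\<mu> e x x \<and> ?\<mu> x e x)) = e"
  proof (rule the_equality)
    show "e \<in> ?D \<and> (\<forall>x\<in>?D. ?\<mu> e x x \<and> ?\<mu> x e x)" using e unit by blast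
    fix e' assume e': "e' \<in> ?D \<and> (\<forall>x\<in>?D. ?\<mu> e' x x \<and> ?\<mu> x e' x)"
    then have "?\<mu> e e' e" "?\<mu> e e' e'" "e' \<in> ?D" using e(1,2) by blast+
    then show "e' = e" using un[OF e(1)] e(1) by blast
  qed
  then have "group_of \<Gamma> A = G"
    unfolding group_of_def G_def m_def mult_rel_def by (intro monoid.equality) (simp_all add: fun_eq_iff)
  then have "group (group_of \<Gamma> A)" using group_axioms by simp
  then show ?thesis
    using wf ex1 unfolding definable_group_def group_fms_wf_def mult_rel_def by blast
qed

lemma expressible_dom:
  assumes "group_fms_wf L \<Gamma>"
  shows "expressible L A B (dim \<Gamma>) (\<lambda>E. E i \<in> dom_of \<Gamma> A) (\<lambda>E. E i \<in> dom_of \<Gamma> B)"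
proof -
  have "expressible L A B (dim \<Gamma>) (\<lambda>E. sat A (dom_fm \<Gamma>) (nth (concat (map E [i]))))
      (\<lambda>E. sat B (dom_fm \<Gamma>) (nth (concat (map E [i]))))"
    using assms by (intro expressible_sat) (auto simp: group_fms_wf_def)
  then show ?thesis by (rule expressible_cong) (auto simp: dom_of_def env_in_def)
qed

lemma expressible_mult:
  assumes "group_fms_wf L \<Gamma>"
  shows "expressible L A B (dim \<Gamma>) (\<lambda>E. mult_rel \<Gamma> A (E i) (E j) (E k)) (\<lambda>E. mult_rel \<Gamma> B (E i) (E j) (E k))"
proof -
  have "expressible L A B (dim \<Gamma>) (\<lambda>E. sat A (mult_fm \<Gamma>) (nth (concat (map E [i, j, k]))))
      (\<lambda>E. sat B (mult_fm \<Gamma>) (nth (concat (map E [i, j, k]))))"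
    using assms by (intro expressible_sat) (auto simp: group_fms_wf_def)
  then show ?thesis by (rule expressible_cong) (auto simp: mult_rel_def)
qed

text \<open>The four clauses are transferred separately. Unreduced terms such as
  \<open>(E(2 := z)) 2\<close> match the updated environment that \<open>expressible_Bex\<close>
  produces; they are simplified only after the transfer.\<close>

lemma group_graph_transfer:
  assumes AB: "elem_substruct L A B" and wf: "group_fms_wf L \<Gamma>"
    and gr: "group_graph (dom_of \<Gamma> A) (mult_rel \<Gamma> A)"
  shows "group_graph (dom_of \<Gamma> B) (mult_rel \<Gamma> B)"
proof -
  let ?d = "dim \<Gamma>"
  note dom = expressible_dom[OF wf, of A B] and mul = expressible_mult[OF wf, of A B]
  have DB: "x \<in> power_of B ?d" if "x \<in> dom_of \<Gamma> B" for x using that dom_of_subset by blast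
  have DA: "x \<in> power_of A ?d" if "x \<in> dom_of \<Gamma> A" for x using that dom_of_subset by blast
  let ?D = "dom_of \<Gamma> A" and ?\<mu> = "mult_rel \<Gamma> A"
  have ex0: "\<forall>x\<in>?D. \<forall>y\<in>?D. \<exists>z\<in>?D. ?\<mu> x y z"
    and un0: "\<forall>x\<in>?D. \<forall>y\<in>?D. \<forall>z\<in>?D. \<forall>z'\<in>?D. ?\<mu> x y z \<and> ?\<mu> x y z' \<longrightarrow> z = z'"
    and as0: "\<forall>x\<in>?D. \<forall>y\<in>?D. \<forall>z\<in>?D. \<forall>a\<in>?D. \<forall>b\<in>?D. \<forall>c\<in>?D.
      ?\<mu> x y a \<and> ?\<mu> y z b \<and> ?\<mu> a z c \<longrightarrow> ?\<mu> x b c"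
    and unit0: "\<exists>e\<in>?D. (\<forall>x\<in>?D. ?\<mu> e x x) \<and> (\<forall>x\<in>?D. \<exists>y\<in>?D. ?\<mu> y x e)"
    by (rule gr[unfolded group_graph_def, THEN conjunct1]
        gr[unfolded group_graph_def, THEN conjunct2, THEN conjunct1]
        gr[unfolded group_graph_def, THEN conjunct2, THEN conjunct2, THEN conjunct1]
        gr[unfolded group_graph_def, THEN conjunct2, THEN conjunct2, THEN conjunct2])+
  have unA: "z = z'" if "?\<mu> x y z" "?\<mu> x y z'" "x \<in> ?D" "y \<in> ?D" "z \<in> ?D" "z' \<in> ?D" for x y z z'
    using un0[rule_format, OF that(3-6)] that(1,2) by simp
  have asA: "?\<mu> x b c" if "?\<mu> x y a" "?\<mu> y z b" "?\<mu> a z c"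
    "x \<in> ?D" "y \<in> ?D" "z \<in> ?D" "a \<in> ?D" "b \<in> ?D" "c \<in> ?D" for x y z a b c
    using as0[rule_format, OF that(4-9)] that(1-3) by simp
  have exA: "\<exists>z\<in>power_of A ?d. z \<in> dom_of \<Gamma> A \<and> mult_rel \<Gamma> A x y z"
    if xy: "x \<in> dom_of \<Gamma> A" "y \<in> dom_of \<Gamma> A" for x y
  proof -
    have "\<exists>z\<in>dom_of \<Gamma> A. mult_rel \<Gamma> A x y z" using ex0 xy by simp
    then show ?thesis using DA by auto
  qed
  show ?thesis unfolding group_graph_def
  proof (intro conjI ballI impI)
    fix x y assume xy: "x \<in> dom_of \<Gamma> B" "y \<in> dom_of \<Gamma> B"
    have "expressible L A B ?d
      (\<lambda>E. E 0 \<in> dom_of \<Gamma> A \<and> E 1 \<in> dom_of \<Gamma> A \<longrightarrow> (\<exists>z\<in>power_of A ?d.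
        (E(2 := z)) 2 \<in> dom_of \<Gamma> A \<and> mult_rel \<Gamma> A ((E(2 := z)) 0) ((E(2 := z)) 1) ((E(2 := z)) 2)))
      (\<lambda>E. E 0 \<in> dom_of \<Gamma> B \<and> E 1 \<in> dom_of \<Gamma> B \<longrightarrow> (\<exists>z\<in>power_of B ?d.
        (E(2 := z)) 2 \<in> dom_of \<Gamma> B \<and> mult_rel \<Gamma> B ((E(2 := z)) 0) ((E(2 := z)) 1) ((E(2 := z)) 2)))"
      by (intro expressible_imp expressible_conj dom expressible_Bex[OF expressible_conj[OF dom mul]])
    \<comment> \<open>Blocks 0 and 1 carry \<open>x\<close> and \<open>y\<close>; all further blocks
      repeat \<open>x\<close>, which keeps the environment inside the power.\<close>
    note val = expressible_valid_closed[OF AB this, of "(\<lambda>_. x)(1 := y)", simplified]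
    have "x \<in> dom_of \<Gamma> B \<and> y \<in> dom_of \<Gamma> B \<longrightarrow>
        (\<exists>z\<in>power_of B ?d. z \<in> dom_of \<Gamma> B \<and> mult_rel \<Gamma> B x y z)"
      by (rule val) (use exA DB xy in \<open>auto simp: env_in_def\<close>)
    then show "\<exists>z\<in>dom_of \<Gamma> B. mult_rel \<Gamma> B x y z" using xy by auto
  next
    fix x y z z' assume *: "x \<in> dom_of \<Gamma> B" "y \<in> dom_of \<Gamma> B" "z \<in> dom_of \<Gamma> B" "z' \<in> dom_of \<Gamma> B"
      "mult_rel \<Gamma> B x y z \<and> mult_rel \<Gamma> B x y z'"
    have "expressible L A B ?d
      (\<lambda>E. E 0 \<in> dom_of \<Gamma> A \<and> E 1 \<in> dom_of \<Gamma> A \<and> E 2 \<in> dom_of \<Gamma> A \<and> E 3 \<in> dom_of \<Gamma> A \<and>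
         mult_rel \<Gamma> A (E 0) (E 1) (E 2) \<and> mult_rel \<Gamma> A (E 0) (E 1) (E 3) \<longrightarrow> E 2 = E 3)
      (\<lambda>E. E 0 \<in> dom_of \<Gamma> B \<and> E 1 \<in> dom_of \<Gamma> B \<and> E 2 \<in> dom_of \<Gamma> B \<and> E 3 \<in> dom_of \<Gamma> B \<and>
         mult_rel \<Gamma> B (E 0) (E 1) (E 2) \<and> mult_rel \<Gamma> B (E 0) (E 1) (E 3) \<longrightarrow> E 2 = E 3)"
      by (intro expressible_imp expressible_conj dom mul expressible_eq)
    note val = expressible_valid_closed[OF AB this, of "(\<lambda>_. x)(1 := y, 2 := z, 3 := z')", simplified]
    have env: "env_in B ?d ((\<lambda>_. x)(Suc 0 := y, 2 := z, 3 := z'))" using DB * by (simp add: env_in_def)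
    have "x \<in> dom_of \<Gamma> B \<and> y \<in> dom_of \<Gamma> B \<and> z \<in> dom_of \<Gamma> B \<and> z' \<in> dom_of \<Gamma> B \<and>
        mult_rel \<Gamma> B x y z \<and> mult_rel \<Gamma> B x y z' \<longrightarrow> z = z'"
      by (rule val) (intro impI, elim conjE, rule unA, assumption+, rule env)
    then show "z = z'" using * by simp
  next
    fix x y z a b c
    assume *: "x \<in> dom_of \<Gamma> B" "y \<in> dom_of \<Gamma> B" "z \<in> dom_of \<Gamma> B" "a \<in> dom_of \<Gamma> B" "b \<in> dom_of \<Gamma> B"
      "c \<in> dom_of \<Gamma> B" "mult_rel \<Gamma> B x y a \<and> mult_rel \<Gamma> B y z b \<and> mult_rel \<Gamma> B a z c"
    have "expressible L A B ?d
      (\<lambda>E. E 0 \<in> dom_of \<Gamma> A \<and> E 1 \<in> dom_of \<Gamma> A \<and> E 2 \<in> dom_of \<Gamma> A \<and> E 3 \<in> dom_of \<Gamma> A \<and>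
         E 4 \<in> dom_of \<Gamma> A \<and> E 5 \<in> dom_of \<Gamma> A \<and> mult_rel \<Gamma> A (E 0) (E 1) (E 3) \<and>
         mult_rel \<Gamma> A (E 1) (E 2) (E 4) \<and> mult_rel \<Gamma> A (E 3) (E 2) (E 5) \<longrightarrow> mult_rel \<Gamma> A (E 0) (E 4) (E 5))
      (\<lambda>E. E 0 \<in> dom_of \<Gamma> B \<and> E 1 \<in> dom_of \<Gamma> B \<and> E 2 \<in> dom_of \<Gamma> B \<and> E 3 \<in> dom_of \<Gamma> B \<and>
         E 4 \<in> dom_of \<Gamma> B \<and> E 5 \<in> dom_of \<Gamma> B \<and> mult_rel \<Gamma> B (E 0) (E 1) (E 3) \<and>
         mult_rel \<Gamma> B (E 1) (E 2) (E 4) \<and> mult_rel \<Gamma> B (E 3) (E 2) (E 5) \<longrightarrow> mult_rel \<Gamma> B (E 0) (E 4) (E 5))"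
      by (intro expressible_imp expressible_conj dom mul)
    note val = expressible_valid_closed[OF AB this, of "(\<lambda>_. x)(1 := y, 2 := z, 3 := a, 4 := b, 5 := c)", simplified]
    have env: "env_in B ?d ((\<lambda>_. x)(Suc 0 := y, 2 := z, 3 := a, 4 := b, 5 := c))"
      using DB * by (simp add: env_in_def)
    have "x \<in> dom_of \<Gamma> B \<and> y \<in> dom_of \<Gamma> B \<and> z \<in> dom_of \<Gamma> B \<and> a \<in> dom_of \<Gamma> B \<and>
        b \<in> dom_of \<Gamma> B \<and> c \<in> dom_of \<Gamma> B \<and> mult_rel \<Gamma> B x y a \<and> mult_rel \<Gamma> B y z b \<and>
        mult_rel \<Gamma> B a z c \<longrightarrow> mult_rel \<Gamma> B x b c"
      by (rule val) (intro impI, elim conjE, rule asA, assumption+, rule env)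
    then show "mult_rel \<Gamma> B x b c" using * by simp
  next
    have "expressible L A B ?d
      (\<lambda>E. \<exists>e\<in>power_of A ?d. (E(0 := e)) 0 \<in> dom_of \<Gamma> A \<and>
        (\<forall>x\<in>power_of A ?d. (E(0 := e, 1 := x)) 1 \<in> dom_of \<Gamma> A \<longrightarrow>
          mult_rel \<Gamma> A ((E(0 := e, 1 := x)) 0) ((E(0 := e, 1 := x)) 1) ((E(0 := e, 1 := x)) 1)) \<and>
        (\<forall>x\<in>power_of A ?d. (E(0 := e, 1 := x)) 1 \<in> dom_of \<Gamma> A \<longrightarrow>
          (\<exists>y\<in>power_of A ?d. (E(0 := e, 1 := x, 2 := y)) 2 \<in> dom_of \<Gamma> A \<and>
            mult_rel \<Gamma> A ((E(0 := e, 1 := x, 2 := y)) 2) ((E(0 := e, 1 := x, 2 := y)) 1) ((E(0 := e, 1 := x, 2 := y)) 0))))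
      (\<lambda>E. \<exists>e\<in>power_of B ?d. (E(0 := e)) 0 \<in> dom_of \<Gamma> B \<and>
        (\<forall>x\<in>power_of B ?d. (E(0 := e, 1 := x)) 1 \<in> dom_of \<Gamma> B \<longrightarrow>
          mult_rel \<Gamma> B ((E(0 := e, 1 := x)) 0) ((E(0 := e, 1 := x)) 1) ((E(0 := e, 1 := x)) 1)) \<and>
        (\<forall>x\<in>power_of B ?d. (E(0 := e, 1 := x)) 1 \<in> dom_of \<Gamma> B \<longrightarrow>
          (\<exists>y\<in>power_of B ?d. (E(0 := e, 1 := x, 2 := y)) 2 \<in> dom_of \<Gamma> B \<and>
            mult_rel \<Gamma> B ((E(0 := e, 1 := x, 2 := y)) 2) ((E(0 := e, 1 := x, 2 := y)) 1) ((E(0 := e, 1 := x, 2 := y)) 0))))"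
      by (rule expressible_Bex[OF expressible_conj[OF dom expressible_conj[OF
          expressible_Ball_power[OF expressible_imp[OF dom mul]]
          expressible_Ball_power[OF expressible_imp[OF dom expressible_Bex[OF expressible_conj[OF dom mul]]]]]]])
    note val = expressible_valid_closed[OF AB this]
    obtain c where "c \<in> univ B" using elem_substruct_nonempty[OF AB] elem_substruct_univ[OF AB] by blast
    then have "env_in B ?d (\<lambda>_. replicate ?d c)" by (auto simp: env_in_def power_of_def)
    moreover have "\<exists>e\<in>power_of A ?d. e \<in> dom_of \<Gamma> A \<and>
        (\<forall>x\<in>power_of A ?d. x \<in> dom_of \<Gamma> A \<longrightarrow> mult_rel \<Gamma> A e x x) \<and>
        (\<forall>x\<in>power_of A ?d. x \<in> dom_of \<Gamma> A \<longrightarrow> (\<exists>y\<in>power_of A ?d. y \<in> dom_of \<Gamma> A \<and> mult_rel \<Gamma> A y x e))"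
    proof -
      obtain e where e: "e \<in> ?D" "\<forall>x\<in>?D. ?\<mu> e x x" "\<forall>x\<in>?D. \<exists>y\<in>?D. ?\<mu> y x e"
        using unit0 by auto
      have "\<exists>y\<in>power_of A ?d. y \<in> ?D \<and> ?\<mu> y x e" if "x \<in> ?D" for x
        using e(3) that DA by auto
      then show ?thesis using e(1,2) DA[OF e(1)] by auto
    qed
    ultimately have "\<exists>e\<in>power_of B ?d. e \<in> dom_of \<Gamma> B \<and>
        (\<forall>x\<in>power_of B ?d. x \<in> dom_of \<Gamma> B \<longrightarrow> mult_rel \<Gamma> B e x x) \<and>
        (\<forall>x\<in>power_of B ?d. x \<in> dom_of \<Gamma> B \<longrightarrow> (\<exists>y\<in>power_of B ?d. y \<in> dom_of \<Gamma> B \<and> mult_rel \<Gamma> B y x e))"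
      by (intro val[simplified]) simp_all
    then show "\<exists>e\<in>dom_of \<Gamma> B. (\<forall>x\<in>dom_of \<Gamma> B. mult_rel \<Gamma> B e x x) \<and>
        (\<forall>x\<in>dom_of \<Gamma> B. \<exists>y\<in>dom_of \<Gamma> B. mult_rel \<Gamma> B y x e)"
      using DB by blast
  qed
qed

lemma definable_group_transfer:
  assumes "elem_substruct L A B" "definable_group L \<Gamma> A"
  shows "definable_group L \<Gamma> B"
  by (rule definable_groupI[OF definable_group_wf[OF assms(2)]
      group_graph_transfer[OF assms(1) definable_group_wf[OF assms(2)] definable_group_graph[OF assms(2)]]])

lemma dom_of_elem_substruct:
  assumes AB: "elem_substruct L A B" and wf: "group_fms_wf L \<Gamma>"
  shows "dom_of \<Gamma> A = dom_of \<Gamma> B \<inter> power_of A (dim \<Gamma>)"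
proof -
  have "x \<in> dom_of \<Gamma> A \<longleftrightarrow> x \<in> dom_of \<Gamma> B" if "x \<in> power_of A (dim \<Gamma>)" for x
    using expressible_agree[OF AB expressible_dom[OF wf], of "\<lambda>_. x"] that by (simp add: env_in_def)
  then show ?thesis using dom_of_subset by blast
qed

text \<open>Only the graph of multiplication transfers; uniqueness of products over \<open>B\<close>
  identifies the values.\<close>

lemma mult_elem_substruct:
  assumes AB: "elem_substruct L A B" and A: "definable_group L \<Gamma> A"
    and xy: "x \<in> dom_of \<Gamma> A" "y \<in> dom_of \<Gamma> A"
  shows "x \<otimes>\<^bsub>group_of \<Gamma> B\<^esub> y = x \<otimes>\<^bsub>group_of \<Gamma> A\<^esub> y"
proof -
  interpret group "group_of \<Gamma> A" by (rule definable_group_group[OF A])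
  note wf = definable_group_wf[OF A]
  let ?z = "x \<otimes>\<^bsub>group_of \<Gamma> A\<^esub> y"
  have z: "?z \<in> dom_of \<Gamma> A" using m_closed xy by (simp add: carrier_group_of)
  have D: "v \<in> power_of A (dim \<Gamma>)" "v \<in> dom_of \<Gamma> B" if "v \<in> dom_of \<Gamma> A" for v
    using that dom_of_elem_substruct[OF AB wf] by auto
  have "mult_rel \<Gamma> A x y ?z" using mult_rel_iff[OF A xy z] by simp
  then have "mult_rel \<Gamma> B x y ?z"
    using expressible_agree[OF AB expressible_mult[OF wf, of A B 0 1 2], of "(\<lambda>_. x)(1 := y, 2 := ?z)"]
      D xy z by (simp add: env_in_def)
  then show ?thesis using mult_rel_iff[OF definable_group_transfer[OF AB A] D(2)[OF xy(1)] D(2)[OF xy(2)] D(2)[OF z]]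
    by simp
qed

section \<open>The algebra of externally definable subsets of the group\<close>

lemma power_of_mono: "univ A \<subseteq> univ B \<Longrightarrow> power_of A k \<subseteq> power_of B k"
  unfolding power_of_def by auto

lemma sat_dom_append:
  assumes "group_fms_wf L \<Gamma>" "length x = dim \<Gamma>"
  shows "sat A (dom_fm \<Gamma>) (nth (x @ cs)) \<longleftrightarrow> sat A (dom_fm \<Gamma>) (nth x)"
  by (rule sat_cong) (use assms in \<open>auto simp: group_fms_wf_def nth_append\<close>)

text \<open>Replaces the ambient power by the group. Conversely \<open>dom_fm\<close> is conjoined
  to the formula; on tuples from \<open>K\<close> it has the same meaning in \<open>K\<close> and in
  the monster model.\<close>

lemma Def_extG_iff:
  assumes wf: "group_fms_wf L \<Gamma>" and K: "elem_substruct L K \<MM>"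
  shows "U \<in> Def_extG L \<MM> \<Gamma> K \<longleftrightarrow>
    (\<exists>\<phi> cs. (\<phi>, cs) \<in> param_fms L (dim \<Gamma>) (univ \<MM>) \<and> U = {x \<in> dom_of \<Gamma> K. sat \<MM> \<phi> (nth (x @ cs))})"
proof -
  have PK: "x \<in> power_of K (dim \<Gamma>)" "x \<in> power_of \<MM> (dim \<Gamma>)" if "x \<in> dom_of \<Gamma> K" for x
    using that dom_of_subset power_of_mono[OF elem_substruct_univ[OF K]] by blast+
  show ?thesis
  proof
    assume "U \<in> Def_extG L \<MM> \<Gamma> K"
    then obtain \<phi> cs where \<phi>: "(\<phi>, cs) \<in> param_fms L (dim \<Gamma>) (univ \<MM>)"
      and U: "U = solutions \<MM> (dim \<Gamma>) (\<phi>, cs) \<inter> power_of K (dim \<Gamma>)" "U \<subseteq> dom_of \<Gamma> K"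
      unfolding Def_extG_def Def_ext_def carrier_group_of by auto
    have "U = {x \<in> dom_of \<Gamma> K. sat \<MM> \<phi> (nth (x @ cs))}"
      using U PK unfolding solutions_def by auto
    then show "\<exists>\<phi> cs. (\<phi>, cs) \<in> param_fms L (dim \<Gamma>) (univ \<MM>) \<and> U = {x \<in> dom_of \<Gamma> K. sat \<MM> \<phi> (nth (x @ cs))}"
      using \<phi> by blast
  next
    assume "\<exists>\<phi> cs. (\<phi>, cs) \<in> param_fms L (dim \<Gamma>) (univ \<MM>) \<and> U = {x \<in> dom_of \<Gamma> K. sat \<MM> \<phi> (nth (x @ cs))}"
    then obtain \<phi> cs where \<phi>: "(\<phi>, cs) \<in> param_fms L (dim \<Gamma>) (univ \<MM>)"
      and U: "U = {x \<in> dom_of \<Gamma> K. sat \<MM> \<phi> (nth (x @ cs))}" by blast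
    let ?\<sigma> = "(And (dom_fm \<Gamma>) \<phi>, cs)"
    have dom: "sat \<MM> (dom_fm \<Gamma>) (nth (x @ cs)) \<longleftrightarrow> x \<in> dom_of \<Gamma> K" if "x \<in> power_of K (dim \<Gamma>)" for x
    proof -
      have "x \<in> power_of \<MM> (dim \<Gamma>)" "length x = dim \<Gamma>"
        using that power_of_mono[OF elem_substruct_univ[OF K]] by (auto simp: power_of_def)
      then show ?thesis
        using that unfolding dom_of_elem_substruct[OF K wf] sat_dom_append[OF wf \<open>length x = dim \<Gamma>\<close>]
        by (simp add: dom_of_def)
    qed
    have "?\<sigma> \<in> param_fms L (dim \<Gamma>) (univ \<MM>)"
      using \<phi> wf unfolding param_fms_def group_fms_wf_def by auto
    moreover have "U = solutions \<MM> (dim \<Gamma>) ?\<sigma> \<inter> power_of K (dim \<Gamma>)"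
      using U dom PK unfolding solutions_def by auto
    ultimately have "(dim \<Gamma>, U) \<in> Def_ext L \<MM> K" unfolding Def_ext_def by blast
    then show "U \<in> Def_extG L \<MM> \<Gamma> K" using U unfolding Def_extG_def carrier_group_of by auto
  qed
qed

lemma Def_extG_subset: "U \<in> Def_extG L \<MM> \<Gamma> K \<Longrightarrow> U \<subseteq> dom_of \<Gamma> K"
  unfolding Def_extG_def carrier_group_of by auto

lemma set_algebra_Def_extG:
  assumes wf: "group_fms_wf L \<Gamma>" and K: "elem_substruct L K \<MM>"
  shows "set_algebra (carrier (group_of \<Gamma> K)) (Def_extG L \<MM> \<Gamma> K)"
  unfolding carrier_group_of
proof
  note iff = Def_extG_iff[OF wf K]
  let ?d = "dim \<Gamma>"
  have len: "length x = ?d" if "x \<in> dom_of \<Gamma> K" for x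
    using that dom_of_subset[of \<Gamma> K] by (auto simp: power_of_def)
  show "U \<subseteq> dom_of \<Gamma> K" if "U \<in> Def_extG L \<MM> \<Gamma> K" for U by (rule Def_extG_subset[OF that])
  have "(dom_fm \<Gamma>, []) \<in> param_fms L ?d (univ \<MM>)"
    using wf unfolding param_fms_def group_fms_wf_def by auto
  moreover have "dom_of \<Gamma> K = {x \<in> dom_of \<Gamma> K. sat \<MM> (dom_fm \<Gamma>) (nth (x @ []))}"
    using dom_of_elem_substruct[OF K wf] by (auto simp: dom_of_def)
  ultimately show "dom_of \<Gamma> K \<in> Def_extG L \<MM> \<Gamma> K" unfolding iff by blast
  fix U assume "U \<in> Def_extG L \<MM> \<Gamma> K"
  then obtain \<phi> cs where \<phi>: "(\<phi>, cs) \<in> param_fms L ?d (univ \<MM>)"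
    and U: "U = {x \<in> dom_of \<Gamma> K. sat \<MM> \<phi> (nth (x @ cs))}" unfolding iff by blast
  have "(Neg \<phi>, cs) \<in> param_fms L ?d (univ \<MM>)" using \<phi> by (simp add: param_fms_def)
  moreover have "dom_of \<Gamma> K - U = {x \<in> dom_of \<Gamma> K. sat \<MM> (Neg \<phi>) (nth (x @ cs))}" using U by auto
  ultimately show "dom_of \<Gamma> K - U \<in> Def_extG L \<MM> \<Gamma> K" unfolding iff by blast
  fix V assume "V \<in> Def_extG L \<MM> \<Gamma> K"
  then obtain \<psi> ds where \<psi>: "(\<psi>, ds) \<in> param_fms L ?d (univ \<MM>)"
    and V: "V = {x \<in> dom_of \<Gamma> K. sat \<MM> \<psi> (nth (x @ ds))}" unfolding iff by blast
  \<comment> \<open>Both formulas share the object variables, while the parameters of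
    \<open>\<psi>\<close> move behind \<open>cs\<close>.\<close>
  let ?f = "\<lambda>i. if i < ?d then i else i + length cs"
  have "fv_fm \<phi> \<subseteq> {..<?d + (length cs + length ds)}" "fv_fm \<psi> \<subseteq> {..<?d + length ds}"
    using \<phi> \<psi> by (auto simp: param_fms_def)
  moreover have "?f i < ?d + (length cs + length ds)" if "i < ?d + length ds" for i using that by auto
  ultimately have "fv_fm (And \<phi> (ren_fm ?f \<psi>)) \<subseteq> {..<?d + (length cs + length ds)}"
    unfolding fv_fm.simps fv_ren_fm by (intro Un_least image_subsetI) (blast, blast)
  then have "(And \<phi> (ren_fm ?f \<psi>), cs @ ds) \<in> param_fms L ?d (univ \<MM>)"
    using \<phi> \<psi> by (simp add: param_fms_def wf_ren_fm)
  moreover have "U \<inter> V = {x \<in> dom_of \<Gamma> K. sat \<MM> (And \<phi> (ren_fm ?f \<psi>)) (nth (x @ cs @ ds))}"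
  proof -
    have "sat \<MM> \<phi> (nth (x @ cs @ ds)) \<longleftrightarrow> sat \<MM> \<phi> (nth (x @ cs))" if "x \<in> dom_of \<Gamma> K" for x
      by (rule sat_cong) (use \<phi> len[OF that] in \<open>auto simp: param_fms_def nth_append\<close>)
    moreover have "sat \<MM> (ren_fm ?f \<psi>) (nth (x @ cs @ ds)) \<longleftrightarrow> sat \<MM> \<psi> (nth (x @ ds))" if "x \<in> dom_of \<Gamma> K" for x
      unfolding sat_ren_fm by (rule sat_cong) (use len[OF that] in \<open>auto simp: nth_append\<close>)
    ultimately show ?thesis unfolding U V by auto
  qed
  ultimately show "U \<inter> V \<in> Def_extG L \<MM> \<Gamma> K" unfolding iff by blast
qed

text \<open>\<open>\<chi>\<close> says that some \<open>z\<close> in the group is the product of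
  \<open>x\<close> and \<open>y\<close> and satisfies \<open>\<phi>\<close>. The blocks
  \<open>x\<close>, \<open>y\<close> and \<open>cs\<close> fill the positions below
  \<open>n\<close>, the witness \<open>z\<close> starts at \<open>n\<close>, and \<open>f1\<close>,
  \<open>f2\<close>, \<open>f3\<close> move the variables of the three conjuncts to this
  layout.\<close>

lemma product_formula:
  assumes G: "definable_group L \<Gamma> A" and \<phi>: "(\<phi>, cs) \<in> param_fms L (dim \<Gamma>) (univ A)"
  obtains \<chi> where "wf_fm L \<chi>" "fv_fm \<chi> \<subseteq> {..<2 * dim \<Gamma> + length cs}"
    "\<forall>x\<in>dom_of \<Gamma> A. \<forall>y\<in>dom_of \<Gamma> A.
       sat A \<chi> (nth (x @ y @ cs)) \<longleftrightarrow> sat A \<phi> (nth ((x \<otimes>\<^bsub>group_of \<Gamma> A\<^esub> y) @ cs))"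
proof -
  interpret group "group_of \<Gamma> A" by (rule definable_group_group[OF G])
  have wf: "group_fms_wf L \<Gamma>" by (rule definable_group_wf[OF G])
  let ?d = "dim \<Gamma>"
  define n where "n = 2 * ?d + length cs"
  define f1 where "f1 i = n + i" for i :: nat
  define f2 where "f2 i = (if i < 2 * ?d then i else n + (i - 2 * ?d))" for i :: nat
  define f3 where "f3 i = (if i < ?d then n + i else ?d + i)" for i :: nat
  define \<psi> where "\<psi> = And (ren_fm f1 (dom_fm \<Gamma>)) (And (ren_fm f2 (mult_fm \<Gamma>)) (ren_fm f3 \<phi>))"
  define \<chi> where "\<chi> = foldr fm.Ex [n..<n + ?d] \<psi>"
  have bounds: "fv_fm (dom_fm \<Gamma>) \<subseteq> {..<?d}" "fv_fm (mult_fm \<Gamma>) \<subseteq> {..<3 * ?d}"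
    "fv_fm \<phi> \<subseteq> {..<?d + length cs}"
    using wf \<phi> by (auto simp: group_fms_wf_def param_fms_def)
  have "wf_fm L \<chi>" using wf \<phi> unfolding \<chi>_def \<psi>_def
    by (simp add: wf_foldr_Ex wf_ren_fm group_fms_wf_def param_fms_def)
  moreover have "fv_fm \<chi> \<subseteq> {..<2 * ?d + length cs}"
  proof -
    have "f1 ` fv_fm (dom_fm \<Gamma>) \<subseteq> {..<n + ?d}" using bounds(1) by (force simp: f1_def)
    moreover have "f2 ` fv_fm (mult_fm \<Gamma>) \<subseteq> {..<n + ?d}" using bounds(2) by (force simp: f2_def n_def)
    moreover have "f3 ` fv_fm \<phi> \<subseteq> {..<n + ?d}" using bounds(3) by (force simp: f3_def n_def)
    ultimately show ?thesis
      unfolding \<chi>_def \<psi>_def fv_foldr_Ex by (auto simp: fv_ren_fm n_def)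
  qed
  moreover have "sat A \<chi> (nth (x @ y @ cs)) \<longleftrightarrow> sat A \<phi> (nth ((x \<otimes>\<^bsub>group_of \<Gamma> A\<^esub> y) @ cs))"
    if xy: "x \<in> dom_of \<Gamma> A" "y \<in> dom_of \<Gamma> A" for x y
  proof -
    have len: "length x = ?d" "length y = ?d" using xy dom_of_subset[of \<Gamma> A] by (auto simp: power_of_def)
    have *: "sat A \<psi> (upd_block n z (nth (x @ y @ cs))) \<longleftrightarrow>
        z \<in> dom_of \<Gamma> A \<and> mult_rel \<Gamma> A x y z \<and> sat A \<phi> (nth (z @ cs))" if z: "z \<in> power_of A ?d" for z
    proof -
      have lz: "length z = ?d" using z by (simp add: power_of_def)
      let ?e = "upd_block n z (nth (x @ y @ cs))"
      have "sat A (dom_fm \<Gamma>) (?e \<circ> f1) \<longleftrightarrow> sat A (dom_fm \<Gamma>) (nth z)"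
        by (rule sat_cong) (use bounds(1) lz in \<open>auto simp: f1_def upd_block_def\<close>)
      moreover have "sat A (mult_fm \<Gamma>) (?e \<circ> f2) \<longleftrightarrow> sat A (mult_fm \<Gamma>) (nth (x @ y @ z))"
      proof (rule sat_cong, rule ballI)
        fix i assume "i \<in> fv_fm (mult_fm \<Gamma>)"
        then have i: "i < 3 * ?d" using bounds(2) by auto
        show "(?e \<circ> f2) i = (x @ y @ z) ! i"
          using i lz len by (auto simp: f2_def upd_block_def n_def nth_append mult_2)
      qed
      moreover have "sat A \<phi> (?e \<circ> f3) \<longleftrightarrow> sat A \<phi> (nth (z @ cs))"
      proof (rule sat_cong, rule ballI)
        fix i assume "i \<in> fv_fm \<phi>"
        then have i: "i < ?d + length cs" using bounds(3) by auto
        show "(?e \<circ> f3) i = (z @ cs) ! i"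
          using i lz len by (auto simp: f3_def upd_block_def n_def nth_append)
      qed
      ultimately show ?thesis using z
        by (simp add: \<psi>_def sat_ren_fm mult_rel_def dom_of_def)
    qed
    let ?z = "x \<otimes>\<^bsub>group_of \<Gamma> A\<^esub> y"
    have zD: "?z \<in> dom_of \<Gamma> A" using m_closed xy by (simp add: carrier_group_of)
    have zP: "?z \<in> power_of A ?d" using zD dom_of_subset by blast
    have "sat A \<chi> (nth (x @ y @ cs)) \<longleftrightarrow>
        (\<exists>z\<in>power_of A ?d. z \<in> dom_of \<Gamma> A \<and> mult_rel \<Gamma> A x y z \<and> sat A \<phi> (nth (z @ cs)))"
      unfolding \<chi>_def sat_foldr_Ex using * by simp
    also have "\<dots> \<longleftrightarrow> sat A \<phi> (nth (?z @ cs))"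
      using mult_rel_iff[OF G xy] zD zP by auto
    finally show ?thesis .
  qed
  ultimately show thesis by (intro that) blast+
qed

text \<open>Two readings of the same condition: in \<open>\<chi>\<close> the right factor counts as
  a parameter, as needed to define d-maps; in \<open>\<chi>'\<close> the left factor does, as needed
  for translates and for the type to be realised.\<close>

lemma product_param_fms:
  assumes G: "definable_group L \<Gamma> A" and \<phi>: "(\<phi>, cs) \<in> param_fms L (dim \<Gamma>) (univ A)"
  obtains \<chi> \<chi>' where
    "\<forall>y\<in>dom_of \<Gamma> A. (\<chi>, y @ cs) \<in> param_fms L (dim \<Gamma>) (univ A)"
    "\<forall>x\<in>dom_of \<Gamma> A. \<forall>y\<in>dom_of \<Gamma> A.
       sat A \<chi> (nth (x @ y @ cs)) \<longleftrightarrow> sat A \<phi> (nth ((x \<otimes>\<^bsub>group_of \<Gamma> A\<^esub> y) @ cs))"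
    "\<forall>x\<in>dom_of \<Gamma> A. (\<chi>', x @ cs) \<in> param_fms L (dim \<Gamma>) (univ A)"
    "\<forall>x\<in>dom_of \<Gamma> A. \<forall>y\<in>dom_of \<Gamma> A.
       sat A \<chi>' (nth (y @ x @ cs)) \<longleftrightarrow> sat A \<phi> (nth ((x \<otimes>\<^bsub>group_of \<Gamma> A\<^esub> y) @ cs))"
proof -
  let ?d = "dim \<Gamma>"
  obtain \<chi> where \<chi>: "wf_fm L \<chi>" "fv_fm \<chi> \<subseteq> {..<2 * ?d + length cs}"
    and sat: "\<forall>x\<in>dom_of \<Gamma> A. \<forall>y\<in>dom_of \<Gamma> A.
       sat A \<chi> (nth (x @ y @ cs)) \<longleftrightarrow> sat A \<phi> (nth ((x \<otimes>\<^bsub>group_of \<Gamma> A\<^esub> y) @ cs))"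
    by (rule product_formula[OF assms]) (rule that)
  have cs: "set cs \<subseteq> univ A" using \<phi> by (simp add: param_fms_def)
  have D: "length x = ?d" "set x \<subseteq> univ A" if "x \<in> dom_of \<Gamma> A" for x
    using that dom_of_subset[of \<Gamma> A] by (auto simp: power_of_def)
  have pf: "(\<psi>, y @ cs) \<in> param_fms L ?d (univ A)"
    if "y \<in> dom_of \<Gamma> A" "wf_fm L \<psi>" "fv_fm \<psi> \<subseteq> {..<2 * ?d + length cs}" for y \<psi>
    using that D[OF that(1)] cs by (simp add: param_fms_def mult_2 add.assoc)
  \<comment> \<open>Exchanges the first two blocks and leaves the parameters in place.\<close>
  let ?f = "\<lambda>i. if i < ?d then ?d + i else if i < 2 * ?d then i - ?d else i"
  have "?f i < 2 * ?d + length cs" if "i < 2 * ?d + length cs" for i using that by auto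
  then have fv: "fv_fm (ren_fm ?f \<chi>) \<subseteq> {..<2 * ?d + length cs}"
    using \<chi>(2) unfolding fv_ren_fm by (intro image_subsetI) blast
  have sat': "sat A (ren_fm ?f \<chi>) (nth (y @ x @ cs)) \<longleftrightarrow> sat A \<phi> (nth ((x \<otimes>\<^bsub>group_of \<Gamma> A\<^esub> y) @ cs))"
    if "x \<in> dom_of \<Gamma> A" "y \<in> dom_of \<Gamma> A" for x y
  proof -
    have "sat A (ren_fm ?f \<chi>) (nth (y @ x @ cs)) \<longleftrightarrow> sat A \<chi> (nth (x @ y @ cs))"
      unfolding sat_ren_fm
      by (rule sat_cong) (use D(1)[OF that(1)] D(1)[OF that(2)] in \<open>auto simp: nth_append\<close>)
    then show ?thesis using sat that by simp
  qed
  show thesis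
  proof (rule that)
    show "\<forall>y\<in>dom_of \<Gamma> A. (\<chi>, y @ cs) \<in> param_fms L ?d (univ A)" using pf \<chi> by auto
    show "\<forall>x\<in>dom_of \<Gamma> A. (ren_fm ?f \<chi>, x @ cs) \<in> param_fms L ?d (univ A)"
      using pf[OF _ _ fv] \<chi>(1) by (simp add: wf_ren_fm)
    show "\<forall>x\<in>dom_of \<Gamma> A. \<forall>y\<in>dom_of \<Gamma> A. sat A (ren_fm ?f \<chi>) (nth (y @ x @ cs)) \<longleftrightarrow>
        sat A \<phi> (nth ((x \<otimes>\<^bsub>group_of \<Gamma> A\<^esub> y) @ cs))"
      using sat' by blast
  qed (fact sat)
qed

lemma shift_Def_extG:
  assumes K: "elem_substruct L K \<MM>" and G: "definable_group L \<Gamma> K"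
    and g: "g \<in> carrier (group_of \<Gamma> K)" and U: "U \<in> Def_extG L \<MM> \<Gamma> K"
  shows "shift (group_of \<Gamma> K) g U \<in> Def_extG L \<MM> \<Gamma> K"
proof -
  interpret K: group "group_of \<Gamma> K" by (rule definable_group_group[OF G])
  have wf: "group_fms_wf L \<Gamma>" by (rule definable_group_wf[OF G])
  note iff = Def_extG_iff[OF wf K]
  have GM: "definable_group L \<Gamma> \<MM>" by (rule definable_group_transfer[OF K G])
  have DM: "x \<in> dom_of \<Gamma> \<MM>" if "x \<in> dom_of \<Gamma> K" for x
    using that dom_of_elem_substruct[OF K wf] by blast
  have g: "g \<in> dom_of \<Gamma> K" using g by (simp add: carrier_group_of)
  obtain \<phi> cs where \<phi>: "(\<phi>, cs) \<in> param_fms L (dim \<Gamma>) (univ \<MM>)"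
    and U: "U = {x \<in> dom_of \<Gamma> K. sat \<MM> \<phi> (nth (x @ cs))}" using U unfolding iff by blast
  obtain \<chi>' where \<chi>'0: "\<forall>x\<in>dom_of \<Gamma> \<MM>. (\<chi>', x @ cs) \<in> param_fms L (dim \<Gamma>) (univ \<MM>)"
    "\<forall>x\<in>dom_of \<Gamma> \<MM>. \<forall>y\<in>dom_of \<Gamma> \<MM>.
       sat \<MM> \<chi>' (nth (y @ x @ cs)) \<longleftrightarrow> sat \<MM> \<phi> (nth ((x \<otimes>\<^bsub>group_of \<Gamma> \<MM>\<^esub> y) @ cs))"
    by (rule product_param_fms[OF GM \<phi>]) (rule that)
  note \<chi>' = \<chi>'0[rule_format]
  have "sat \<MM> \<chi>' (nth (y @ g @ cs)) \<longleftrightarrow> g \<otimes>\<^bsub>group_of \<Gamma> K\<^esub> y \<in> U" if y: "y \<in> dom_of \<Gamma> K" for y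
    using \<chi>'(2)[OF DM[OF g] DM[OF y]] mult_elem_substruct[OF K G g y] K.m_closed g y
    by (simp add: U carrier_group_of)
  then have "shift (group_of \<Gamma> K) g U = {y \<in> dom_of \<Gamma> K. sat \<MM> \<chi>' (nth (y @ g @ cs))}"
    unfolding shift_def carrier_group_of by auto
  then show ?thesis unfolding iff using \<chi>'(1)[OF DM[OF g]] by blast
qed

text \<open>The type of \<open>p\<close> over \<open>K\<close> and the parameters of \<open>U\<close> is realised in the monster
  model by some \<open>a\<close>, and then \<open>dmap G p U\<close> is defined by membership of \<open>g \<otimes> a\<close> in the set
  defining \<open>U\<close>.\<close>

lemma dmap_Def_extG:
  assumes mon: "monster L \<kappa> \<MM>" and K: "elem_substruct L K \<MM>" and small: "|univ K| <o \<kappa>"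
    and G: "definable_group L \<Gamma> K"
    and p: "p \<in> ultrafilters (carrier (group_of \<Gamma> K)) (Def_extG L \<MM> \<Gamma> K)"
    and U: "U \<in> Def_extG L \<MM> \<Gamma> K"
  shows "dmap (group_of \<Gamma> K) p U \<in> Def_extG L \<MM> \<Gamma> K"
proof -
  interpret K: group "group_of \<Gamma> K" by (rule definable_group_group[OF G])
  have wf: "group_fms_wf L \<Gamma>" by (rule definable_group_wf[OF G])
  interpret alg: set_algebra "carrier (group_of \<Gamma> K)" "Def_extG L \<MM> \<Gamma> K"
    by (rule set_algebra_Def_extG[OF wf K])
  note P = ultrafilterD[OF p]
  note iff = Def_extG_iff[OF wf K]
  let ?d = "dim \<Gamma>"
  have GM: "definable_group L \<Gamma> \<MM>" by (rule definable_group_transfer[OF K G])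
  have DM: "x \<in> dom_of \<Gamma> \<MM>" if "x \<in> dom_of \<Gamma> K" for x
    using that dom_of_elem_substruct[OF K wf] by blast
  have PM: "x \<in> power_of \<MM> ?d" if "x \<in> dom_of \<Gamma> \<MM>" for x using that dom_of_subset by blast
  obtain \<phi> cs where \<phi>: "(\<phi>, cs) \<in> param_fms L ?d (univ \<MM>)"
    and Ueq: "U = {x \<in> dom_of \<Gamma> K. sat \<MM> \<phi> (nth (x @ cs))}" using U unfolding iff by blast
  obtain \<chi> \<chi>' where \<chi>0: "\<forall>y\<in>dom_of \<Gamma> \<MM>. (\<chi>, y @ cs) \<in> param_fms L ?d (univ \<MM>)"
    "\<forall>x\<in>dom_of \<Gamma> \<MM>. \<forall>y\<in>dom_of \<Gamma> \<MM>.
       sat \<MM> \<chi> (nth (x @ y @ cs)) \<longleftrightarrow> sat \<MM> \<phi> (nth ((x \<otimes>\<^bsub>group_of \<Gamma> \<MM>\<^esub> y) @ cs))"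
    and \<chi>'0: "\<forall>x\<in>dom_of \<Gamma> \<MM>. (\<chi>', x @ cs) \<in> param_fms L ?d (univ \<MM>)"
    "\<forall>x\<in>dom_of \<Gamma> \<MM>. \<forall>y\<in>dom_of \<Gamma> \<MM>.
       sat \<MM> \<chi>' (nth (y @ x @ cs)) \<longleftrightarrow> sat \<MM> \<phi> (nth ((x \<otimes>\<^bsub>group_of \<Gamma> \<MM>\<^esub> y) @ cs))"
    by (rule product_param_fms[OF GM \<phi>]) (rule that)
  note \<chi> = \<chi>0[rule_format] and \<chi>' = \<chi>'0[rule_format]
  let ?s = "\<lambda>g. shift (group_of \<Gamma> K) g U"
  have sat_K: "sat \<MM> \<chi>' (nth (y @ g @ cs)) \<longleftrightarrow> y \<in> ?s g" if "g \<in> dom_of \<Gamma> K" "y \<in> dom_of \<Gamma> K" for g y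
    using \<chi>'(2)[OF DM[OF that(1)] DM[OF that(2)]] mult_elem_substruct[OF K G that] K.m_closed that
    by (simp add: Ueq shift_def carrier_group_of)
  have sB: "?s g \<in> Def_extG L \<MM> \<Gamma> K" if "g \<in> dom_of \<Gamma> K" for g
    using shift_Def_extG[OF K G _ U] that by (simp add: carrier_group_of)
  \<comment> \<open>The part of the type of \<open>p\<close> that matters: its realisation
    \<open>a\<close> has to lie in the group, and for each \<open>g\<close> it has to be decided as
    by \<open>p\<close> whether \<open>g\<close> times \<open>a\<close> falls into the set defined
    by \<open>\<phi>\<close>.\<close>
  define \<Sigma> where "\<Sigma> = insert (dom_fm \<Gamma>, []) ((\<lambda>g. (if ?s g \<in> p then \<chi>' else Neg \<chi>', g @ cs)) ` dom_of \<Gamma> K)"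
  \<comment> \<open>Each condition holds on a whole member of \<open>p\<close>, so finitely many
    have a common solution inside \<open>K\<close>.\<close>
  have big: "\<exists>S\<in>p. S \<subseteq> solutions \<MM> ?d \<sigma>" if "\<sigma> \<in> \<Sigma>" for \<sigma>
  proof -
    from that consider "\<sigma> = (dom_fm \<Gamma>, [])" | g where "g \<in> dom_of \<Gamma> K" "\<sigma> = (if ?s g \<in> p then \<chi>' else Neg \<chi>', g @ cs)"
      unfolding \<Sigma>_def by blast
    then show ?thesis
    proof cases
      case 1
      have "dom_of \<Gamma> K \<subseteq> solutions \<MM> ?d \<sigma>"
        unfolding 1 using DM by (auto simp: solutions_def dom_of_def)
      then show ?thesis using P(2) by (auto simp: carrier_group_of)
    next
      case 2
      let ?S = "if ?s g \<in> p then ?s g else dom_of \<Gamma> K - ?s g"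
      have "?S \<in> p" using P(6)[OF sB[OF 2(1)]] by (auto simp: carrier_group_of)
      moreover have "?S \<subseteq> solutions \<MM> ?d \<sigma>"
      proof
        fix y assume y: "y \<in> ?S"
        then have yK: "y \<in> dom_of \<Gamma> K" by (auto simp: shift_def carrier_group_of split: if_splits)
        then show "y \<in> solutions \<MM> ?d \<sigma>"
          using y PM[OF DM[OF yK]] sat_K[OF 2(1) yK] unfolding 2(2) solutions_def by (auto split: if_splits)
      qed
      ultimately show ?thesis by blast
    qed
  qed
  have fin: "\<exists>S\<in>p. \<forall>\<sigma>\<in>\<Delta>. S \<subseteq> solutions \<MM> ?d \<sigma>" if "finite \<Delta>" "\<Delta> \<subseteq> \<Sigma>" for \<Delta>
    using that
  proof (induction rule: finite_induct)
    case (insert \<sigma> \<Delta>)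
    obtain S where S: "S \<in> p" "\<forall>\<sigma>\<in>\<Delta>. S \<subseteq> solutions \<MM> ?d \<sigma>" using insert by auto
    obtain S' where S': "S' \<in> p" "S' \<subseteq> solutions \<MM> ?d \<sigma>" using big insert.prems by blast
    have "S \<inter> S' \<in> p" by (rule P(4)[OF S(1) S'(1)])
    moreover have "\<forall>\<tau>\<in>insert \<sigma> \<Delta>. S \<inter> S' \<subseteq> solutions \<MM> ?d \<tau>" using S(2) S'(2) by auto
    ultimately show ?case by (rule bexI[rotated])
  qed (use P(2) in blast)
  have "\<exists>a\<in>power_of \<MM> ?d. \<forall>\<sigma>\<in>\<Sigma>. a \<in> solutions \<MM> ?d \<sigma>"
  proof -
    \<comment> \<open>Saturation applies because \<open>K\<close> is small and \<open>cs\<close> is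
      finite, so there are fewer than \<open>\<kappa>\<close> parameters.\<close>
    let ?C = "univ K \<union> set cs"
    have sat: "saturated L \<kappa> \<MM>" and inf: "Cinfinite \<kappa>" using mon by (auto simp: monster_def)
    have "Well_order \<kappa>" using inf card_order_on_well_order_on by blast
    then have "|set cs| <o \<kappa>"
      using inf by (intro finite_ordLess_infinite) (auto simp: cinfinite_def Field_card_of card_of_well_order_on)
    then have C: "|?C| <o \<kappa>"
      using inf small by (intro card_of_Un_ordLess_infinite_Field) (auto simp: cinfinite_def)
    have CM: "?C \<subseteq> univ \<MM>" using elem_substruct_univ[OF K] \<phi> by (auto simp: param_fms_def)
    have "\<Sigma> \<subseteq> param_fms L ?d ?C"
    proof -
      have "(if ?s g \<in> p then \<chi>' else Neg \<chi>', g @ cs) \<in> param_fms L ?d ?C" if "g \<in> dom_of \<Gamma> K" for g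
      proof -
        have "set g \<subseteq> univ K" using that dom_of_subset[of \<Gamma> K] by (auto simp: power_of_def)
        then show ?thesis using \<chi>'(1)[OF DM[OF that]] by (auto simp: param_fms_def)
      qed
      moreover have "(dom_fm \<Gamma>, []) \<in> param_fms L ?d ?C"
        using wf by (simp add: param_fms_def group_fms_wf_def)
      ultimately show ?thesis unfolding \<Sigma>_def by blast
    qed
    moreover have "\<exists>xs\<in>power_of \<MM> ?d. \<forall>\<sigma>\<in>\<Delta>. xs \<in> solutions \<MM> ?d \<sigma>" if D: "\<Delta> \<subseteq> \<Sigma>" "finite \<Delta>" for \<Delta>
    proof -
      obtain S where S: "S \<in> p" "\<forall>\<sigma>\<in>\<Delta>. S \<subseteq> solutions \<MM> ?d \<sigma>" using fin[OF D(2,1)] by auto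
      have "S \<noteq> {}" using S(1) P(3) by auto
      then obtain x where x: "x \<in> S" by auto
      have "x \<in> dom_of \<Gamma> K" using x Def_extG_subset[OF P(1)[OF S(1)]] by auto
      then show ?thesis using PM[OF DM] x S(2) by blast
    qed
    ultimately show ?thesis
      by (intro sat[unfolded saturated_def, rule_format, of ?C]) (use C CM in blast)
  qed
  then obtain a where a: "\<And>\<sigma>. \<sigma> \<in> \<Sigma> \<Longrightarrow> a \<in> solutions \<MM> ?d \<sigma>" by auto
  have aD: "a \<in> dom_of \<Gamma> \<MM>"
    using a[of "(dom_fm \<Gamma>, [])"] by (simp add: \<Sigma>_def solutions_def dom_of_def)
  have "?s g \<in> p \<longleftrightarrow> sat \<MM> \<chi> (nth (g @ a @ cs))" if g: "g \<in> dom_of \<Gamma> K" for g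
  proof -
    have "a \<in> solutions \<MM> ?d (if ?s g \<in> p then \<chi>' else Neg \<chi>', g @ cs)"
      using g by (intro a) (simp add: \<Sigma>_def)
    then have "?s g \<in> p \<longleftrightarrow> sat \<MM> \<chi>' (nth (a @ g @ cs))"
      by (auto simp: solutions_def split: if_splits)
    then show ?thesis using \<chi>(2)[OF DM[OF g] aD] \<chi>'(2)[OF DM[OF g] aD] by simp
  qed
  then have "dmap (group_of \<Gamma> K) p U = {g \<in> dom_of \<Gamma> K. sat \<MM> \<chi> (nth (g @ a @ cs))}"
    using K.inv_coset_eq_shift alg.sub[OF U] unfolding dmap_def carrier_group_of by auto
  then show ?thesis unfolding iff using \<chi>(1)[OF aD] by blast
qed

lemma group_set_algebra_Def_extG:
  assumes "monster L \<kappa> \<MM>" "small_model L \<kappa> \<MM> K" "definable_group L \<Gamma> K"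
  shows "group_set_algebra (group_of \<Gamma> K) (Def_extG L \<MM> \<Gamma> K)"
proof -
  have K: "elem_substruct L K \<MM>" "|univ K| <o \<kappa>" using assms(2) by (auto simp: small_model_def)
  show ?thesis
    by (intro group_set_algebra.intro definable_group_group[OF assms(3)]
        set_algebra_Def_extG[OF definable_group_wf[OF assms(3)] K(1)] group_set_algebra_axioms.intro
        shift_Def_extG[OF K(1) assms(3)] dmap_Def_extG[OF assms(1) K assms(3)])
qed

section \<open>Elementary extensions of the expansions\<close>

lemma expressible_iff:
  assumes "expressible L A B d \<Phi> \<Psi>" "expressible L A B d \<Phi>' \<Psi>'"
  shows "expressible L A B d (\<lambda>E. \<Phi> E \<longleftrightarrow> \<Phi>' E) (\<lambda>E. \<Psi> E \<longleftrightarrow> \<Psi>' E)"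
  by (rule expressible_cong[OF expressible_conj[OF expressible_imp[OF assms] expressible_imp[OF assms(2,1)]]]) auto

text \<open>Formulas reach products through the graph only; this turns the quantified form back into
  a statement about multiplication.\<close>

lemma ex_mult_rel_iff:
  assumes G: "definable_group L \<Gamma> A" and xy: "x \<in> dom_of \<Gamma> A" "y \<in> dom_of \<Gamma> A"
  shows "(\<exists>z\<in>power_of A (dim \<Gamma>). z \<in> dom_of \<Gamma> A \<and> mult_rel \<Gamma> A x y z \<and> z \<in> U) \<longleftrightarrow>
    x \<otimes>\<^bsub>group_of \<Gamma> A\<^esub> y \<in> U"
proof -
  interpret group "group_of \<Gamma> A" by (rule definable_group_group[OF G])
  have D: "x \<otimes>\<^bsub>group_of \<Gamma> A\<^esub> y \<in> dom_of \<Gamma> A" using m_closed xy by (simp add: carrier_group_of)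
  then have "x \<otimes>\<^bsub>group_of \<Gamma> A\<^esub> y \<in> power_of A (dim \<Gamma>)" using dom_of_subset by blast
  then show ?thesis using mult_rel_iff[OF G xy] D by auto
qed

context
  fixes L :: "('f, 'r) lang" and \<MM> M N :: "('f, 'r, 'a) struct" and \<iota> \<Gamma> d \<L> \<A> \<B> st
  assumes \<iota>: "\<And>P. P \<in> Def_ext L \<MM> M \<Longrightarrow> \<iota> P \<in> Def_ext L \<MM> N \<and> fst (\<iota> P) = fst P"
    and elem: "elem_substruct (ext_lang L \<MM> M) (ext_struct M) (reduct_along \<iota> (ext_struct N))"
    and MN: "elem_substruct L M N" and NM: "elem_substruct L N \<MM>" and MM: "elem_substruct L M \<MM>"
    and G: "definable_group L \<Gamma> M"
  defines "d \<equiv> dim \<Gamma>" and "\<L> \<equiv> ext_lang L \<MM> M" and "\<A> \<equiv> ext_struct M"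
    and "\<B> \<equiv> reduct_along \<iota> (ext_struct N)" and "st \<equiv> \<lambda>U. snd (\<iota> (dim \<Gamma>, U))"
begin

lemma group_wf: "group_fms_wf L \<Gamma>"
  by (rule definable_group_wf[OF G])

lemma group_N: "definable_group L \<Gamma> N"
  by (rule definable_group_transfer[OF MN G])

lemma expansion_elem: "elem_substruct \<L> \<A> \<B>"
  using elem unfolding \<L>_def \<A>_def \<B>_def .

lemma univ_ext: "univ \<A> = univ M" "univ \<B> = univ N"
  unfolding \<A>_def \<B>_def ext_struct_def reduct_along_def by simp_all

lemma power_ext: "power_of \<A> k = power_of M k" "power_of \<B> k = power_of N k"
  unfolding power_of_def by (simp_all add: univ_ext)

lemma expressible_expand:
  assumes "expressible L M N k \<Phi> \<Psi>"
  shows "expressible \<L> \<A> \<B> k \<Phi> \<Psi>"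
proof -
  obtain \<phi> where \<phi>: "wf_fm L \<phi>"
    "\<And>e. range e \<subseteq> univ M \<Longrightarrow> sat M \<phi> e \<longleftrightarrow> \<Phi> (blocks k e)"
    "\<And>e. range e \<subseteq> univ N \<Longrightarrow> sat N \<phi> e \<longleftrightarrow> \<Psi> (blocks k e)"
    using assms unfolding expressible_def by blast
  have "wf_fm \<L> (map_fm id Inl \<phi>)"
    by (rule wf_map_fm[OF _ _ _ \<phi>(1)]) (auto simp: \<L>_def ext_lang_def)
  moreover have "sat \<A> (map_fm id Inl \<phi>) e \<longleftrightarrow> sat M \<phi> e" for e
    by (rule sat_map_fm) (simp_all add: \<A>_def ext_struct_def)
  moreover have "sat \<B> (map_fm id Inl \<phi>) e \<longleftrightarrow> sat N \<phi> e" for e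
    by (rule sat_map_fm) (simp_all add: \<B>_def ext_struct_def reduct_along_def)
  ultimately show ?thesis
    unfolding expressible_def univ_ext using \<phi>(2,3) by (intro exI[of _ "map_fm id Inl \<phi>"]) simp
qed

lemmas dom_ext = expressible_expand[OF expressible_dom[OF group_wf], folded d_def]
  and mult_ext = expressible_expand[OF expressible_mult[OF group_wf], folded d_def]

lemma domD: "x \<in> dom_of \<Gamma> M \<Longrightarrow> x \<in> power_of M d" "x \<in> dom_of \<Gamma> N \<Longrightarrow> x \<in> power_of N d"
  using dom_of_subset d_def by blast+

lemma dom_MN: "x \<in> dom_of \<Gamma> M \<Longrightarrow> x \<in> dom_of \<Gamma> N"
  using dom_of_elem_substruct[OF MN group_wf] by blast

lemma st_Def_ext:
  assumes "U \<in> Def_extG L \<MM> \<Gamma> M"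
  shows "(d, st U) \<in> Def_ext L \<MM> N" "\<iota> (d, U) = (d, st U)"
proof -
  have "(d, U) \<in> Def_ext L \<MM> M" using assms by (simp add: Def_extG_def d_def)
  then have "\<iota> (d, U) \<in> Def_ext L \<MM> N" "fst (\<iota> (d, U)) = d" using \<iota> by fastforce+
  moreover from this(2) show eq: "\<iota> (d, U) = (d, st U)" by (simp add: st_def d_def prod_eq_iff)
  ultimately show "(d, st U) \<in> Def_ext L \<MM> N" by simp
qed

text \<open>The atomic formula with the symbol of \<open>U\<close>. In the reduct along
  \<open>\<iota>\<close> that symbol is interpreted by the one identified with it, which is where
  \<open>st U\<close> comes from.\<close>

lemma expressible_Def_extG:
  assumes U: "U \<in> Def_extG L \<MM> \<Gamma> M"
  shows "expressible \<L> \<A> \<B> d (\<lambda>E. E i \<in> U) (\<lambda>E. E i \<in> st U)"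
proof -
  let ?\<phi> = "Rel (Inr (d, U)) (map Var [0..<d])"
  have "(d, U) \<in> Def_ext L \<MM> M" using U by (simp add: Def_extG_def d_def)
  then have "wf_fm \<L> ?\<phi>" by (simp add: \<L>_def ext_lang_def)
  moreover have "fv_fm ?\<phi> \<subseteq> {..<length [i] * d}" by auto
  ultimately have "expressible \<L> \<A> \<B> d (\<lambda>E. sat \<A> ?\<phi> (nth (concat (map E [i]))))
      (\<lambda>E. sat \<B> ?\<phi> (nth (concat (map E [i]))))"
    by (rule expressible_sat)
  then show ?thesis
  proof (rule expressible_cong)
    have *: "map (eval_tm C (nth x)) (map Var [0..<d]) = x" if "length x = d" for C x
      using that by (intro nth_equalityI) simp_all
    fix E
    show "sat \<A> ?\<phi> (nth (concat (map E [i]))) \<longleftrightarrow> E i \<in> U" if "env_in \<A> d E"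
    proof -
      have "length (E i) = d" using that by (simp add: env_in_def power_of_def)
      then show ?thesis unfolding sat.simps by (simp only: list.map concat.simps append_Nil2 *) (simp add: \<A>_def ext_struct_def)
    qed
    show "sat \<B> ?\<phi> (nth (concat (map E [i]))) \<longleftrightarrow> E i \<in> st U" if "env_in \<B> d E"
    proof -
      have "length (E i) = d" using that by (simp add: env_in_def power_of_def)
      then show ?thesis unfolding sat.simps
        by (simp only: list.map concat.simps append_Nil2 *) (simp add: \<B>_def ext_struct_def reduct_along_def st_Def_ext(2)[OF U])
    qed
  qed
qed

text \<open>The identification only promises an externally definable subset of the power;
  containment in the group is a sentence true in the expansion of M.\<close>

lemma st_subset:
  assumes U: "U \<in> Def_extG L \<MM> \<Gamma> M"
  shows "st U \<subseteq> dom_of \<Gamma> N"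
proof
  fix x assume x: "x \<in> st U"
  then have "env_in \<B> d (\<lambda>_. x)"
    using st_Def_ext(1)[OF U] by (auto simp: Def_ext_def env_in_def power_ext)
  moreover have "E 0 \<in> U \<longrightarrow> E 0 \<in> dom_of \<Gamma> M" for E :: "nat \<Rightarrow> 'a list"
    using Def_extG_subset[OF U] by blast
  ultimately have "x \<in> st U \<longrightarrow> x \<in> dom_of \<Gamma> N"
    by (rule expressible_valid_closed[OF expansion_elem expressible_imp[OF expressible_Def_extG[OF U] dom_ext], of 0 0 "\<lambda>_. x", rotated])
  then show "x \<in> dom_of \<Gamma> N" using x by blast
qed

text \<open>For the trace of a set over N the same formula and parameters work over M. The laws for
  \<open>st\<close> are sentences of the expanded language, with \<open>g\<close> as a parameter in
  the case of shifts.\<close>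

lemma group_set_algebra_extension_Def_extG:
  assumes M: "group_set_algebra (group_of \<Gamma> M) (Def_extG L \<MM> \<Gamma> M)"
    and N: "group_set_algebra (group_of \<Gamma> N) (Def_extG L \<MM> \<Gamma> N)"
  shows "group_set_algebra_extension (group_of \<Gamma> M) (group_of \<Gamma> N) (Def_extG L \<MM> \<Gamma> M) (Def_extG L \<MM> \<Gamma> N) st"
proof -
  let ?DM = "Def_extG L \<MM> \<Gamma> M" and ?DN = "Def_extG L \<MM> \<Gamma> N"
  interpret M: group_set_algebra "group_of \<Gamma> M" ?DM by (rule M)
  note U_ext = expressible_Def_extG
  have ext_eq: "st U = V"
    if "U \<in> ?DM" "V \<subseteq> dom_of \<Gamma> N" "\<And>x. x \<in> dom_of \<Gamma> N \<Longrightarrow> x \<in> st U \<longleftrightarrow> x \<in> V" for U V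
    using that st_subset[OF that(1)] by blast
  show ?thesis
  proof (intro group_set_algebra_extension.intro M N group_set_algebra_extension_axioms.intro)
    show "carrier (group_of \<Gamma> M) \<subseteq> carrier (group_of \<Gamma> N)"
      using dom_MN by (auto simp: carrier_group_of)
    show "x \<otimes>\<^bsub>group_of \<Gamma> N\<^esub> y = x \<otimes>\<^bsub>group_of \<Gamma> M\<^esub> y"
      if "x \<in> carrier (group_of \<Gamma> M)" "y \<in> carrier (group_of \<Gamma> M)" for x y
      using mult_elem_substruct[OF MN G] that by (simp add: carrier_group_of)
    show "V \<inter> carrier (group_of \<Gamma> M) \<in> ?DM" if V: "V \<in> ?DN" for V
    proof -
      obtain \<phi> cs where \<phi>: "(\<phi>, cs) \<in> param_fms L (dim \<Gamma>) (univ \<MM>)"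
        and "V = {x \<in> dom_of \<Gamma> N. sat \<MM> \<phi> (nth (x @ cs))}"
        using V unfolding Def_extG_iff[OF group_wf NM] by blast
      then have "V \<inter> carrier (group_of \<Gamma> M) = {x \<in> dom_of \<Gamma> M. sat \<MM> \<phi> (nth (x @ cs))}"
        using dom_MN by (auto simp: carrier_group_of)
      then show ?thesis unfolding Def_extG_iff[OF group_wf MM] using \<phi> by blast
    qed
    show "st U \<in> ?DN" if "U \<in> ?DM" for U
      using st_Def_ext(1)[OF that] st_subset[OF that] by (simp add: Def_extG_def d_def carrier_group_of)
    show "st (carrier (group_of \<Gamma> M) - U) = carrier (group_of \<Gamma> N) - st U" if U: "U \<in> ?DM" for U
      unfolding carrier_group_of
    proof (rule ext_eq)
      show D: "dom_of \<Gamma> M - U \<in> ?DM" using M.compl[OF U] by (simp add: carrier_group_of)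
      fix x assume x: "x \<in> dom_of \<Gamma> N"
      then have "env_in \<B> d (\<lambda>_. x)" by (simp add: env_in_def power_ext domD)
      then have "x \<in> st (dom_of \<Gamma> M - U) \<longleftrightarrow> x \<in> dom_of \<Gamma> N \<and> x \<notin> st U"
        using expressible_valid_closed[OF expansion_elem expressible_iff[OF U_ext[OF D] expressible_conj[OF dom_ext expressible_neg[OF U_ext[OF U]]]],
            of 0 0 0 "\<lambda>_. x"] by simp
      then show "x \<in> st (dom_of \<Gamma> M - U) \<longleftrightarrow> x \<in> dom_of \<Gamma> N - st U" by simp
    qed simp
    show "st (U \<inter> V) = st U \<inter> st V" if U: "U \<in> ?DM" and V: "V \<in> ?DM" for U V
    proof (rule ext_eq)
      show D: "U \<inter> V \<in> ?DM" by (rule M.int[OF U V])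
      show "st U \<inter> st V \<subseteq> dom_of \<Gamma> N" using st_subset[OF U] by blast
      fix x assume x: "x \<in> dom_of \<Gamma> N"
      then have "env_in \<B> d (\<lambda>_. x)" by (simp add: env_in_def power_ext domD)
      then show "x \<in> st (U \<inter> V) \<longleftrightarrow> x \<in> st U \<inter> st V"
        using expressible_valid_closed[OF expansion_elem expressible_iff[OF U_ext[OF D] expressible_conj[OF U_ext[OF U] U_ext[OF V]]],
            of 0 0 0 "\<lambda>_. x"] by simp
    qed
    show "st (shift (group_of \<Gamma> M) g U) = shift (group_of \<Gamma> N) g (st U)"
      if g: "g \<in> carrier (group_of \<Gamma> M)" and U: "U \<in> ?DM" for g U
    proof (rule ext_eq)
      let ?V = "shift (group_of \<Gamma> M) g U"
      show D: "?V \<in> ?DM" by (rule M.shift_closed[OF g U])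
      show "shift (group_of \<Gamma> N) g (st U) \<subseteq> dom_of \<Gamma> N" by (auto simp: shift_def carrier_group_of)
      have gM: "g \<in> dom_of \<Gamma> M" using g by (simp add: carrier_group_of)
      have gN: "g \<in> dom_of \<Gamma> N" by (rule dom_MN[OF gM])
      fix x assume x: "x \<in> dom_of \<Gamma> N"
      have "expressible \<L> \<A> \<B> d
         (\<lambda>E. E 1 \<in> dom_of \<Gamma> M \<longrightarrow> (E 1 \<in> ?V \<longleftrightarrow> (\<exists>z\<in>power_of \<A> d. (E(2 := z)) 2 \<in> dom_of \<Gamma> M \<and>
            mult_rel \<Gamma> M ((E(2 := z)) 0) ((E(2 := z)) 1) ((E(2 := z)) 2) \<and> (E(2 := z)) 2 \<in> U)))
         (\<lambda>E. E 1 \<in> dom_of \<Gamma> N \<longrightarrow> (E 1 \<in> st ?V \<longleftrightarrow> (\<exists>z\<in>power_of \<B> d. (E(2 := z)) 2 \<in> dom_of \<Gamma> N \<and>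
            mult_rel \<Gamma> N ((E(2 := z)) 0) ((E(2 := z)) 1) ((E(2 := z)) 2) \<and> (E(2 := z)) 2 \<in> st U)))"
        by (rule expressible_imp[OF dom_ext expressible_iff[OF U_ext[OF D]
            expressible_Bex[OF expressible_conj[OF dom_ext expressible_conj[OF mult_ext U_ext[OF U]]]]]])
      \<comment> \<open>Block 0 holds the parameter \<open>g\<close> from M and stays fixed through
        \<open>{0}\<close>; block 1 ranges over the larger group.\<close>
      note val = expressible_valid[OF expansion_elem this, of "\<lambda>_. g" "{0}" "(\<lambda>_. g)(1 := x)", simplified]
      have "x \<in> dom_of \<Gamma> N \<longrightarrow> (x \<in> st ?V \<longleftrightarrow> (\<exists>z\<in>power_of \<B> d. z \<in> dom_of \<Gamma> N \<and>
            mult_rel \<Gamma> N g x z \<and> z \<in> st U))"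
      proof (rule val)
        show "env_in \<A> d (\<lambda>_. g)" using domD(1)[OF gM] by (simp add: env_in_def power_ext)
        show "env_in \<B> d ((\<lambda>_. g)(Suc 0 := x))" using domD(2)[OF gN] domD(2)[OF x] by (simp add: env_in_def power_ext)
        fix E :: "nat \<Rightarrow> 'a list" assume "E 0 = g"
        then show "E (Suc 0) \<in> dom_of \<Gamma> M \<longrightarrow> (E (Suc 0) \<in> ?V \<longleftrightarrow> (\<exists>z\<in>power_of \<A> d. z \<in> dom_of \<Gamma> M \<and>
            mult_rel \<Gamma> M g (E (Suc 0)) z \<and> z \<in> U))"
          using ex_mult_rel_iff[OF G gM, of "E (Suc 0)" U]
          by (simp add: shift_def carrier_group_of power_ext d_def)
      qed
      then show "x \<in> st ?V \<longleftrightarrow> x \<in> shift (group_of \<Gamma> N) g (st U)"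
        using ex_mult_rel_iff[OF group_N gN x, of "st U"] x by (simp add: shift_def carrier_group_of power_ext d_def)
    qed
    fix n :: nat and As Ds hs
    assume AD: "\<And>i. i < n \<Longrightarrow> As i \<in> ?DM \<and> Ds i \<in> ?DM"
      and fip: "\<And>gs. \<forall>i<n. gs i \<in> Ds i \<Longrightarrow> \<exists>x\<in>carrier (group_of \<Gamma> M). \<forall>i<n. gs i \<otimes>\<^bsub>group_of \<Gamma> M\<^esub> x \<in> As i"
      and hs: "\<forall>i<n. hs i \<in> st (Ds i)"
    have hD: "hs i \<in> dom_of \<Gamma> N" if "i < n" for i using hs that st_subset AD by blast
    \<comment> \<open>A template for both structures: blocks below \<open>n\<close> hold the
      translating elements, block \<open>n\<close> the common witness \<open>x\<close>, and block
      \<open>Suc n\<close> the current product.\<close>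
    let ?F = "\<lambda>K P st E. (\<forall>i\<in>{..<n}. E i \<in> st (Ds i)) \<longrightarrow> (\<exists>x\<in>P. (E(n := x)) n \<in> dom_of \<Gamma> K \<and>
      (\<forall>i\<in>{..<n}. \<exists>z\<in>P. (E(n := x, Suc n := z)) (Suc n) \<in> dom_of \<Gamma> K \<and>
        mult_rel \<Gamma> K ((E(n := x, Suc n := z)) i) ((E(n := x, Suc n := z)) n) ((E(n := x, Suc n := z)) (Suc n)) \<and>
        (E(n := x, Suc n := z)) (Suc n) \<in> st (As i)))"
    have "expressible \<L> \<A> \<B> d (?F M (power_of \<A> d) (\<lambda>U. U)) (?F N (power_of \<B> d) st)"
    proof (rule expressible_imp)
      show "expressible \<L> \<A> \<B> d (\<lambda>E. \<forall>i\<in>{..<n}. E i \<in> Ds i) (\<lambda>E. \<forall>i\<in>{..<n}. E i \<in> st (Ds i))"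
        by (intro expressible_Ball U_ext) (use AD in auto)
      have "expressible \<L> \<A> \<B> d
        (\<lambda>E. \<exists>z\<in>power_of \<A> d. (E(Suc n := z)) (Suc n) \<in> dom_of \<Gamma> M \<and>
          mult_rel \<Gamma> M ((E(Suc n := z)) i) ((E(Suc n := z)) n) ((E(Suc n := z)) (Suc n)) \<and>
          (E(Suc n := z)) (Suc n) \<in> As i)
        (\<lambda>E. \<exists>z\<in>power_of \<B> d. (E(Suc n := z)) (Suc n) \<in> dom_of \<Gamma> N \<and>
          mult_rel \<Gamma> N ((E(Suc n := z)) i) ((E(Suc n := z)) n) ((E(Suc n := z)) (Suc n)) \<and>
          (E(Suc n := z)) (Suc n) \<in> st (As i))" if "i \<in> {..<n}" for i
        by (rule expressible_Bex[OF expressible_conj[OF dom_ext expressible_conj[OF mult_ext U_ext]]])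
          (use AD that in auto)
      from expressible_Ball[OF finite_lessThan this]
      show "expressible \<L> \<A> \<B> d
        (\<lambda>E. \<exists>x\<in>power_of \<A> d. (E(n := x)) n \<in> dom_of \<Gamma> M \<and>
          (\<forall>i\<in>{..<n}. \<exists>z\<in>power_of \<A> d. (E(n := x, Suc n := z)) (Suc n) \<in> dom_of \<Gamma> M \<and>
            mult_rel \<Gamma> M ((E(n := x, Suc n := z)) i) ((E(n := x, Suc n := z)) n) ((E(n := x, Suc n := z)) (Suc n)) \<and>
            (E(n := x, Suc n := z)) (Suc n) \<in> As i))
        (\<lambda>E. \<exists>x\<in>power_of \<B> d. (E(n := x)) n \<in> dom_of \<Gamma> N \<and>
          (\<forall>i\<in>{..<n}. \<exists>z\<in>power_of \<B> d. (E(n := x, Suc n := z)) (Suc n) \<in> dom_of \<Gamma> N \<and>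
            mult_rel \<Gamma> N ((E(n := x, Suc n := z)) i) ((E(n := x, Suc n := z)) n) ((E(n := x, Suc n := z)) (Suc n)) \<and>
            (E(n := x, Suc n := z)) (Suc n) \<in> st (As i)))"
        by (rule expressible_Bex[OF expressible_conj[OF dom_ext]])
    qed
    note val = expressible_valid_closed[OF expansion_elem this]
    have F_iff: "?F K P st' E \<longleftrightarrow> ((\<forall>i<n. E i \<in> st' (Ds i)) \<longrightarrow>
        (\<exists>x\<in>dom_of \<Gamma> K. \<forall>i<n. E i \<otimes>\<^bsub>group_of \<Gamma> K\<^esub> x \<in> st' (As i)))"
      if K: "definable_group L \<Gamma> K" "P = power_of K d" and st': "\<And>i. i < n \<Longrightarrow> st' (Ds i) \<subseteq> dom_of \<Gamma> K" for K P st' E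
    proof -
      have ex: "(\<exists>z\<in>P. z \<in> dom_of \<Gamma> K \<and> mult_rel \<Gamma> K (E i) x z \<and> z \<in> st' (As i)) \<longleftrightarrow>
          E i \<otimes>\<^bsub>group_of \<Gamma> K\<^esub> x \<in> st' (As i)" if "E i \<in> dom_of \<Gamma> K" "x \<in> dom_of \<Gamma> K" for i x
        unfolding K(2) d_def by (rule ex_mult_rel_iff[OF K(1) that])
      have upd: "(E(n := x, Suc n := z)) i = E i" "(E(n := x, Suc n := z)) n = x" if "i < n" for i x z
        using that by auto
      show ?thesis
      proof (cases "\<forall>i<n. E i \<in> st' (Ds i)")
        case True
        then have "E i \<in> dom_of \<Gamma> K" if "i < n" for i using st' that by blast
        then have "(\<exists>x\<in>P. x \<in> dom_of \<Gamma> K \<and> (\<forall>i<n. \<exists>z\<in>P. z \<in> dom_of \<Gamma> K \<and> mult_rel \<Gamma> K (E i) x z \<and> z \<in> st' (As i))) \<longleftrightarrow>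
            (\<exists>x\<in>P. x \<in> dom_of \<Gamma> K \<and> (\<forall>i<n. E i \<otimes>\<^bsub>group_of \<Gamma> K\<^esub> x \<in> st' (As i)))"
          using ex by (intro bex_cong refl conj_cong all_cong) auto
        also have "\<dots> \<longleftrightarrow> (\<exists>x\<in>dom_of \<Gamma> K. \<forall>i<n. E i \<otimes>\<^bsub>group_of \<Gamma> K\<^esub> x \<in> st' (As i))"
          using dom_of_subset[of \<Gamma> K] unfolding K(2) d_def by blast
        finally show ?thesis using True by (simp add: upd Ball_def)
      next
        case False
        then have "\<not> (\<forall>i\<in>{..<n}. E i \<in> st' (Ds i))" by auto
        then show ?thesis using False by (simp only: simp_thms)
      qed
    qed
    have sub: "st (Ds i) \<subseteq> dom_of \<Gamma> N" "Ds i \<subseteq> dom_of \<Gamma> M" if "i < n" for i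
      using st_subset Def_extG_subset AD[OF that] by blast+
    have valM: "?F M (power_of \<A> d) (\<lambda>U. U) E" for E
      by (rule iffD2[OF F_iff[OF G power_ext(1), of "\<lambda>U. U" E] impI])
        (use sub(2) fip[of E] in \<open>simp_all only: carrier_group_of\<close>)
    obtain c where c: "c \<in> univ N" using elem_substruct_nonempty[OF NM] by blast
    \<comment> \<open>Blocks from \<open>n\<close> on receive a constant tuple so that the
      environment stays in the power.\<close>
    let ?E = "\<lambda>i. if i < n then hs i else replicate d c"
    have "replicate d c \<in> power_of N d" using c by (auto simp: power_of_def)
    then have "env_in \<B> d ?E" using domD(2)[OF hD] by (simp add: env_in_def power_ext)
    from val[OF valM this]
    have "?F N (power_of \<B> d) st ?E" .
    then have "\<exists>x\<in>dom_of \<Gamma> N. \<forall>i<n. ?E i \<otimes>\<^bsub>group_of \<Gamma> N\<^esub> x \<in> st (As i)"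
      using iffD1[OF F_iff[OF group_N power_ext(2), of st ?E]] sub(1) hs by simp
    then show "\<exists>x\<in>carrier (group_of \<Gamma> N). \<forall>i<n. hs i \<otimes>\<^bsub>group_of \<Gamma> N\<^esub> x \<in> st (As i)"
      unfolding carrier_group_of by (elim bexE) (auto intro!: bexI)
  qed
qed

end

theorem theorem3p4:
  fixes L :: "('f, 'r) lang" and \<kappa> :: "'k rel"
    and \<MM> M N :: "('f, 'r, 'a) struct" and \<Gamma> :: "('f, 'r) group_fms"
  assumes "monster L \<kappa> \<MM>"
    and "small_model L \<kappa> \<MM> M" and "small_model L \<kappa> \<MM> N"
    and "definable_group L \<Gamma> M" and "infinite (carrier (group_of \<Gamma> M))"
    and "star_elem_substruct L \<MM> M N"
    and "\<forall>I. minimal_left_ideal (S_extG L \<MM> \<Gamma> N) (S_extG_mult L \<MM> \<Gamma> N) I \<longrightarrow>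
           (\<exists>e. group \<lparr>carrier = I, mult = S_extG_mult L \<MM> \<Gamma> N, one = e\<rparr>)"
  shows "\<forall>E \<in> Ellis_groups (S_extG L \<MM> \<Gamma> M) (S_extG_mult L \<MM> \<Gamma> M).
           \<exists>H \<in> Ellis_groups (S_extG L \<MM> \<Gamma> N) (S_extG_mult L \<MM> \<Gamma> N).
             \<exists>K. subgroup K H \<and> closedin (S_extG_topology L \<MM> \<Gamma> N) K \<and>
                 E \<cong> H\<lparr>carrier := K\<rparr>"
proof
  fix E assume E: "E \<in> Ellis_groups (S_extG L \<MM> \<Gamma> M) (S_extG_mult L \<MM> \<Gamma> M)"
  have MM: "elem_substruct L M \<MM>" and NM: "elem_substruct L N \<MM>"
    using assms(2,3) by (auto simp: small_model_def)
  have MN: "elem_substruct L M N" using assms(6) by (simp add: star_elem_substruct_def)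
  obtain \<iota> where \<iota>: "\<forall>P\<in>Def_ext L \<MM> M. \<iota> P \<in> Def_ext L \<MM> N \<and> fst (\<iota> P) = fst P"
    and elem: "elem_substruct (ext_lang L \<MM> M) (ext_struct M) (reduct_along \<iota> (ext_struct N))"
    using assms(6) unfolding star_elem_substruct_def by blast
  have GN: "definable_group L \<Gamma> N" by (rule definable_group_transfer[OF MN assms(4)])
  interpret group_set_algebra_extension "group_of \<Gamma> M" "group_of \<Gamma> N" "Def_extG L \<MM> \<Gamma> M" "Def_extG L \<MM> \<Gamma> N"
    "\<lambda>U. snd (\<iota> (dim \<Gamma>, U))"
    by (rule group_set_algebra_extension_Def_extG[OF bspec[OF \<iota>] elem MN NM MM assms(4)
          group_set_algebra_Def_extG[OF assms(1,2,4)] group_set_algebra_Def_extG[OF assms(1,3) GN]])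
  show "\<exists>H \<in> Ellis_groups (S_extG L \<MM> \<Gamma> N) (S_extG_mult L \<MM> \<Gamma> N).
      \<exists>K. subgroup K H \<and> closedin (S_extG_topology L \<MM> \<Gamma> N) K \<and> E \<cong> H\<lparr>carrier := K\<rparr>"
    using Ellis_group_embeds[of E] E assms(7)
    unfolding S_extG_def S_extG_mult_def S_extG_topology_def by blast
qed

end
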